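(* Let $x_0\in\mathrm{int}(P)$ and $\gamma\in(0,1)$, and let $$\epsilon:=\min\left\{\frac{\lambda_0^2\rho_0^2}{2m^2},\ \frac{\lambda_0^2r_0^2}{8m^2L_{\mathrm{ctr}}^2},\ \frac{\lambda_0^2(1-q_0)^2}{2m^2L_0^2L_{\mathrm{ctr}}^2},\ \frac{\lambda_0^2(1-q_0)^2\log(1/\gamma)^2}{32m^2L_0^2L_{\mathrm{ctr}}^2},\ \frac{\lambda_0^2\log(1/\gamma)^2}{32m^2L_{\mathrm{vol}}^2}\right\},$$ $$N_\gamma:=\left\lceil\frac{\log^+\bigl(2\delta_v(x_0)/\log(1/\gamma)\bigr)}{\log(1/q_0)}\right\rceil,\qquad \zeta_\gamma:=\min\left\{\frac12,\frac{\epsilon}{n+1}\right\}.$$ Run the inexact polarity process from $x_0$ for $N_\gamma+1$ updates, using the WA-TY method to strong $\zeta_\gamma$-accuracy at each realized outer point $x_k$ (and the recovered lifted matrix as oracle output). Afterward define $$C_{\mathrm{WA},\gamma}:=\max_{0\le k\le N_\gamma}C_{\mathrm{WA}}(x_k),\qquad J_\gamma:=\max_{0\le k\le N_\gamma}J(x_k).$$ Then the last ellipsoid $\mathcal E(x_{N_\gamma+1},E_{N_\gamma+1})$ is $\gamma$-maximal, and the total number of arithmetic operations in the dense implementation model is $$\mathcal O\left((N_\gamma+1)\,m(n+1)^2\left[J_\gamma+56\,C_{\mathrm{WA},\gamma}\log\left(\frac1{\zeta_\gamma}\right)\right]\right).$$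
   Context: $P=\{x\in\mathbb R^n: a_i^\top x\le 1,\ i=1,\dots,m\}$ is a full-dimensional (bounded) polytope. For $c\in\mathbb R^n$ and $Q$ symmetric positive definite, $\mathcal E(c,Q)=\{y:(y-c)^\top Q(y-c)\le 1\}$, with normalized volume $\mathrm{Vol}(\mathcal E(c,Q))=\det(Q)^{-1/2}$. $S^\circ=\{y: y^\top s\le1\ \forall s\in S\}$. $\mathrm{MinCE}(K)$ is the unique minimum-volume ellipsoid containing $K$; $\mathrm{MaxIE}(P)$ is the unique maximum-volume ellipsoid contained in $P$, with center $x^*$. An ellipsoid $\mathcal E\subseteq P$ is $\gamma$-maximal if $\mathrm{Vol}(\mathcal E)\ge\gamma\mathrm{Vol}(\mathrm{MaxIE}(P))$. For $x\in\mathrm{int}(P)$: $v(x)=\log\mathrm{Vol}(\mathrm{MinCE}((P-x)^\circ))$, $\delta_v(x)=v(x)-v(x^* )$. $\log^+(t)=\max\{0,\log t\}$ for $t>0$, $\log^+(0)=0$. Lifted problem at $x\in\mathrm{int}(P)$: with $\tilde a_i(x)=a_i/(1-a_i^\top x)$ and $h_i(x)=(\tilde a_i(x)^\top,1)^\top$, minimize $-\log\det\mathcal Q$ over symmetric positive definite $\mathcal Q\in\mathbb R^{(n+1)\times(n+1)}$ subject to $h_i(x)^\top\mathcal Qh_i(x)\le1$ for all $i\in[m]$. Its unique optimizer is $\mathcal Q(x)=\begin{bmatrix} G(x) & z(x) \\ z(x)^\top & s(x) \end{bmatrix}$. Put $\beta(x)=1-s(x)+z(x)^\top G(x)^{-1}z(x)$,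 $$\mathcal K(x)=x+\frac{z(x)}{1-s(x)},\quad E(x)=(1-s(x))\Bigl(G(x)^{-1}-\frac{G(x)^{-1}z(x)z(x)^\top G(x)^{-1}}{\beta(x)}\Bigr).$$ For any feasible $\widehat{\mathcal Q}(x)$ with blocks $\widehat G(x),\widehat z(x),\widehat s(x)$ define $\widehat\beta(x),\widehat{\mathcal K}(x),\widehat E(x)$ by the same formulas with hats. Inexact polarity process: for $k=0,1,\dots$ an oracle returns a feasible point $\widehat{\mathcal Q}(x_k)$ of the lifted problem at $x_k$; set $x_{k+1}=\widehat{\mathcal K}(x_k)$, $E_{k+1}=\widehat E(x_k)$. Tolerance $\epsilon$ means $-\log\det\widehat{\mathcal Q}(x_k)\le-\log\det\mathcal Q(x_k)+\epsilon$. WA-TY oracle. Let $d=n+1$, $\Delta_m=\{\lambda\in\mathbb R^m_+:\sum_i\lambda_i=1\}$, $\mathsf M(x,\lambda)=\sum_i\lambda_ih_i(x)h_i(x)^\top$, and, when $\mathsf M(x,\lambda)\succ0$, $w_i(x,\lambda)=h_i(x)^\top\mathsf M(x,\lambda)^{-1}h_i(x)$. A point $\lambda\in\Delta_m$ with $\mathsf M(x,\lambda)\succ0$ is a strong $\zeta$-approximate maximizer of $\max_{\lambda\in\Delta_m}\log\det\mathsf M(x,\lambda)$ (strong $\zeta$-accuracy) if $w_i(x,\lambda)\le(1+\zeta)d$ for all $i$ and $w_i(x,\lambda)\ge(1-\zeta)d$ for all $i$ with $\lambda_i>0$. The recovered lifted matrix is $\widehat{\mathcal Q}(x)=\frac{1}{d(1+\zeta)}\mathsf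 M(x,\lambda)^{-1}$. WA-TY (Wolfe–Atwood–Todd–Yıldırım) is the Frank–Wolfe method with away steps for this maximization, initialized at $\lambda_i=1/m$: each iteration takes an exact line-search step toward the vertex $e_j$ maximizing $w_j$ or away from the support vertex minimizing $w_j$ (whichever most violates the pair of inequalities $w_i(x,\lambda)\le(1+\zeta)d$ for all $i$ and $w_i(x,\lambda)\ge(1-\zeta)d$ for all $i$ with $\lambda_i>0$), away steps being truncated to keep $\lambda\ge0$ (drop steps). Known fixed-instance result of Ahipasaoglu, Sun and Todd (2008), used as given: for each $x\in\mathrm{int}(P)$ there are positive data-dependent constants $C_{\mathrm{WA}}(x)$ and $J(x)$ such that for every $\zeta\in(0,1)$ WA-TY needs at most $J(x)+56C_{\mathrm{WA}}(x)\log(1/\zeta)$ iterations to produce a strong $\zeta$-approximate maximizer; $C_{\mathrm{WA}}(x),J(x)$ denote these constants. Dense implementation model: initialization (forming and inverting $\mathsf M$) and each WA-TY iteration (all $m$ leverage scores $w_i$ and the inverse update) cost $\mathcal O(md^2)$ arithmetic operations. Constants (depending on $P$ and $x_0$). Let $\mathcal L=\{x\in\mathrm{int}(P):v(x)\le v(x_0)+1\}$, which is compact. - $q_0\in(0,1)$ is such that $\delta_v(\mathcal K(x))\le q_0\delta_v(x)$ for all $x\in\mathcal L$ (such $q_0$ exists). - $\lambda_0=\min_{x\in\mathcal L}\lambda_{\min}\bigl(\sum_{i=1}^mh_i(x)h_i(x)^\top\bigr)>0$. - $\theta_0,\mu_0,\sigma_0,\beta_0$ are the (positive) minima over $x\in\mathcal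 L$ of $\lambda_{\min}(\mathcal Q(x))$, $\lambda_{\min}(G(x))$, $1-s(x)$, $\beta(x)$, respectively. $\rho_0>0$ is such that for all $x\in\mathcal L$ and all feasible $\widehat{\mathcal Q}(x)$ with $\|\widehat{\mathcal Q}(x)-\mathcal Q(x)\|_F\le\rho_0$: $\lambda_{\min}(\widehat{\mathcal Q}(x))\ge\theta_0/2$, $\lambda_{\min}(\widehat G(x))\ge\mu_0/2$, $1-\widehat s(x)\ge\sigma_0/2$, $\widehat\beta(x)\ge\beta_0/2$; and $L_{\mathrm{ctr}},L_{\mathrm{vol}}>0$ are such that for all such $x,\widehat{\mathcal Q}(x)$: $\|\widehat{\mathcal K}(x)-\mathcal K(x)\|\le L_{\mathrm{ctr}}\|\widehat{\mathcal Q}(x)-\mathcal Q(x)\|_F$ and $|\log\mathrm{Vol}(\mathcal E(\widehat{\mathcal K}(x),\widehat E(x)))-\log\mathrm{Vol}(\mathcal E(\mathcal K(x),E(x)))|\le L_{\mathrm{vol}}\|\widehat{\mathcal Q}(x)-\mathcal Q(x)\|_F$ (such constants exist). - $r_0=\mathrm{dist}(\mathcal K(\mathcal L),\partial P)>0$, $\mathcal V_0=\{y\in\mathbb R^n:\mathrm{dist}(y,\mathcal K(\mathcal L))\le r_0/2\}$, $L_0=\max_{y\in\mathcal V_0}\|\nabla\delta_v(y)\|\in(0,\infty)$.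
   Formalization: The constant in the O-bound is made explicit as c(1+1/J(x_0)), with c the per-iteration cost constant; an absolute constant fails when J and C_WA are tiny and no iterations are needed, since initialization still costs about m(n+1)^2. *)

theory Defs
  imports "HOL-Analysis.Analysis"
begin

definition posdef :: "real^'k^'k \<Rightarrow> bool" where
  "posdef A \<longleftrightarrow> transpose A = A \<and> (\<forall>v. v \<noteq> 0 \<longrightarrow> 0 < v \<bullet> (A *v v))"

definition outer_prod :: "real^'k \<Rightarrow> real^'k^'k" where
  "outer_prod u = (\<chi> i j. u $ i * u $ j)"

text \<open>Only used for symmetric matrices, whose set of real eigenvalues is finite and nonempty,
  so that the infimum is the smallest eigenvalue.\<close>

definition lambda_min :: "real^'k^'k \<Rightarrow> real" where
  "lambda_min A = Inf {\<mu>. \<exists>v. v \<noteq> 0 \<and> A *v v = \<mu> *\<^sub>R v}"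

definition is_min_value :: "('a \<Rightarrow> real) \<Rightarrow> 'a set \<Rightarrow> real \<Rightarrow> bool" where
  "is_min_value f S \<mu> \<longleftrightarrow> (\<exists>x\<in>S. f x = \<mu>) \<and> (\<forall>x\<in>S. \<mu> \<le> f x)"

definition is_max_value :: "('a \<Rightarrow> real) \<Rightarrow> 'a set \<Rightarrow> real \<Rightarrow> bool" where
  "is_max_value f S \<mu> \<longleftrightarrow> (\<exists>x\<in>S. f x = \<mu>) \<and> (\<forall>x\<in>S. f x \<le> \<mu>)"

definition gradient :: "('a::real_inner \<Rightarrow> real) \<Rightarrow> 'a \<Rightarrow> 'a" where
  "gradient f y = (SOME g. GDERIV f y :> g)"

definition log_plus :: "real \<Rightarrow> real" where
  "log_plus t = (if t > 0 then max 0 (ln t) else 0)"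

definition ellipsoid :: "real^'n \<Rightarrow> real^'n^'n \<Rightarrow> (real^'n) set" where
  "ellipsoid c Q = {y. (y - c) \<bullet> (Q *v (y - c)) \<le> 1}"

definition is_ellipsoid :: "(real^'n) set \<Rightarrow> bool" where
  "is_ellipsoid S \<longleftrightarrow> (\<exists>c Q. posdef Q \<and> S = ellipsoid c Q)"

text \<open>Center and shape matrix of an ellipsoid are determined by the set, so center and normalized
  volume are functions of the set.\<close>

definition ellipsoid_center :: "(real^'n) set \<Rightarrow> real^'n" where
  "ellipsoid_center S = (THE c. \<exists>Q. posdef Q \<and> S = ellipsoid c Q)"

definition ellipsoid_vol :: "(real^'n) set \<Rightarrow> real" where
  "ellipsoid_vol S = (THE r. \<exists>c Q. posdef Q \<and> S = ellipsoid c Q \<and> r = det Q powr (-1/2))"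

definition polar_set :: "(real^'n) set \<Rightarrow> (real^'n) set" where
  "polar_set S = {y. \<forall>s\<in>S. y \<bullet> s \<le> 1}"

definition MinCE :: "(real^'n) set \<Rightarrow> (real^'n) set" where
  "MinCE K = arg_min ellipsoid_vol (\<lambda>S. is_ellipsoid S \<and> K \<subseteq> S)"

definition MaxIE :: "(real^'n) set \<Rightarrow> (real^'n) set" where
  "MaxIE K = arg_max ellipsoid_vol (\<lambda>S. is_ellipsoid S \<and> S \<subseteq> K)"

definition gamma_maximal :: "(real^'n) set \<Rightarrow> real \<Rightarrow> (real^'n) set \<Rightarrow> bool" where
  "gamma_maximal K \<gamma> S \<longleftrightarrow>
     is_ellipsoid S \<and> S \<subseteq> K \<and> ellipsoid_vol S \<ge> \<gamma> * ellipsoid_vol (MaxIE K)"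

text \<open>The \<open>m\<close> constraint vectors are indexed by a finite type \<open>'m\<close> with \<open>m = CARD('m)\<close>.\<close>

definition polyP :: "('m::finite \<Rightarrow> real^'n) \<Rightarrow> (real^'n) set" where
  "polyP a = {x. \<forall>i. a i \<bullet> x \<le> 1}"

definition vfun :: "('m::finite \<Rightarrow> real^'n) \<Rightarrow> real^'n \<Rightarrow> real" where
  "vfun a x = ln (ellipsoid_vol (MinCE (polar_set ((\<lambda>p. p - x) ` polyP a))))"

definition delta_v :: "('m::finite \<Rightarrow> real^'n) \<Rightarrow> real^'n \<Rightarrow> real" where
  "delta_v a x = vfun a x - vfun a (ellipsoid_center (MaxIE (polyP a)))"

definition levelL :: "('m::finite \<Rightarrow> real^'n) \<Rightarrow> real^'n \<Rightarrow> (real^'n) set" where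
  "levelL a x0 = {x \<in> interior (polyP a). vfun a x \<le> vfun a x0 + 1}"

text \<open>Coordinates of the \<open>(n+1)\<close>-dimensional lifted space are indexed by \<open>'n option\<close>, with
  \<open>None\<close> as the last coordinate. The norm of the type \<open>real^'k^'k\<close> is the Frobenius norm.\<close>

definition hvec :: "('m::finite \<Rightarrow> real^'n) \<Rightarrow> real^'n \<Rightarrow> 'm \<Rightarrow> real^('n option)" where
  "hvec a x i = (\<chi> k. case k of Some j \<Rightarrow> a i $ j / (1 - a i \<bullet> x) | None \<Rightarrow> 1)"

definition lifted_feasible ::
  "('m::finite \<Rightarrow> real^'n) \<Rightarrow> real^'n \<Rightarrow> real^('n option)^('n option) \<Rightarrow> bool" where
  "lifted_feasible a x Q \<longleftrightarrow> posdef Q \<and> (\<forall>i. hvec a x i \<bullet> (Q *v hvec a x i) \<le> 1)"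

definition Qopt :: "('m::finite \<Rightarrow> real^'n) \<Rightarrow> real^'n \<Rightarrow> real^('n option)^('n option)" where
  "Qopt a x = arg_min (\<lambda>Q. - ln (det Q)) (lifted_feasible a x)"

definition blkG :: "real^('n::finite option)^('n option) \<Rightarrow> real^'n^'n" where
  "blkG Q = (\<chi> i j. Q $ Some i $ Some j)"

definition blkz :: "real^('n::finite option)^('n option) \<Rightarrow> real^'n" where
  "blkz Q = (\<chi> i. Q $ Some i $ None)"

definition blks :: "real^('n::finite option)^('n option) \<Rightarrow> real" where
  "blks Q = Q $ None $ None"

definition betaQ :: "real^('n::finite option)^('n option) \<Rightarrow> real" where
  "betaQ Q = 1 - blks Q + blkz Q \<bullet> (matrix_inv (blkG Q) *v blkz Q)"

definition centerK :: "real^'n \<Rightarrow> real^('n option)^('n option) \<Rightarrow> real^'n" where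
  "centerK x Q = x + (1 / (1 - blks Q)) *\<^sub>R blkz Q"

definition shapeE :: "real^('n option)^('n option) \<Rightarrow> real^'n^'n" where
  "shapeE Q = (1 - blks Q) *\<^sub>R
     (matrix_inv (blkG Q) -
      (1 / betaQ Q) *\<^sub>R (matrix_inv (blkG Q) ** outer_prod (blkz Q) ** matrix_inv (blkG Q)))"

definition Kmap :: "('m::finite \<Rightarrow> real^'n) \<Rightarrow> real^'n \<Rightarrow> real^'n" where
  "Kmap a x = centerK x (Qopt a x)"

definition simplexD :: "(real^'m) set" where
  "simplexD = {l. (\<forall>i. 0 \<le> l $ i) \<and> (\<Sum>i\<in>UNIV. l $ i) = 1}"

definition Mmat ::
  "('m::finite \<Rightarrow> real^'n) \<Rightarrow> real^'n \<Rightarrow> real^'m \<Rightarrow> real^('n option)^('n option)" where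
  "Mmat a x l = (\<Sum>i\<in>UNIV. l $ i *\<^sub>R outer_prod (hvec a x i))"

definition lev :: "('m::finite \<Rightarrow> real^'n) \<Rightarrow> real^'n \<Rightarrow> real^'m \<Rightarrow> 'm \<Rightarrow> real" where
  "lev a x l i = hvec a x i \<bullet> (matrix_inv (Mmat a x l) *v hvec a x i)"

definition strong_approx ::
  "('m::finite \<Rightarrow> real^'n) \<Rightarrow> real^'n \<Rightarrow> real \<Rightarrow> real^'m \<Rightarrow> bool" where
  "strong_approx a x \<zeta> l \<longleftrightarrow>
     l \<in> simplexD \<and> posdef (Mmat a x l) \<and>
     (\<forall>i. lev a x l i \<le> (1 + \<zeta>) * (real CARD('n) + 1)) \<and>
     (\<forall>i. l $ i > 0 \<longrightarrow> lev a x l i \<ge> (1 - \<zeta>) * (real CARD('n) + 1))"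

definition recovered ::
  "('m::finite \<Rightarrow> real^'n) \<Rightarrow> real^'n \<Rightarrow> real \<Rightarrow> real^'m \<Rightarrow> real^('n option)^('n option)" where
  "recovered a x \<zeta> l =
     (1 / ((real CARD('n) + 1) * (1 + \<zeta>))) *\<^sub>R matrix_inv (Mmat a x l)"

text \<open>Exact line search for \<open>log det M\<close> from \<open>l\<close> along \<open>u\<close>, over the steps that stay in the
  simplex. As \<open>log det M\<close> is concave along the line, this is the unrestricted exact step,
  truncated where it would leave the simplex.\<close>

definition exact_step ::
  "('m::finite \<Rightarrow> real^'n) \<Rightarrow> real^'n \<Rightarrow> real^'m \<Rightarrow> real^'m \<Rightarrow> real^'m \<Rightarrow> bool" where
  "exact_step a x l u l' \<longleftrightarrow>
     (\<exists>t\<ge>0. l' = l + t *\<^sub>R u) \<and> l' \<in> simplexD \<and> posdef (Mmat a x l') \<and>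
     (\<forall>s\<ge>0. l + s *\<^sub>R u \<in> simplexD \<and> posdef (Mmat a x (l + s *\<^sub>R u)) \<longrightarrow>
        ln (det (Mmat a x (l + s *\<^sub>R u))) \<le> ln (det (Mmat a x l')))"

text \<open>One iteration. With \<open>d = n+1\<close>, the violations of the two accuracy conditions at a vertex \<open>j\<close>
  are \<open>w j - (1+\<zeta>) d\<close> and \<open>(1-\<zeta>) d - w j\<close>; their comparison does not depend on \<open>\<zeta>\<close>, so the
  iteration does not either. Ties may be broken arbitrarily.\<close>

definition waty_step ::
  "('m::finite \<Rightarrow> real^'n) \<Rightarrow> real^'n \<Rightarrow> real^'m \<Rightarrow> real^'m \<Rightarrow> bool" where
  "waty_step a x l l' \<longleftrightarrow>
     (let d = real CARD('n) + 1; w = lev a x l in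
       \<exists>j. ((\<forall>i. w i \<le> w j) \<and> (\<forall>i. l $ i > 0 \<longrightarrow> d - w i \<le> w j - d) \<and>
            exact_step a x l (axis j 1 - l) l')
         \<or> (l $ j > 0 \<and> (\<forall>i. l $ i > 0 \<longrightarrow> w j \<le> w i) \<and> (\<forall>i. w i - d \<le> d - w j) \<and>
            exact_step a x l (l - axis j 1) l'))"

definition waty_run ::
  "('m::finite \<Rightarrow> real^'n) \<Rightarrow> real^'n \<Rightarrow> (nat \<Rightarrow> real^'m) \<Rightarrow> bool" where
  "waty_run a x L \<longleftrightarrow>
     L 0 = (\<chi> i. 1 / real CARD('m)) \<and> (\<forall>t. waty_step a x (L t) (L (Suc t)))"

text \<open>Number of iterations performed when the run is stopped at the first strong
  \<open>\<zeta>\<close>-approximate maximizer.\<close>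

definition stop_time ::
  "('m::finite \<Rightarrow> real^'n) \<Rightarrow> real^'n \<Rightarrow> real \<Rightarrow> (nat \<Rightarrow> real^'m) \<Rightarrow> nat" where
  "stop_time a x \<zeta> L = (LEAST t. strong_approx a x \<zeta> (L t))"

definition waty_oracle ::
  "('m::finite \<Rightarrow> real^'n) \<Rightarrow> real \<Rightarrow> (real^'n \<Rightarrow> nat \<Rightarrow> real^'m) \<Rightarrow> real^'n \<Rightarrow>
   real^('n option)^('n option)" where
  "waty_oracle a \<zeta> waty x = recovered a x \<zeta> (waty x (stop_time a x \<zeta> (waty x)))"

end

theory Submission
  imports Defs
begin

text \<open>
  Weak duality for determinant maximization turns strong \<open>\<zeta>\<close>-accuracy of the WA-TY output into an
  additive gap \<open>(n + 1) \<zeta> \<le> \<epsilon>\<close> in the lifted problem, and strong convexity of \<open>- ln det\<close> on the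
  feasible set (whose traces are at most \<open>m / \<lambda>\<^sub>0\<close>) turns this gap into the Frobenius distance
  \<open>m / \<lambda>\<^sub>0 * sqrt (2 \<epsilon>)\<close>. With the Lipschitz constants of the center map and of \<open>v\<close>, the
  process then satisfies \<open>\<delta> (k + 1) \<le> q\<^sub>0 \<delta> k + e\<close> with \<open>e \<le> (1 - q\<^sub>0) ln (1 / \<gamma>) / 4\<close>, and \<open>\<delta>\<close> bounds
  the volume deficit of the ellipsoid obtained by polarity.

  The value \<open>v x\<close> is an affine function of the optimal lifted value. It is differentiable because at each point
  it is squeezed between two smooth functions: from below by the dual objective at a fixed optimal
  weight vector, from above by the objective at feasible matrices coming from a fixed inscribed
  ellipsoid.
\<close>

section \<open>Symmetric matrices and simultaneous diagonalization\<close>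

text \<open>Most of the matrix analysis rests on one fact: a positive definite and a symmetric
  matrix are diagonalized by one basis. With the identity as first matrix this is the spectral
  theorem; on a segment of matrices it reduces \<open>ln det\<close> to scalars.
  \<open>arg_min\<close>, \<open>arg_max\<close> and \<open>gradient\<close> are choices, so
  existence comes first: of the lifted optimizer, of the extremal ellipsoids, of the derivative of
  \<open>delta_v\<close>. The last is the main obstacle: \<open>L0\<close> bounds a chosen gradient
  and says nothing about increments of \<open>delta_v\<close> before differentiability on
  \<open>V0\<close> is known. The dual weights of the lower squeeze need equality of primal and dual
  values, which is read off from WA-TY itself, as its accuracy tends to 0. The error budget, with
  \<open>l = ln (1 / \<gamma>)\<close>: \<open>N\<close> contractions bring the initial deficit down
  to \<open>l / 2\<close>, the center errors form a geometric series of sum at most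
  \<open>l / 4\<close>, and the volume error of the last ellipsoid takes \<open>l / 4\<close>. The
  first three terms of \<open>\<epsilon>\<close> keep everything where the constants hold: within
  \<open>\<rho>0\<close> of the optimizer, within \<open>V0\<close>, and in the level set.\<close>

lemma inner_matrix_transpose:
  fixes A :: "real^'n^'m"
  shows "x \<bullet> (A *v y) = (transpose A *v x) \<bullet> y"
  by (simp add: dot_lmul_matrix)

lemma symmetric_inner_commute:
  fixes A :: "real^'k^'k"
  assumes "transpose A = A"
  shows "x \<bullet> (A *v y) = y \<bullet> (A *v x)"
  by (metis assms inner_commute inner_matrix_transpose)

lemma outer_prod_mult_vec: "outer_prod u *v x = (u \<bullet> x) *\<^sub>R u"
  by (simp add: outer_prod_def matrix_vector_mult_def vec_eq_iff inner_vec_def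
      sum_distrib_left sum_distrib_right mult_ac)

lemma transpose_outer_prod [simp]: "transpose (outer_prod u) = outer_prod u"
  by (simp add: outer_prod_def transpose_def vec_eq_iff mult.commute)

lemma transpose_add: "transpose (A + B) = transpose A + transpose B"
  by (simp add: transpose_def vec_eq_iff)

lemma transpose_diff: "transpose (A - B) = transpose A - transpose (B :: real^'k^'l)"
  by (simp add: transpose_def vec_eq_iff)

lemma transpose_sum: "transpose (\<Sum>i\<in>I. f i) = (\<Sum>i\<in>I. transpose (f i))"
  by (induction I rule: infinite_finite_induct) (auto simp: transpose_add, simp_all add: transpose_def vec_eq_iff)

lemma sum_matrix_mult_vec: "(\<Sum>i\<in>I. f i) *v x = (\<Sum>i\<in>I. f i *v (x :: real^'k))"
  by (induction I rule: infinite_finite_induct) (auto simp: matrix_vector_mult_add_rdistrib)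

lemma matrix_mult_vec_sum: "A *v (\<Sum>i\<in>I. f i) = (\<Sum>i\<in>I. A *v (f i :: real^'k))"
  by (rule linear_sum) (rule matrix_vector_mul_linear)

lemma scaleR_matrix_mult_vec: "(c *\<^sub>R A) *v x = c *\<^sub>R (A *v (x :: real^'k))"
  by (simp add: scaleR_matrix_vector_assoc)

lemma sum_outer_prod_mult_vec:
  "(\<Sum>i\<in>I. w i *\<^sub>R outer_prod (v i)) *v x = (\<Sum>i\<in>I. (w i * (v i \<bullet> x)) *\<^sub>R v i)"
  by (simp add: sum_matrix_mult_vec scaleR_matrix_mult_vec outer_prod_mult_vec)

lemma sum_outer_prod_form:
  "x \<bullet> ((\<Sum>i\<in>I. w i *\<^sub>R outer_prod (v i)) *v y) = (\<Sum>i\<in>I. w i * (v i \<bullet> x) * (v i \<bullet> y))"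
  unfolding sum_outer_prod_mult_vec
  by (simp add: inner_sum_right inner_commute mult_ac)

lemma norm_outer_prod: "norm (outer_prod u) = (norm u)\<^sup>2"
proof -
  have "outer_prod u \<bullet> outer_prod u = (u \<bullet> u) * (u \<bullet> u)"
    by (simp add: outer_prod_def inner_vec_def sum_product mult_ac)
  then show ?thesis
    by (simp add: norm_eq_sqrt_inner power2_eq_square real_sqrt_mult)
qed

lemma trace_scaleR: "trace (c *\<^sub>R A) = c * trace (A :: real^'k^'k)"
  by (simp add: trace_def sum_distrib_left)

lemma trace_sum: "trace (\<Sum>i\<in>I. f i) = (\<Sum>i\<in>I. trace (f i :: real^'k^'k))"
  by (induction I rule: infinite_finite_induct) (auto simp: trace_add, simp_all add: trace_def)

lemma trace_outer_prod: "trace (outer_prod u) = u \<bullet> u"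
  by (simp add: trace_def outer_prod_def inner_vec_def)

lemma det_sum_outer_prod:
  fixes v :: "'k::finite \<Rightarrow> real^'k"
  shows "det (\<Sum>i\<in>UNIV. w i *\<^sub>R outer_prod (v i)) = (det (\<chi> r i. v i $ r))\<^sup>2 * (\<Prod>i\<in>UNIV. w i)"
proof -
  define V :: "real^'k^'k" where "V = (\<chi> r i. v i $ r)"
  define D :: "real^'k^'k" where "D = (\<chi> i j. if i = j then w i else 0)"
  have "(\<Sum>i\<in>UNIV. w i *\<^sub>R outer_prod (v i)) = V ** D ** transpose V"
    by (simp add: vec_eq_iff V_def D_def matrix_matrix_mult_def transpose_def outer_prod_def
        if_distrib sum.delta cong: if_cong) (simp add: mult_ac)
  moreover have "det D = (\<Prod>i\<in>UNIV. w i)"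
    by (subst det_diagonal) (auto simp: D_def)
  ultimately show ?thesis
    by (simp add: det_mul power2_eq_square V_def)
qed

lemma linear_coeff_zero_if_quadratic_nonneg:
  fixes b c :: real
  assumes "\<And>t. 0 \<le> 2 * t * b + t\<^sup>2 * c"
  shows "b = 0"
proof (rule ccontr)
  assume "b \<noteq> 0"
  \<comment> \<open>Small enough that at \<open>t = - e * b\<close> the quadratic takes the value
    \<open>- e * b\<^sup>2 * (2 - e * c)\<close>, which is negative.\<close>
  define e where "e = 1 / (1 + \<bar>c\<bar>)"
  have e: "0 < e" "e * c < 2"
    by (auto simp: e_def divide_simps)
  have "2 * (- e * b) * b + (- e * b)\<^sup>2 * c = - (e * b\<^sup>2) * (2 - e * c)"
    by (simp add: power2_eq_square algebra_simps)
  also have "\<dots> < 0"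
    using e \<open>b \<noteq> 0\<close> by (intro mult_neg_pos) auto
  finally show False
    using assms[of "- e * b"] by linarith
qed

text \<open>A null vector of a nonnegative form minimizes it, so the first-order condition makes the
  mixed terms vanish. The diagonalization uses this on a subspace, all later applications on the
  whole space.\<close>

lemma psd_form_zero:
  fixes C :: "real^'k^'k"
  assumes "transpose C = C" "subspace W" "\<And>w. w \<in> W \<Longrightarrow> 0 \<le> w \<bullet> (C *v w)"
    and "v \<in> W" "v \<bullet> (C *v v) = 0" "w \<in> W"
  shows "v \<bullet> (C *v w) = 0"
proof (rule linear_coeff_zero_if_quadratic_nonneg)
  fix t
  have "v + t *\<^sub>R w \<in> W"
    using assms by (simp add: subspace_add subspace_scale)
  then have "0 \<le> (v + t *\<^sub>R w) \<bullet> (C *v (v + t *\<^sub>R w))"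
    using assms by blast
  also have "\<dots> = 2 * t * (v \<bullet> (C *v w)) + t\<^sup>2 * (w \<bullet> (C *v w))"
    using assms(5) symmetric_inner_commute[OF assms(1), of w v]
    by (simp add: matrix_vector_right_distrib matrix_vector_mult_scaleR inner_add_left
        inner_add_right power2_eq_square algebra_simps)
  finally show "0 \<le> 2 * t * (v \<bullet> (C *v w)) + t\<^sup>2 * (w \<bullet> (C *v w))" .
qed

lemma continuous_on_matrix_mult_vec [continuous_intros]:
  fixes A :: "'a::topological_space \<Rightarrow> real^'k^'l"
  assumes "continuous_on S A" "continuous_on S f"
  shows "continuous_on S (\<lambda>x. A x *v f x)"
  unfolding matrix_vector_mult_def by (intro continuous_intros assms)

lemma posdefD:
  assumes "posdef A"
  shows "transpose A = A" "v \<noteq> 0 \<Longrightarrow> 0 < v \<bullet> (A *v v)" "0 \<le> v \<bullet> (A *v v)"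
  using assms by (auto simp: posdef_def intro: less_imp_le)
     (metis inner_zero_left less_eq_real_def)

text \<open>Induction adds one vector at a time: a minimizer of the Rayleigh quotient of
  \<open>B\<close> relative to \<open>A\<close> on the \<open>A\<close>-orthogonal complement of the
  vectors found so far. The last clause strengthens the induction: it makes every vector of that
  complement, in particular the new one, \<open>B\<close>-orthogonal to the old ones.\<close>

lemma simultaneous_orthogonal_family:
  fixes A B :: "real^'k^'k" and I :: "'k::finite set"
  assumes A: "posdef A" and B: "transpose B = B"
  shows "\<exists>u. (\<forall>i\<in>I. u i \<bullet> (A *v u i) = 1) \<and>
    (\<forall>i\<in>I. \<forall>j\<in>I. i \<noteq> j \<longrightarrow> u i \<bullet> (A *v u j) = 0 \<and> u i \<bullet> (B *v u j) = 0) \<and>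
    (\<forall>w. (\<forall>j\<in>I. u j \<bullet> (A *v w) = 0) \<longrightarrow> (\<forall>i\<in>I. u i \<bullet> (B *v w) = 0))"
  using finite[of I]
proof (induction I rule: finite_induct)
  case empty
  show ?case by simp
next
  case (insert k I)
  from insert(3) obtain u where "\<forall>i\<in>I. u i \<bullet> (A *v u i) = 1"
    "\<forall>i\<in>I. \<forall>j\<in>I. i \<noteq> j \<longrightarrow> u i \<bullet> (A *v u j) = 0 \<and> u i \<bullet> (B *v u j) = 0"
    "\<forall>w. (\<forall>j\<in>I. u j \<bullet> (A *v w) = 0) \<longrightarrow> (\<forall>i\<in>I. u i \<bullet> (B *v w) = 0)"
    by (elim exE conjE)
  then have u: "\<And>i. i \<in> I \<Longrightarrow> u i \<bullet> (A *v u i) = 1"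
    "\<And>i j. i \<in> I \<Longrightarrow> j \<in> I \<Longrightarrow> i \<noteq> j \<Longrightarrow> u i \<bullet> (A *v u j) = 0 \<and> u i \<bullet> (B *v u j) = 0"
    "\<And>w i. (\<forall>j\<in>I. u j \<bullet> (A *v w) = 0) \<Longrightarrow> i \<in> I \<Longrightarrow> u i \<bullet> (B *v w) = 0"
    by auto
  define W where "W = {w. \<forall>j\<in>I. u j \<bullet> (A *v w) = 0}"
  have subW: "subspace W"
    by (auto simp: W_def subspace_def matrix_vector_right_distrib matrix_vector_mult_scaleR inner_add_right)
  have closedW: "closed W"
  proof -
    have "W = (\<Inter>j\<in>I. {w. u j \<bullet> (A *v w) = 0})"
      by (auto simp: W_def)
    then show ?thesis
      by (auto intro!: closed_Collect_eq continuous_intros)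
  qed
  \<comment> \<open>Since \<open>k\<close> is not in \<open>I\<close>, fewer vectors than the
    dimension have been chosen, so the complement \<open>W\<close> is nontrivial.\<close>
  have "dim ((\<lambda>j. A *v u j) ` I) < DIM(real^'k)"
  proof -
    have "dim ((\<lambda>j. A *v u j) ` I) \<le> card I"
      using insert(1) by (metis card_image_le dim_le_card' finite_imageI le_trans)
    also have "\<dots> < CARD('k)"
      using insert by (metis UNIV_I finite psubset_card_mono psubsetI subset_UNIV)
    finally show ?thesis by simp
  qed
  then obtain x where x: "x \<noteq> 0" "\<And>y. y \<in> span ((\<lambda>j. A *v u j) ` I) \<Longrightarrow> orthogonal x y"
    by (rule orthogonal_to_subspace_exists) blast
  have xW: "x \<in> W"
    unfolding W_def
  proof (clarify)
    fix j assume "j \<in> I"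
    then have "x \<bullet> (A *v u j) = 0"
      using x(2)[of "A *v u j"] by (auto simp: orthogonal_def span_base)
    then show "u j \<bullet> (A *v x) = 0"
      using symmetric_inner_commute[OF posdefD(1)[OF A]] by metis
  qed
  define K where "K = W \<inter> sphere 0 1"
  have "compact K"
    unfolding K_def by (simp add: closedW closed_Int_compact)
  moreover have "(1 / norm x) *\<^sub>R x \<in> K"
    using x(1) xW subW by (auto simp: K_def subspace_scale)
  moreover have "continuous_on K (\<lambda>w. (w \<bullet> (B *v w)) / (w \<bullet> (A *v w)))"
  proof (intro continuous_intros ballI)
    fix w assume "w \<in> K"
    then have "w \<noteq> 0" by (auto simp: K_def)
    then show "w \<bullet> (A *v w) \<noteq> 0"
      using posdefD(2)[OF A] by force
  qed
  ultimately obtain w0 where w0: "w0 \<in> K"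
    "\<And>w. w \<in> K \<Longrightarrow> (w0 \<bullet> (B *v w0)) / (w0 \<bullet> (A *v w0)) \<le> (w \<bullet> (B *v w)) / (w \<bullet> (A *v w))"
    using continuous_attains_inf[of K "\<lambda>w. (w \<bullet> (B *v w)) / (w \<bullet> (A *v w))"] by blast
  define \<mu> where "\<mu> = (w0 \<bullet> (B *v w0)) / (w0 \<bullet> (A *v w0))"
  \<comment> \<open>By minimality of \<open>\<mu>\<close> the form of \<open>C\<close> is
    nonnegative on \<open>W\<close>, and it vanishes at \<open>w0\<close>; hence \<open>w0\<close>
    is \<open>C\<close>-orthogonal to \<open>W\<close>, which gives the last clause for the new
    vector.\<close>
  define C where "C = B - \<mu> *\<^sub>R A"
  have C: "transpose C = C"
    by (simp add: C_def transpose_diff B posdefD(1)[OF A] transpose_scalar)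
  have w0': "w0 \<noteq> 0" "w0 \<in> W" using w0(1) by (auto simp: K_def)
  then have w0A: "0 < w0 \<bullet> (A *v w0)" using A by (simp add: posdefD)
  have Cform: "w \<bullet> (C *v z) = w \<bullet> (B *v z) - \<mu> * (w \<bullet> (A *v z))" for w z
    by (simp add: C_def matrix_vector_mult_diff_rdistrib scaleR_matrix_mult_vec inner_diff_right)
  have C_nonneg: "0 \<le> w \<bullet> (C *v w)" if "w \<in> W" for w
  proof (cases "w = 0")
    case False
    have "(1 / norm w) *\<^sub>R w \<in> K"
      using False that subW by (auto simp: K_def subspace_scale)
    from w0(2)[OF this] have "\<mu> \<le> (w \<bullet> (B *v w)) / (w \<bullet> (A *v w))"
      using False by (simp add: \<mu>_def matrix_vector_mult_scaleR)
    moreover have "0 < w \<bullet> (A *v w)"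
      using A False by (simp add: posdefD)
    ultimately show ?thesis
      by (simp add: Cform field_simps)
  qed simp
  have "w0 \<bullet> (C *v w0) = 0"
    using w0A by (simp add: Cform \<mu>_def)
  then have C_zero: "w0 \<bullet> (C *v w) = 0" if "w \<in> W" for w
    using psd_form_zero[OF C subW C_nonneg w0'(2) _ that] by blast
  define u' where "u' = u(k := (1 / sqrt (w0 \<bullet> (A *v w0))) *\<^sub>R w0)"
  have u'k: "u' k = (1 / sqrt (w0 \<bullet> (A *v w0))) *\<^sub>R w0" by (simp add: u'_def)
  have u'i: "u' i = u i" if "i \<in> I" for i using that insert(2) by (auto simp: u'_def)
  have kA: "u i \<bullet> (A *v u' k) = 0" "u' k \<bullet> (A *v u i) = 0" if "i \<in> I" for i
    using that w0'(2) symmetric_inner_commute[OF posdefD(1)[OF A], of w0 "u i"]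
    by (auto simp: u'k matrix_vector_mult_scaleR W_def)
  have kB: "u i \<bullet> (B *v u' k) = 0" "u' k \<bullet> (B *v u i) = 0" if "i \<in> I" for i
    using that w0'(2) symmetric_inner_commute[OF B, of w0 "u i"] u(3)[of w0 i]
    by (auto simp: u'k matrix_vector_mult_scaleR W_def)
  show ?case
  proof (intro exI[of _ u'] conjI ballI allI impI)
    fix i assume "i \<in> insert k I"
    then show "u' i \<bullet> (A *v u' i) = 1"
      using u(1) w0A by (auto simp: u'i) (auto simp: u'k matrix_vector_mult_scaleR)
  next
    fix i j assume "i \<in> insert k I" "j \<in> insert k I" "i \<noteq> j"
    then show "u' i \<bullet> (A *v u' j) = 0" "u' i \<bullet> (B *v u' j) = 0"
      using kA kB u(2) u'i by auto
  next
    fix w i assume w: "\<forall>j\<in>insert k I. u' j \<bullet> (A *v w) = 0" and i: "i \<in> insert k I"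
    then have "w \<in> W" and "w0 \<bullet> (A *v w) = 0"
      using u'i w0A by (auto simp: W_def) (auto simp: u'k)
    then show "u' i \<bullet> (B *v w) = 0"
      using i u(3)[of w i] C_zero[of w] u'i by (auto simp: W_def) (auto simp: u'k Cform)
  qed
qed

text \<open>The full \<open>A\<close>-orthonormal family \<open>u\<close> has the dual basis
  \<open>v i = A *v u i\<close>. Expanding in these bases turns both matrices into weighted sums of
  the same rank-one matrices. Such a sum has determinant \<open>(det V)\<^sup>2\<close> times the
  product of its weights, and weights 1 show that \<open>(det V)\<^sup>2 = det A\<close>.\<close>

lemma simultaneous_diagonalization:
  fixes A B :: "real^'k^'k"
  assumes A: "posdef A" and B: "transpose B = B"
  obtains v u :: "'k \<Rightarrow> real^'k" and \<mu> where
    "A = (\<Sum>i\<in>UNIV. outer_prod (v i))" "B = (\<Sum>i\<in>UNIV. \<mu> i *\<^sub>R outer_prod (v i))"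
    "\<And>w. det (\<Sum>i\<in>UNIV. w i *\<^sub>R outer_prod (v i)) = det A * (\<Prod>i\<in>UNIV. w i)"
    "\<And>i j. v i \<bullet> u j = (if i = j then 1 else 0)" "0 < det A"
proof -
  from simultaneous_orthogonal_family[OF A B, of UNIV] obtain u :: "'k \<Rightarrow> real^'k"
    where "\<forall>i\<in>UNIV. u i \<bullet> (A *v u i) = 1"
      "\<forall>i\<in>UNIV. \<forall>j\<in>UNIV. i \<noteq> j \<longrightarrow> u i \<bullet> (A *v u j) = 0 \<and> u i \<bullet> (B *v u j) = 0"
    by (elim exE conjE)
  then have u: "\<And>i. u i \<bullet> (A *v u i) = 1"
    "\<And>i j. i \<noteq> j \<Longrightarrow> u i \<bullet> (A *v u j) = 0" "\<And>i j. i \<noteq> j \<Longrightarrow> u i \<bullet> (B *v u j) = 0"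
    by auto
  define U :: "real^'k^'k" where "U = (\<chi> r i. u i $ r)"
  define v where "v i = A *v u i" for i
  define \<mu> where "\<mu> i = u i \<bullet> (B *v u i)" for i
  have vu: "v i \<bullet> u j = (if i = j then 1 else 0)" for i j
    using u(1,2) by (simp add: v_def inner_commute)
  define V :: "real^'k^'k" where "V = (\<chi> r i. v i $ r)"
  have "transpose V ** U = mat 1"
    using vu by (simp add: V_def U_def matrix_matrix_mult_def transpose_def vec_eq_iff inner_vec_def mat_def)
  then have UV: "U ** transpose V = mat 1"
    by (simp add: matrix_left_right_inverse)
  have expand: "x = (\<Sum>i\<in>UNIV. (v i \<bullet> x) *\<^sub>R u i)" for x
  proof -
    have "x = U *v (transpose V *v x)"
      unfolding matrix_vector_mul_assoc UV by simp
    also have "\<dots> = (\<Sum>i\<in>UNIV. (v i \<bullet> x) *\<^sub>R u i)"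
      by (simp add: U_def V_def matrix_vector_mult_def transpose_def vec_eq_iff inner_vec_def mult_ac
          sum_distrib_left vector_matrix_mult_def)
    finally show ?thesis .
  qed
  have Ax: "A *v x = (\<Sum>i\<in>UNIV. (v i \<bullet> x) *\<^sub>R v i)" for x
    by (subst (1) expand[of x]) (simp add: v_def matrix_mult_vec_sum matrix_vector_mult_scaleR)
  have Aeq: "A = (\<Sum>i\<in>UNIV. outer_prod (v i))"
    by (simp add: matrix_eq sum_matrix_mult_vec outer_prod_mult_vec Ax)
  have Bu: "B *v u i = \<mu> i *\<^sub>R v i" for i
  proof -
    \<comment> \<open>The residual is orthogonal to every \<open>u j\<close>; being a combination of
      the \<open>u j\<close>, it is orthogonal to itself.\<close>
    have "u j \<bullet> (B *v u i - \<mu> i *\<^sub>R v i) = 0" for j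
      using u vu[of i j] by (cases "i = j") (auto simp: inner_diff_right \<mu>_def inner_commute)
    then have "(\<Sum>j\<in>UNIV. (v j \<bullet> (B *v u i - \<mu> i *\<^sub>R v i)) *\<^sub>R u j) \<bullet> (B *v u i - \<mu> i *\<^sub>R v i) = 0"
      by (simp add: inner_sum_left)
    then show ?thesis
      using expand[of "B *v u i - \<mu> i *\<^sub>R v i"] by simp
  qed
  have Bx: "B *v x = (\<Sum>i\<in>UNIV. (v i \<bullet> x) *\<^sub>R (\<mu> i *\<^sub>R v i))" for x
    by (subst (1) expand[of x]) (simp add: Bu matrix_mult_vec_sum matrix_vector_mult_scaleR)
  have Beq: "B = (\<Sum>i\<in>UNIV. \<mu> i *\<^sub>R outer_prod (v i))"
    by (simp add: matrix_eq sum_outer_prod_mult_vec Bx mult.commute)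
  have detA: "det A = (det V)\<^sup>2"
    using det_sum_outer_prod[of "\<lambda>_. 1" v] by (simp add: Aeq[symmetric] V_def)
  have "det V \<noteq> 0"
    using \<open>transpose V ** U = mat 1\<close> by (metis det_I det_mul det_transpose mult_zero_left zero_neq_one)
  then show thesis
    using that[OF Aeq Beq _ vu] det_sum_outer_prod[of _ v] detA unfolding V_def by auto
qed

section \<open>Block determinants and the determinant-trace inequality\<close>

lemma sum_UNIV_option: "(\<Sum>k\<in>UNIV. f k) = f None + (\<Sum>j\<in>UNIV. f (Some j :: 'n::finite option))"
  by (simp add: UNIV_option_conv sum.reindex)

lemma prod_UNIV_option: "(\<Prod>k\<in>UNIV. f k) = f None * (\<Prod>j\<in>UNIV. f (Some j :: 'n::finite option))"
  by (simp add: UNIV_option_conv prod.reindex)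

lemma vec_option_eq_iff:
  "(x :: 'a^('n::finite option)) = y \<longleftrightarrow> x $ None = y $ None \<and> (\<forall>j. x $ Some j = y $ Some j)"
  by (metis not_None_eq vec_eq_iff)

definition block_vec :: "real^'n \<Rightarrow> real \<Rightarrow> real^('n::finite option)" where
  "block_vec x t = (\<chi> k. case k of Some j \<Rightarrow> x $ j | None \<Rightarrow> t)"

text \<open>\<open>z\<close> is the last column and \<open>w\<close> the last row. They are
  independent so that triangular elimination factors have this form too.\<close>

definition block_mat :: "real^'n^'n \<Rightarrow> real^'n \<Rightarrow> real^'n \<Rightarrow> real \<Rightarrow> real^('n::finite option)^('n option)" where
  "block_mat G z w c = (\<chi> i. case i of Some i' \<Rightarrow> block_vec (G $ i') (z $ i') | None \<Rightarrow> block_vec w c)"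

lemma block_vec_nth [simp]: "block_vec x t $ None = t" "block_vec x t $ Some j = x $ j"
  by (simp_all add: block_vec_def)

lemma block_mat_nth [simp]: "block_mat G z w c $ None = block_vec w c"
  "block_mat G z w c $ Some i = block_vec (G $ i) (z $ i)"
  by (simp_all add: block_mat_def)

lemma block_vec_cases: obtains v t where "x = block_vec v t"
  by (rule that[of "\<chi> j. x $ Some j" "x $ None"]) (simp add: vec_option_eq_iff)

lemma block_vec_eq_iff [simp]: "block_vec x t = block_vec y s \<longleftrightarrow> x = y \<and> t = s"
  by (auto simp: vec_option_eq_iff vec_eq_iff)

lemma block_vec_eq_0_iff [simp]: "block_vec x t = 0 \<longleftrightarrow> x = 0 \<and> t = 0"
  by (auto simp: vec_option_eq_iff vec_eq_iff)

lemma inner_block_vec [simp]: "block_vec x t \<bullet> block_vec y s = x \<bullet> y + t * s"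
  by (simp add: inner_vec_def sum_UNIV_option)

lemma block_vec_scaleR: "r *\<^sub>R block_vec x t = block_vec (r *\<^sub>R x) (r * t)"
  by (auto simp: vec_option_eq_iff)

lemma block_mat_mult_vec [simp]:
  "block_mat G z w c *v block_vec x t = block_vec (G *v x + t *\<^sub>R z) (w \<bullet> x + c * t)"
  by (auto simp: vec_option_eq_iff matrix_vector_mul_component mult.commute)

lemma transpose_block_mat [simp]: "transpose (block_mat G z w c) = block_mat (transpose G) w z c"
  by (auto simp: vec_option_eq_iff transpose_def)

lemma block_mat_mult:
  "block_mat G z w c ** block_mat G' z' w' c' =
   block_mat (G ** G' + (\<chi> i j. z $ i * w' $ j)) (G *v z' + c' *\<^sub>R z) (transpose G' *v w + c *\<^sub>R w') (w \<bullet> z' + c * c')"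
  by (auto simp: vec_option_eq_iff matrix_matrix_mult_def sum_UNIV_option matrix_vector_mult_def
      vector_matrix_mult_def transpose_def inner_vec_def mult_ac)

lemma block_mat_blk: "Q = block_mat (blkG Q) (blkz Q) (blkz (transpose Q)) (blks Q)"
  by (auto simp: vec_option_eq_iff blkG_def blkz_def blks_def transpose_def)

lemma det_single_offdiagonal_entry:
  fixes c :: real
  assumes "m \<noteq> n"
  shows "det (\<chi> i j. if i = m \<and> j = n then c else of_bool (i = j) :: real^'k^'k) = 1"
proof -
  have "(\<chi> i j. if i = m \<and> j = n then c else of_bool (i = j) :: real^'k^'k) =
    (\<chi> k. if k = m then row m (mat 1) + c *s row n (mat 1) else row k (mat 1))"
    using assms by (auto simp: vec_eq_iff row_def mat_def)
  then show ?thesis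
    using det_row_operation[OF assms, of "mat 1 :: real^'k^'k" c] by simp
qed

text \<open>Bordering by a unit is multiplicative, so the determinants need comparing only on the
  pieces of an elementary factorization: matrices with a zero row, diagonal matrices, transpositions
  and shears.\<close>

lemma det_block_diag_1: "det (block_mat G 0 0 1) = det G"
proof (induction G rule: induct_matrix_elementary)
  case (1 A B)
  have "block_mat (A ** B) 0 0 1 = block_mat A 0 0 1 ** block_mat B 0 0 1"
    by (simp add: block_mat_mult) (simp add: vec_option_eq_iff vec_eq_iff)
  then show ?case
    using 1 by (simp add: det_mul)
next
  case (2 A i)
  then have "row (Some i) (block_mat A 0 0 1) = 0"
    by (simp add: vec_option_eq_iff row_def vec_eq_iff)
  then show ?case
    using 2 by (metis det_zero_row(2))
next
  case (3 A)
  have "det (block_mat A 0 0 1) = (\<Prod>k\<in>UNIV. block_mat A 0 0 1 $ k $ k)"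
  proof (rule det_diagonal)
    fix i j :: "'a option" assume "i \<noteq> j"
    then show "block_mat A 0 0 1 $ i $ j = 0"
      using 3 by (cases i; cases j) auto
  qed
  then show ?case
    using 3 by (simp add: prod_UNIV_option det_diagonal)
next
  case (4 m n)
  let ?p = "Transposition.transpose m n" and ?q = "Transposition.transpose (Some m) (Some n)"
  have q: "?q None = None" "?q (Some j) = Some (?p j)" for j
    by (auto simp: Transposition.transpose_def)
  have "block_mat (\<chi> i j. mat 1 $ i $ ?p j) 0 0 1 = (\<chi> i j. mat 1 $ i $ ?q j)"
    by (auto simp: vec_option_eq_iff q mat_def)
  moreover have "det (\<chi> i j. mat 1 $ i $ ?q j :: real^('a option)^('a option)) = -1"
    using 4 by (subst det_permute_columns) (auto simp: permutes_swap_id sign_swap_id)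
  moreover have "det (\<chi> i j. mat 1 $ i $ ?p j :: real^'a^'a) = -1"
    using 4 by (subst det_permute_columns) (auto simp: permutes_swap_id sign_swap_id)
  ultimately show ?case by simp
next
  case (5 m n c)
  have "block_mat (\<chi> i j. if i = m \<and> j = n then c else of_bool (i = j)) 0 0 1 =
    (\<chi> i j. if i = Some m \<and> j = Some n then c else of_bool (i = j))"
    by (auto simp: vec_option_eq_iff)
  then show ?case
    using 5 by (simp add: det_single_offdiagonal_entry)
qed

text \<open>Splits off \<open>block_mat G 0 0 1\<close>; the remaining factor is a diagonal matrix
  with multiples of the other rows added to its last row.\<close>

lemma det_block_lower: "det (block_mat G 0 w c) = c * det G"
proof -
  define D :: "real^('a option)^('a option)" where "D = block_mat (mat 1) 0 0 c"
  have detD: "det D = c"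
  proof -
    have "det D = (\<Prod>k\<in>UNIV. D $ k $ k)"
    proof (rule det_diagonal)
      fix i j :: "'a option" assume "i \<noteq> j"
      then show "D $ i $ j = 0"
        by (cases i; cases j) (auto simp: D_def mat_def)
    qed
    then show ?thesis
      by (simp add: prod_UNIV_option D_def mat_def)
  qed
  have "block_mat (mat 1) 0 w c = (\<chi> k. if k = None then row None D + block_vec w 0 else row k D)"
    by (auto simp: vec_option_eq_iff row_def D_def)
  moreover have "block_vec w 0 \<in> vec.span {row j D |j. j \<noteq> None}"
  proof -
    have "block_vec w 0 = (\<Sum>j\<in>UNIV. w $ j *s row (Some j) D)"
      by (auto simp: vec_option_eq_iff row_def D_def mat_def if_distrib cong: if_cong)
    also have "\<dots> \<in> vec.span {row j D |j. j \<noteq> None}"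
      by (intro vec.span_sum vec.span_scale vec.span_base) blast
    finally show ?thesis .
  qed
  ultimately have "det (block_mat (mat 1) 0 w c) = c"
    using det_row_span[of "block_vec w 0" D None] detD by (simp only:)
  moreover have "block_mat G 0 w c = block_mat G 0 0 1 ** block_mat (mat 1) 0 w c"
  proof -
    have "(\<chi> i j. 0 $ i * w $ j) = (0 :: real^'a^'a)"
      by (simp add: vec_eq_iff)
    then show ?thesis
      by (simp add: block_mat_mult del: transpose_matrix_vector)
  qed
  ultimately have "det (block_mat G 0 w c) = det (block_mat G 0 0 1) * c"
    by (simp only: det_mul)
  then show ?thesis
    by (simp only: det_block_diag_1 mult.commute)
qed

lemma det_block_upper: "det (block_mat G z 0 c) = c * det G"
  using det_block_lower[of "transpose G" z c] by (metis det_transpose transpose_block_mat transpose_transpose)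

section \<open>Matrix inverses, the Schur complement and the rank-one update\<close>

lemma matrix_inv_inverse:
  fixes A :: "real^'k^'k"
  assumes "det A \<noteq> 0"
  shows "A ** matrix_inv A = mat 1" "matrix_inv A ** A = mat 1"
proof -
  have "\<exists>A'. A ** A' = mat 1 \<and> A' ** A = mat 1"
    using assms invertible_det_nz[of A] by (auto simp: invertible_def)
  from someI_ex[OF this] show "A ** matrix_inv A = mat 1" "matrix_inv A ** A = mat 1"
    by (auto simp: matrix_inv_def)
qed

lemma matrix_inv_unique:
  fixes A :: "real^'k^'k"
  assumes "A ** B = mat 1"
  shows "matrix_inv A = B"
proof -
  have "det A \<noteq> 0"
    using assms by (metis det_I det_mul mult_zero_left zero_neq_one)
  then have "matrix_inv A = matrix_inv A ** (A ** B)"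
    using assms by simp
  also have "\<dots> = B"
    using matrix_inv_inverse(2)[OF \<open>det A \<noteq> 0\<close>] by (simp add: matrix_mul_assoc)
  finally show ?thesis .
qed

lemma matrix_inv_mult_vec:
  fixes A :: "real^'k^'k"
  assumes "det A \<noteq> 0"
  shows "A *v (matrix_inv A *v x) = x" "matrix_inv A *v (A *v x) = x"
  using matrix_inv_inverse[OF assms] by (simp_all add: matrix_vector_mul_assoc)

lemma det_matrix_inv: "det (A :: real^'k^'k) \<noteq> 0 \<Longrightarrow> det (matrix_inv A) = 1 / det A"
  using matrix_inv_inverse(1)[of A] by (metis det_I det_mul nonzero_mult_div_cancel_left)

lemma transpose_matrix_inv:
  fixes A :: "real^'k^'k"
  assumes "det A \<noteq> 0" "transpose A = A"
  shows "transpose (matrix_inv A) = matrix_inv A"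
proof -
  have "A ** transpose (matrix_inv A) = transpose (matrix_inv A ** A)"
    by (simp add: matrix_transpose_mul assms(2))
  also have "\<dots> = mat 1"
    by (simp add: matrix_inv_inverse(2)[OF assms(1)])
  finally show ?thesis
    by (metis matrix_inv_unique)
qed

text \<open>Block elimination: a unitriangular left factor with last row
  \<open>matrix_inv G *v w\<close> leaves an upper triangular block matrix.\<close>

lemma det_block_schur_complement:
  assumes "det G \<noteq> 0" "transpose G = G"
  shows "det (block_mat G z w c) = det G * (c - w \<bullet> (matrix_inv G *v z))"
proof -
  have "block_mat G z w c = block_mat (mat 1) 0 (matrix_inv G *v w) 1 ** block_mat G z 0 (c - w \<bullet> (matrix_inv G *v z))"
    using matrix_inv_mult_vec(1)[OF assms(1)] transpose_matrix_inv[OF assms] assms(2)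
      symmetric_inner_commute[OF transpose_matrix_inv[OF assms], of w z]
    by (simp add: block_mat_mult inner_commute del: transpose_matrix_vector) (auto simp: vec_option_eq_iff vec_eq_iff)
  then show ?thesis
    by (simp add: det_mul det_block_lower det_block_upper)
qed

text \<open>The matrix \<open>block_mat G z (- z) c\<close> is eliminated in two ways, through
  \<open>G\<close> and through \<open>c\<close>; the two values of its determinant agree.\<close>

lemma det_rank_one_update:
  assumes "det G \<noteq> 0" "transpose G = G" "c \<noteq> 0"
  shows "det (G + (1 / c) *\<^sub>R outer_prod z) = det G * (1 + (z \<bullet> (matrix_inv G *v z)) / c)"
proof -
  have "block_mat G z (- z) c = block_mat (mat 1) ((1 / c) *\<^sub>R z) 0 1 ** block_mat (G + (1 / c) *\<^sub>R outer_prod z) 0 (- z) c"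
    using assms(3)
    by (simp add: block_mat_mult outer_prod_def del: transpose_matrix_vector) (auto simp: vec_option_eq_iff vec_eq_iff)
  then have "det (block_mat G z (- z) c) = c * det (G + (1 / c) *\<^sub>R outer_prod z)"
    by (simp add: det_mul det_block_lower det_block_upper)
  then show ?thesis
    using det_block_schur_complement[OF assms(1,2), of z "- z" c] assms(3)
    by (simp add: field_simps)
qed

section \<open>Positive definite matrices, eigenvalues and trace bounds\<close>

lemma posdef_det_pos:
  assumes "posdef A" shows "0 < det A"
  by (rule simultaneous_diagonalization[OF assms posdefD(1)[OF assms]])

lemma posdef_matrix_inv:
  assumes "posdef A" shows "posdef (matrix_inv A)"
proof -
  have d: "det A \<noteq> 0" using posdef_det_pos[OF assms] by simp
  show ?thesis
    unfolding posdef_def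
  proof (intro conjI allI impI)
    show "transpose (matrix_inv A) = matrix_inv A"
      using transpose_matrix_inv[OF d] assms by (simp add: posdefD)
    fix v :: "real^'a" assume "v \<noteq> 0"
    then have "matrix_inv A *v v \<noteq> 0"
      using matrix_inv_mult_vec(1)[OF d, of v] by auto
    then have "0 < (matrix_inv A *v v) \<bullet> (A *v (matrix_inv A *v v))"
      using assms by (simp add: posdefD)
    then show "0 < v \<bullet> (matrix_inv A *v v)"
      by (simp add: matrix_inv_mult_vec(1)[OF d] inner_commute)
  qed
qed

lemma posdef_lower_bound:
  fixes A :: "real^'k^'k"
  assumes "posdef A"
  obtains \<alpha> where "0 < \<alpha>" "\<And>v. \<alpha> * (v \<bullet> v) \<le> v \<bullet> (A *v v)"
proof -
  have "axis undefined 1 \<in> sphere (0 :: real^'k) 1" by simp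
  then have "\<exists>w\<in>sphere 0 1. \<forall>v\<in>sphere 0 1. w \<bullet> (A *v w) \<le> v \<bullet> (A *v v)"
    by (intro continuous_attains_inf) (auto intro!: continuous_intros)
  then obtain w where w: "w \<in> sphere 0 1" "\<And>v. v \<in> sphere 0 1 \<Longrightarrow> w \<bullet> (A *v w) \<le> v \<bullet> (A *v v)"
    by blast
  show thesis
  proof
    show "0 < w \<bullet> (A *v w)"
      using w(1) by (intro posdefD(2)[OF assms]) auto
    show "w \<bullet> (A *v w) * (v \<bullet> v) \<le> v \<bullet> (A *v v)" for v
    proof (cases "v = 0")
      case False
      then have "w \<bullet> (A *v w) \<le> ((1 / norm v) *\<^sub>R v) \<bullet> (A *v ((1 / norm v) *\<^sub>R v))"
        by (intro w(2)) simp
      also have "\<dots> = (v \<bullet> (A *v v)) / (v \<bullet> v)"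
        by (simp add: matrix_vector_mult_scaleR dot_square_norm power2_eq_square)
      finally show ?thesis
        using False by (simp add: field_simps)
    qed simp
  qed
qed

lemma posdef_mat_1: "posdef (mat 1)"
  by (simp add: posdef_def)

text \<open>Simultaneous diagonalization with the identity: expanding \<open>u j\<close> in the
  \<open>v i\<close> shows that the dual basis is \<open>v\<close> itself, so \<open>v\<close> is
  orthonormal and consists of eigenvectors.\<close>

lemma spectral_decomposition:
  fixes B :: "real^'k^'k"
  assumes "transpose B = B"
  obtains v :: "'k \<Rightarrow> real^'k" and \<mu> where "B = (\<Sum>i\<in>UNIV. \<mu> i *\<^sub>R outer_prod (v i))"
    "\<And>i j. v i \<bullet> v j = (if i = j then 1 else 0)" "det B = (\<Prod>i\<in>UNIV. \<mu> i)"
    "\<And>i. B *v v i = \<mu> i *\<^sub>R v i" "\<And>x. x \<bullet> x = (\<Sum>i\<in>UNIV. (v i \<bullet> x)\<^sup>2)"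
proof -
  obtain v u :: "'k \<Rightarrow> real^'k" and \<mu> where v: "mat 1 = (\<Sum>i\<in>UNIV. outer_prod (v i))"
    "B = (\<Sum>i\<in>UNIV. \<mu> i *\<^sub>R outer_prod (v i))"
    "\<And>w. det (\<Sum>i\<in>UNIV. w i *\<^sub>R outer_prod (v i)) = det (mat 1 :: real^'k^'k) * (\<Prod>i\<in>UNIV. w i)"
    "\<And>i j. v i \<bullet> u j = (if i = j then 1 else 0)"
    by (rule simultaneous_diagonalization[OF posdef_mat_1 assms]) (rule that)
  have x: "x = (\<Sum>i\<in>UNIV. (v i \<bullet> x) *\<^sub>R v i)" for x
  proof -
    have "x = mat 1 *v x" by simp
    also have "\<dots> = (\<Sum>i\<in>UNIV. (v i \<bullet> x) *\<^sub>R v i)"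
      by (subst v(1)) (simp add: sum_matrix_mult_vec outer_prod_mult_vec)
    finally show ?thesis .
  qed
  have "u j = v j" for j
  proof -
    have "u j = (\<Sum>i\<in>UNIV. if i = j then v i else 0)"
      by (subst x, intro sum.cong) (auto simp: v(4))
    then show ?thesis by simp
  qed
  then have orth: "v i \<bullet> v j = (if i = j then 1 else 0)" for i j
    using v(4)[of i j] by simp
  have "B *v v j = \<mu> j *\<^sub>R v j" for j
  proof -
    have "B *v v j = (\<Sum>i\<in>UNIV. (\<mu> i * (v i \<bullet> v j)) *\<^sub>R v i)"
      by (subst v(2)) (rule sum_outer_prod_mult_vec)
    also have "\<dots> = (\<Sum>i\<in>UNIV. if i = j then \<mu> i *\<^sub>R v i else 0)"
      by (intro sum.cong) (auto simp: orth)
    finally show ?thesis by simp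
  qed
  moreover have "x \<bullet> x = (\<Sum>i\<in>UNIV. (v i \<bullet> x)\<^sup>2)" for x
  proof -
    have "x \<bullet> x = (\<Sum>i\<in>UNIV. (v i \<bullet> x) *\<^sub>R v i) \<bullet> x"
      using x[of x] by simp
    then show ?thesis
      by (simp add: inner_sum_left power2_eq_square)
  qed
  ultimately show thesis
    using that[OF v(2) orth] v(3)[of \<mu>] v(2) by simp
qed

text \<open>For a semidefinite matrix a null vector of the form lies in the kernel. This promotes
  maximizers of \<open>det\<close> over closed sets of semidefinite matrices to positive definite
  ones.\<close>

lemma posdef_if_psd_det_nonzero:
  fixes A :: "real^'k^'k"
  assumes "transpose A = A" "\<And>v. 0 \<le> v \<bullet> (A *v v)" "det A \<noteq> 0"
  shows "posdef A"
  unfolding posdef_def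
proof (intro conjI allI impI)
  fix v :: "real^'k" assume "v \<noteq> 0"
  have "v \<bullet> (A *v v) \<noteq> 0"
  proof
    assume "v \<bullet> (A *v v) = 0"
    then have "(A *v v) \<bullet> (A *v v) = 0"
      using psd_form_zero[OF assms(1) subspace_UNIV, of v "A *v v"] assms(2)
        symmetric_inner_commute[OF assms(1), of v "A *v v"] by auto
    then have "A *v v = 0" by simp
    then show False
      using matrix_inv_mult_vec(2)[OF assms(3), of v] \<open>v \<noteq> 0\<close> by simp
  qed
  then show "0 < v \<bullet> (A *v v)"
    using assms(2)[of v] by linarith
qed (fact assms)

text \<open>Triangle inequality over the spectral rank-one terms, whose weights are nonnegative and
  which have norm and trace 1.\<close>

lemma psd_norm_le_trace:
  fixes B :: "real^'k^'k"
  assumes "transpose B = B" "\<And>v. 0 \<le> v \<bullet> (B *v v)"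
  shows "norm B \<le> trace B"
proof -
  obtain v :: "'k \<Rightarrow> real^'k" and \<mu> where v: "B = (\<Sum>i\<in>UNIV. \<mu> i *\<^sub>R outer_prod (v i))"
    "\<And>i j. v i \<bullet> v j = (if i = j then 1 else 0)" "det B = (\<Prod>i\<in>UNIV. \<mu> i)"
    "\<And>i. B *v v i = \<mu> i *\<^sub>R v i"
    by (rule spectral_decomposition[OF assms(1)]) (rule that)
  have "0 \<le> \<mu> i" for i using v(2)[of i i] v(4)[of i] assms(2)[of "v i"] by simp
  then have "norm B \<le> (\<Sum>i\<in>UNIV. norm (\<mu> i *\<^sub>R outer_prod (v i)))"
    by (subst v(1)) (rule norm_sum)
  also have "\<dots> = trace B"
    using \<open>\<And>i. 0 \<le> \<mu> i\<close>
    by (subst v(1)) (simp add: trace_sum trace_scaleR trace_outer_prod v(2) norm_outer_prod power2_norm_eq_inner)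
  finally show ?thesis .
qed

text \<open>Evaluates the lower bound on the form at each eigenvector of \<open>B\<close> and adds
  up with the eigenvalues as weights. For the lifted vectors \<open>h i\<close> it bounds the trace
  of every feasible matrix.\<close>

lemma psd_trace_bound:
  fixes B :: "real^'k^'k"
  assumes B: "transpose B = B" "\<And>v. 0 \<le> v \<bullet> (B *v v)"
    and M: "\<And>v. \<alpha> * (v \<bullet> v) \<le> v \<bullet> ((\<Sum>i\<in>I. w i *\<^sub>R outer_prod (h i)) *v v)"
  shows "\<alpha> * trace B \<le> (\<Sum>i\<in>I. w i * (h i \<bullet> (B *v h i)))"
proof -
  obtain v :: "'k \<Rightarrow> real^'k" and \<mu> where v: "B = (\<Sum>i\<in>UNIV. \<mu> i *\<^sub>R outer_prod (v i))"
    "\<And>i j. v i \<bullet> v j = (if i = j then 1 else 0)" "det B = (\<Prod>i\<in>UNIV. \<mu> i)"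
    "\<And>i. B *v v i = \<mu> i *\<^sub>R v i"
    by (rule spectral_decomposition[OF B(1)]) (rule that)
  have \<mu>: "0 \<le> \<mu> i" for i using v(2)[of i i] v(4)[of i] B(2)[of "v i"] by simp
  have "\<alpha> * trace B = (\<Sum>j\<in>UNIV. \<mu> j * (\<alpha> * (v j \<bullet> v j)))"
    by (subst v(1)) (simp add: trace_sum trace_scaleR trace_outer_prod sum_distrib_left mult_ac)
  also have "\<dots> \<le> (\<Sum>j\<in>UNIV. \<mu> j * (v j \<bullet> ((\<Sum>i\<in>I. w i *\<^sub>R outer_prod (h i)) *v v j)))"
    by (intro sum_mono mult_left_mono M \<mu>)
  also have "\<dots> = (\<Sum>i\<in>I. w i * (h i \<bullet> (B *v h i)))"
    by (subst v(1)) (simp add: sum_outer_prod_form sum_distrib_left sum.swap[of _ UNIV I] inner_commute mult_ac)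
  finally show ?thesis .
qed

text \<open>The inequality of arithmetic and geometric means for the eigenvalues, from
  \<open>ln u \<le> u - 1\<close> at \<open>u = ?d * \<mu> i\<close>.\<close>

lemma det_le_of_trace_le_1:
  fixes N :: "real^'k^'k"
  assumes "posdef N" "trace N \<le> 1"
  shows "det N * real CARD('k) ^ CARD('k) \<le> 1"
proof -
  let ?d = "real CARD('k)"
  obtain v :: "'k \<Rightarrow> real^'k" and \<mu> where v: "N = (\<Sum>i\<in>UNIV. \<mu> i *\<^sub>R outer_prod (v i))"
    "\<And>i j. v i \<bullet> v j = (if i = j then 1 else 0)" "det N = (\<Prod>i\<in>UNIV. \<mu> i)"
    "\<And>i. N *v v i = \<mu> i *\<^sub>R v i"
    by (rule spectral_decomposition[OF posdefD(1)[OF assms(1)]]) (rule that)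
  have "v i \<noteq> 0" for i using v(2)[of i i] by auto
  then have \<mu>: "0 < \<mu> i" for i using v(2)[of i i] v(4)[of i] posdefD(2)[OF assms(1), of "v i"] by simp
  have tr: "trace N = (\<Sum>i\<in>UNIV. \<mu> i)"
    by (subst v(1)) (simp add: trace_sum trace_scaleR trace_outer_prod v(2))
  have "det N * ?d ^ CARD('k) = (\<Prod>i\<in>UNIV. ?d * \<mu> i)"
    by (simp add: v(3) prod.distrib)
  also have "\<dots> = exp (\<Sum>i\<in>UNIV. ln (?d * \<mu> i))"
    using \<mu> by (simp add: exp_sum)
  also have "\<dots> \<le> exp (\<Sum>i\<in>UNIV. ?d * \<mu> i - 1)"
    using \<mu> by (intro iffD2[OF exp_le_cancel_iff] sum_mono ln_le_minus_one) simp
  also have "(\<Sum>i\<in>UNIV. ?d * \<mu> i - 1) = ?d * trace N - ?d"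
    by (simp add: sum_subtractf tr sum_distrib_left)
  also have "exp \<dots> \<le> 1"
    using assms(2) by (simp add: mult_left_le)
  finally show ?thesis by simp
qed

text \<open>With \<open>Q = V ** transpose V\<close>, the matrix
  \<open>N = transpose V ** M ** V\<close> has determinant \<open>det Q * det M\<close>, and its
  trace is exactly the weighted sum in the hypothesis. So the determinant-trace inequality for
  \<open>N\<close> is the claim; it is the core of weak duality.\<close>

lemma det_mult_le_if_weighted_form_le_1:
  fixes Q :: "real^'k^'k"
  assumes Q: "posdef Q" and w: "posdef (\<Sum>i\<in>I. w i *\<^sub>R outer_prod (h i))"
    and h: "(\<Sum>i\<in>I. w i * (h i \<bullet> (Q *v h i))) \<le> 1"
  shows "det Q * det (\<Sum>i\<in>I. w i *\<^sub>R outer_prod (h i)) * real CARD('k) ^ CARD('k) \<le> 1"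
proof -
  define M where "M = (\<Sum>i\<in>I. w i *\<^sub>R outer_prod (h i))"
  obtain v :: "'k \<Rightarrow> real^'k" where v: "Q = (\<Sum>i\<in>UNIV. outer_prod (v i))"
    by (rule simultaneous_diagonalization[OF Q posdefD(1)[OF Q]]) (rule that)
  define V :: "real^'k^'k" where "V = (\<chi> r i. v i $ r)"
  have detQ: "det Q = (det V)\<^sup>2"
    using det_sum_outer_prod[of "\<lambda>_. 1" v] by (simp add: v V_def)
  define N where "N = transpose V ** M ** V"
  have Nform: "x \<bullet> (N *v y) = (V *v x) \<bullet> (M *v (V *v y))" for x y
    by (simp add: N_def matrix_vector_mul_assoc[symmetric] inner_matrix_transpose[of x "transpose V"]
        del: transpose_matrix_vector)
  have tN: "transpose N = N"
    by (simp add: N_def matrix_transpose_mul matrix_mul_assoc posdefD(1)[OF w[folded M_def]])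
  have detN: "det N = det Q * det M"
    by (simp add: N_def det_mul detQ power2_eq_square)
  have pN: "posdef N"
  proof (rule posdef_if_psd_det_nonzero[OF tN])
    show "0 \<le> x \<bullet> (N *v x)" for x
      unfolding Nform by (rule posdefD(3)[OF w[folded M_def]])
    show "det N \<noteq> 0"
      using posdef_det_pos[OF Q] posdef_det_pos[OF w[folded M_def]] by (simp add: detN)
  qed
  have "trace N = (\<Sum>j\<in>UNIV. axis j 1 \<bullet> (N *v axis j 1))"
    by (simp add: trace_def inner_axis' matrix_vector_mult_basis column_def)
  also have "\<dots> = (\<Sum>j\<in>UNIV. v j \<bullet> (M *v v j))"
  proof -
    have "V *v axis j 1 = v j" for j
      by (simp add: matrix_vector_mult_basis column_def V_def vec_eq_iff)
    then show ?thesis by (simp add: Nform)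
  qed
  also have "\<dots> = (\<Sum>i\<in>I. w i * (h i \<bullet> (Q *v h i)))"
    unfolding M_def v
    by (simp add: scaleR_matrix_mult_vec sum_outer_prod_form sum_matrix_mult_vec outer_prod_mult_vec inner_sum_right
        sum_distrib_left sum.swap[of _ UNIV I] inner_commute mult_ac)
  finally have "trace N \<le> 1" using h by simp
  from det_le_of_trace_le_1[OF pN this] show ?thesis
    by (simp add: detN M_def)
qed

section \<open>Strong convexity of the negative log-determinant\<close>

lemma continuous_on_det [continuous_intros]:
  fixes A :: "'a::topological_space \<Rightarrow> real^'k^'k"
  assumes "continuous_on S A"
  shows "continuous_on S (\<lambda>x. det (A x))"
  unfolding det_def by (intro continuous_intros assms)

lemma lambda_min_le_form:
  fixes S :: "real^'k^'k"
  assumes "transpose S = S"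
  shows "lambda_min S * (x \<bullet> x) \<le> x \<bullet> (S *v x)"
proof -
  obtain v :: "'k \<Rightarrow> real^'k" and \<mu> where v: "S = (\<Sum>i\<in>UNIV. \<mu> i *\<^sub>R outer_prod (v i))"
    "\<And>i j. v i \<bullet> v j = (if i = j then 1 else 0)" "det S = (\<Prod>i\<in>UNIV. \<mu> i)"
    "\<And>i. S *v v i = \<mu> i *\<^sub>R v i" "\<And>x. x \<bullet> x = (\<Sum>i\<in>UNIV. (v i \<bullet> x)\<^sup>2)"
    by (rule spectral_decomposition[OF assms]) (rule that)
  have form: "x \<bullet> (S *v x) = (\<Sum>i\<in>UNIV. \<mu> i * (v i \<bullet> x)\<^sup>2)" for x
    by (subst v(1)) (simp add: sum_outer_prod_form power2_eq_square mult.assoc)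
  have le: "c * (x \<bullet> x) \<le> x \<bullet> (S *v x)" if "\<And>i. c \<le> \<mu> i" for c x
    unfolding form v(5)[of x] sum_distrib_left
    by (intro sum_mono mult_right_mono that) simp
  let ?E = "{\<mu>. \<exists>v. v \<noteq> 0 \<and> S *v v = \<mu> *\<^sub>R v}"
  \<comment> \<open>The infimum is a lower bound only for a set that is bounded below; the least
    spectral weight serves as bound.\<close>
  have "bdd_below ?E"
  proof (rule bdd_belowI)
    fix c assume "c \<in> ?E"
    then obtain w where w: "w \<noteq> 0" "S *v w = c *\<^sub>R w" by blast
    have "Min (range \<mu>) * (w \<bullet> w) \<le> c * (w \<bullet> w)"
      using le[of "Min (range \<mu>)" w] w(2) by simp
    then show "Min (range \<mu>) \<le> c"
      using w(1) by (simp add: inner_gt_zero_iff)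
  qed
  moreover have "\<mu> i \<in> ?E" for i
    using v(2)[of i i] v(4)[of i] by (auto intro!: exI[of _ "v i"])
  ultimately have "lambda_min S \<le> \<mu> i" for i
    unfolding lambda_min_def by (intro cInf_lower)
  then show ?thesis by (rule le)
qed

text \<open>In coordinates that diagonalize both end points, \<open>- ln det\<close> along the segment is \<open>- \<Sum> ln (1 + t \<nu>\<^sub>i)\<close>, up to a constant.\<close>

lemma near_maximizer_of_det_is_close:
  fixes Q Q' :: "real^'k^'k"
  assumes Q: "posdef Q" "trace Q \<le> R" and Q': "posdef Q'" "trace Q' \<le> R"
    and max: "\<And>t. 0 \<le> t \<Longrightarrow> t \<le> 1 \<Longrightarrow> det (Q + t *\<^sub>R (Q' - Q)) \<le> det Q"
    and gap: "ln (det Q) \<le> ln (det Q') + \<epsilon>"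
  shows "(norm (Q' - Q))\<^sup>2 \<le> 2 * R\<^sup>2 * \<epsilon>"
proof -
  obtain v u :: "'k \<Rightarrow> real^'k" and \<mu> where v: "Q = (\<Sum>i\<in>UNIV. outer_prod (v i))"
    "Q' = (\<Sum>i\<in>UNIV. \<mu> i *\<^sub>R outer_prod (v i))"
    "\<And>w. det (\<Sum>i\<in>UNIV. w i *\<^sub>R outer_prod (v i)) = det Q * (\<Prod>i\<in>UNIV. w i)"
    "\<And>i j. v i \<bullet> u j = (if i = j then 1 else 0)" "0 < det Q"
    by (rule simultaneous_diagonalization[OF Q(1) posdefD(1)[OF Q'(1)]]) (rule that)
  have \<mu>: "0 < \<mu> i" for i
  proof -
    have "u i \<bullet> (Q' *v u i) = (\<Sum>j\<in>UNIV. if j = i then \<mu> i else 0)"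
      unfolding v(2) sum_outer_prod_form by (intro sum.cong) (auto simp: v(4))
    moreover have "u i \<noteq> 0" using v(4)[of i i] by auto
    ultimately show ?thesis using posdefD(2)[OF Q'(1), of "u i"] by simp
  qed
  define \<nu> where "\<nu> i = \<mu> i - 1" for i
  have pos: "0 < 1 + t * \<nu> i" if "0 \<le> t" "t \<le> 1" for t i
  proof -
    have "1 + t * \<nu> i = (1 - t) + t * \<mu> i" by (simp add: \<nu>_def algebra_simps)
    moreover have "0 \<le> (1 - t)" "0 \<le> t * \<mu> i" using that \<mu>[of i] by auto
    moreover have "0 < 1 - t \<or> 0 < t * \<mu> i" using that \<mu>[of i] by (cases "t = 1") auto
    ultimately show ?thesis by linarith
  qed
  have D: "Q' - Q = (\<Sum>i\<in>UNIV. \<nu> i *\<^sub>R outer_prod (v i))"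
    unfolding v(1) v(2) \<nu>_def by (simp add: scaleR_diff_left sum_subtractf)
  have Qt: "Q + t *\<^sub>R (Q' - Q) = (\<Sum>i\<in>UNIV. (1 + t * \<nu> i) *\<^sub>R outer_prod (v i))" for t
    unfolding D by (subst v(1)) (simp add: scaleR_add_left sum.distrib scaleR_sum_right)
  have R: "0 < R"
  proof -
    have "0 < norm Q" using posdefD(2)[OF Q(1), of "axis undefined 1"] by auto
    then show ?thesis using psd_norm_le_trace[OF posdefD(1)[OF Q(1)] posdefD(3)[OF Q(1)]] Q(2) by linarith
  qed
  \<comment> \<open>A lower bound for the second derivative of \<open>- ln det\<close> on the whole
    segment.\<close>
  define \<kappa> where "\<kappa> = (norm (Q' - Q))\<^sup>2 / R\<^sup>2"
  have hess: "\<kappa> \<le> (\<Sum>i\<in>UNIV. (\<nu> i)\<^sup>2 / (1 + t * \<nu> i)\<^sup>2)" if t: "0 \<le> t" "t \<le> 1" for t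
  proof -
    \<comment> \<open>The trace of the \<open>i\<close>-th rank-one term of the matrix at parameter
      \<open>t\<close>. These traces are nonnegative with sum at most \<open>R\<close>, so their
      squares sum to at most \<open>R\<^sup>2\<close>, and Cauchy-Schwarz separates them from the
      terms of the second derivative.\<close>
    define b where "b i = (1 + t * \<nu> i) * (v i \<bullet> v i)" for i
    have b: "0 \<le> b i" for i using pos[OF t, of i] by (simp add: b_def)
    have "(\<Sum>i\<in>UNIV. b i) = trace (Q + t *\<^sub>R (Q' - Q))"
      unfolding Qt b_def by (simp add: trace_sum trace_scaleR trace_outer_prod)
    also have "\<dots> = (1 - t) * trace Q + t * trace Q'"
      by (simp add: trace_add trace_sub trace_scaleR algebra_simps)
    also have "\<dots> \<le> (1 - t) * R + t * R"
      using Q(2) Q'(2) t by (intro add_mono mult_left_mono) auto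
    finally have sb: "(\<Sum>i\<in>UNIV. b i) \<le> R" by (simp add: algebra_simps)
    have "norm (Q' - Q) \<le> (\<Sum>i\<in>UNIV. norm (\<nu> i *\<^sub>R outer_prod (v i)))"
      unfolding D by (rule norm_sum)
    also have "\<dots> = (\<Sum>i\<in>UNIV. (\<bar>\<nu> i\<bar> / (1 + t * \<nu> i)) * b i)"
      using pos[OF t] by (intro sum.cong) (auto simp: norm_outer_prod b_def power2_norm_eq_inner less_imp_neq[symmetric])
    finally have "(norm (Q' - Q))\<^sup>2 \<le> (\<Sum>i\<in>UNIV. (\<bar>\<nu> i\<bar> / (1 + t * \<nu> i)) * b i)\<^sup>2"
      by (intro power_mono) auto
    also have "\<dots> \<le> (\<Sum>i\<in>UNIV. (\<bar>\<nu> i\<bar> / (1 + t * \<nu> i))\<^sup>2) * (\<Sum>i\<in>UNIV. (b i)\<^sup>2)"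
      by (rule Cauchy_Schwarz_ineq_sum)
    also have "\<dots> \<le> (\<Sum>i\<in>UNIV. (\<bar>\<nu> i\<bar> / (1 + t * \<nu> i))\<^sup>2) * R\<^sup>2"
    proof (intro mult_left_mono)
      have "(\<Sum>i\<in>UNIV. (b i)\<^sup>2) \<le> (\<Sum>i\<in>UNIV. b i * R)"
      proof (intro sum_mono)
        fix i
        have "b i \<le> (\<Sum>i\<in>UNIV. b i)" using b by (intro member_le_sum) auto
        then show "(b i)\<^sup>2 \<le> b i * R"
          using b sb by (auto simp: power2_eq_square intro!: mult_left_mono)
      qed
      also have "\<dots> = (\<Sum>i\<in>UNIV. b i) * R" by (simp add: sum_distrib_right)
      also have "\<dots> \<le> R\<^sup>2" using sb R by (simp add: power2_eq_square)
      finally show "(\<Sum>i\<in>UNIV. (b i)\<^sup>2) \<le> R\<^sup>2" .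
    qed (simp add: sum_nonneg)
    finally show ?thesis
      using R by (simp add: \<kappa>_def power_divide pos_divide_le_eq)
  qed
  \<comment> \<open>The \<open>m\<close>-th derivative of \<open>- ln det\<close> on the segment,
    normalized to 0 at \<open>t = 0\<close>; a family indexed by the order is what Taylor's formula
    takes.\<close>
  define g where "g m t = (if m = 0 then - (\<Sum>i\<in>UNIV. ln (1 + t * \<nu> i))
    else if m = 1 then - (\<Sum>i\<in>UNIV. \<nu> i / (1 + t * \<nu> i))
    else (\<Sum>i\<in>UNIV. (\<nu> i)\<^sup>2 / (1 + t * \<nu> i)\<^sup>2))" for m :: nat and t
  have g_deriv: "DERIV (g m) t :> g (Suc m) t" if "m < 2" "0 \<le> t" "t \<le> 1" for m t
  proof -
    consider "m = 0" | "m = 1" using \<open>m < 2\<close> by linarith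
    then show ?thesis
    proof cases
      case 1
      have "DERIV (\<lambda>t. - (\<Sum>i\<in>UNIV. ln (1 + t * \<nu> i))) t :> - (\<Sum>i\<in>UNIV. \<nu> i / (1 + t * \<nu> i))"
        using pos[OF that(2,3)] by (auto intro!: derivative_eq_intros simp: less_imp_neq[symmetric] divide_inverse mult.commute)
      then show ?thesis by (simp add: 1 g_def[abs_def])
    next
      case 2
      have "DERIV (\<lambda>t. - (\<Sum>i\<in>UNIV. \<nu> i / (1 + t * \<nu> i))) t :> (\<Sum>i\<in>UNIV. (\<nu> i)\<^sup>2 / (1 + t * \<nu> i)\<^sup>2)"
        using pos[OF that(2,3)]
        by (auto intro!: derivative_eq_intros simp: less_imp_neq[symmetric] power2_eq_square sum_negf)
      then show ?thesis by (simp add: 2 g_def[abs_def])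
    qed
  qed
  have ln_det: "- g 0 t = ln (det (Q + t *\<^sub>R (Q' - Q))) - ln (det Q)" if t: "0 \<le> t" "t \<le> 1" for t
    using pos[OF t] v(5)
    by (simp add: Qt v(3) g_def ln_mult prod_pos ln_prod less_imp_neq[symmetric])
  \<comment> \<open>A negative slope would let the determinant grow away from \<open>Q\<close>,
    against its maximality on the segment.\<close>
  have g'0: "0 \<le> g 1 0"
  proof (rule ccontr)
    assume "\<not> 0 \<le> g 1 0"
    then obtain d where d: "d > 0" "\<And>h. 0 < h \<Longrightarrow> h < d \<Longrightarrow> g 0 (0 + h) < g 0 0"
      using DERIV_neg_dec_right[OF g_deriv[of 0 0]] by force
    define h where "h = min 1 (d / 2)"
    have h: "0 < h" "h < d" "h \<le> 1" using d(1) by (auto simp: h_def)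
    have "0 < det (Q + h *\<^sub>R (Q' - Q))"
      unfolding Qt v(3) using v(5) pos h by (intro mult_pos_pos prod_pos) auto
    then have "ln (det (Q + h *\<^sub>R (Q' - Q))) \<le> ln (det Q)"
      using max[of h] h by simp
    then show False
      using ln_det[of h] h d(2)[of h] by (simp add: g_def)
  qed
  \<comment> \<open>Taylor's formula of order 2 with remainder at an intermediate point; the linear
    term is nonnegative, so the gap dominates the remainder.\<close>
  have "\<exists>t>0. t < 1 \<and> g 0 1 = (\<Sum>m<2. (g m 0 / fact m) * 1 ^ m) + (g 2 t / fact 2) * 1 ^ 2"
    using g_deriv by (intro Maclaurin) auto
  then obtain t where t: "0 < t" "t < 1" "g 0 1 = g 0 0 + g 1 0 + g 2 t / 2"
    by (auto simp: numeral_2_eq_2)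
  have "\<kappa> / 2 \<le> g 2 t / 2" using hess[of t] t by (simp add: g_def)
  moreover have "g 0 0 = 0" by (simp add: g_def)
  moreover have "g 0 1 \<le> \<epsilon>" using ln_det[of 1] gap by simp
  ultimately have "\<kappa> \<le> 2 * \<epsilon>" using t(3) g'0 by linarith
  then show ?thesis
    using R by (simp add: \<kappa>_def pos_divide_le_eq mult_ac)
qed

section \<open>The lifted problem\<close>

text \<open>For interior \<open>x\<close> these are the constraint vectors of the translated
  polytope \<open>P - x\<close>, again with right-hand side 1.\<close>

definition tilde :: "('m::finite \<Rightarrow> real^'n) \<Rightarrow> real^'n \<Rightarrow> 'm \<Rightarrow> real^'n" where
  "tilde a x i = (1 / (1 - a i \<bullet> x)) *\<^sub>R a i"

lemma hvec_block: "hvec a x i = block_vec (tilde a x i) 1"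
  by (auto simp: hvec_def tilde_def vec_option_eq_iff)

lemma interior_polyP: "interior (polyP a) = {x. \<forall>i. a i \<bullet> x < 1}"
proof (intro subset_antisym)
  show "interior (polyP a) \<subseteq> {x. \<forall>i. a i \<bullet> x < 1}"
  proof clarify
    fix x i assume "x \<in> interior (polyP a)"
    then have "x \<in> interior {x. a i \<bullet> x \<le> 1}"
      by (rule rev_subsetD[OF _ interior_mono]) (auto simp: polyP_def)
    then show "a i \<bullet> x < 1"
      by (cases "a i = 0") (auto simp: interior_halfspace_le)
  qed
  have "{x. \<forall>i. a i \<bullet> x < 1} = (\<Inter>i. {x. a i \<bullet> x < 1})" by auto
  then have "open {x. \<forall>i. a i \<bullet> x < 1}"
    by (auto intro!: open_INT simp: open_halfspace_lt)
  then show "{x. \<forall>i. a i \<bullet> x < 1} \<subseteq> interior (polyP a)"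
    by (intro interior_maximal) (auto simp: polyP_def less_imp_le)
qed

text \<open>The ray from 0 in direction \<open>w\<close> stays in the polytope. Below, this turns
  sign conditions on all constraint vectors into \<open>w = 0\<close>.\<close>

lemma bounded_polyP_recession:
  assumes "bounded (polyP a)" "\<And>i. a i \<bullet> w \<le> 0"
  shows "w = 0"
proof (rule ccontr)
  assume "w \<noteq> 0"
  obtain B where B: "\<And>x. x \<in> polyP a \<Longrightarrow> norm x \<le> B"
    using assms(1) by (auto simp: bounded_iff)
  define t where "t = (\<bar>B\<bar> + 1) / norm w"
  have "t *\<^sub>R w \<in> polyP a"
  proof -
    have "0 \<le> t" by (simp add: t_def)
    then have "t * (a i \<bullet> w) \<le> 0" for i
      using assms(2) by (simp add: mult_nonneg_nonpos)
    then show ?thesis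
      by (auto simp: polyP_def intro: order_trans[of _ 0])
  qed
  then have "norm (t *\<^sub>R w) \<le> B" by (rule B)
  then show False using \<open>w \<noteq> 0\<close> by (simp add: t_def)
qed

lemma tilde_inner_le_0_iff:
  assumes "x \<in> interior (polyP a)"
  shows "tilde a x i \<bullet> w \<le> 0 \<longleftrightarrow> a i \<bullet> w \<le> 0"
proof -
  have "0 < 1 - a i \<bullet> x" using assms by (simp add: interior_polyP)
  then show ?thesis by (simp add: tilde_def divide_le_0_iff)
qed

lemma tilde_recession:
  assumes "bounded (polyP a)" "x \<in> interior (polyP a)" "\<And>i. tilde a x i \<bullet> w \<le> 0"
  shows "w = 0"
  using bounded_polyP_recession[OF assms(1)] assms(3) tilde_inner_le_0_iff[OF assms(2)] by metis

text \<open>The lifted vectors span the lifted space. A vector \<open>(w, t)\<close> orthogonal to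
  all of them satisfies \<open>tilde a x i \<bullet> w = - t\<close> for every \<open>i\<close>, so
  \<open>w\<close> or \<open>- w\<close> is a recession direction, and both parts vanish.\<close>

lemma hvec_separating:
  assumes P: "bounded (polyP a)" "x \<in> interior (polyP a)" and v: "\<And>i. hvec a x i \<bullet> v = 0"
  shows "v = 0"
proof -
  obtain w t where w: "v = block_vec w t" by (rule block_vec_cases)
  have eq: "tilde a x i \<bullet> w = - t" for i
    using v[of i] by (simp add: w hvec_block)
  have "w = 0"
  proof (cases "0 \<le> t")
    case True
    then show ?thesis using tilde_recession[OF P, of w] eq by simp
  next
    case False
    then show ?thesis using tilde_recession[OF P, of "- w"] eq by simp
  qed
  then show ?thesis using eq[of undefined] w by simp
qed

lemma posdef_sum_hvec:
  fixes a :: "'m::finite \<Rightarrow> real^'n"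
  assumes P: "bounded (polyP a)" "x \<in> interior (polyP a)" and w: "\<And>i. 0 < w i"
  shows "posdef (\<Sum>i\<in>UNIV. w i *\<^sub>R outer_prod (hvec a x i))"
  unfolding posdef_def
proof (intro conjI allI impI)
  show "transpose (\<Sum>i\<in>UNIV. w i *\<^sub>R outer_prod (hvec a x i)) = (\<Sum>i\<in>UNIV. w i *\<^sub>R outer_prod (hvec a x i))"
    by (simp add: transpose_sum transpose_scalar)
  fix v :: "real^('n option)" assume "v \<noteq> 0"
  then obtain i where i: "hvec a x i \<bullet> v \<noteq> 0"
    using hvec_separating[OF P, of v] by blast
  have "0 < (\<Sum>i\<in>UNIV. w i * (hvec a x i \<bullet> v)\<^sup>2)"
    by (rule sum_pos2[of _ i]) (use i w in \<open>auto intro!: mult_pos_pos mult_nonneg_nonneg less_imp_le[OF w]\<close>)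
  then show "0 < v \<bullet> ((\<Sum>i\<in>UNIV. w i *\<^sub>R outer_prod (hvec a x i)) *v v)"
    by (simp add: sum_outer_prod_form power2_eq_square mult.assoc)
qed

lemma transpose_Mmat: "transpose (Mmat a x l) = Mmat a x l"
  by (simp add: Mmat_def transpose_sum transpose_scalar)

lemma Mmat_form: "v \<bullet> (Mmat a x l *v w) = (\<Sum>i\<in>UNIV. l $ i * (hvec a x i \<bullet> v) * (hvec a x i \<bullet> w))"
  by (simp add: Mmat_def sum_outer_prod_form)

lemma Mmat_psd: "l \<in> simplexD \<Longrightarrow> 0 \<le> v \<bullet> (Mmat a x l *v v)"
  by (auto simp: Mmat_form simplexD_def mult.assoc intro!: sum_nonneg)

lemma posdef_scaleR: "posdef A \<Longrightarrow> 0 < c \<Longrightarrow> posdef (c *\<^sub>R A)"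
  by (simp add: posdef_def transpose_scalar scaleR_matrix_mult_vec)

lemma det_scaleR: "det (c *\<^sub>R (A :: real^'k^'k)) = c ^ CARD('k) * det A"
proof -
  have "c *\<^sub>R A = (\<chi> i. c *s A $ i)" by (simp add: vec_eq_iff)
  then show ?thesis
    using det_rows_mul[of "\<lambda>_. c" "\<lambda>i. A $ i"] by simp
qed

lemma lifted_feasible_exists: "\<exists>Q. lifted_feasible a x Q"
proof -
  define s where "s = (\<Sum>i\<in>UNIV. hvec a x i \<bullet> hvec a x i)"
  have s: "0 \<le> s" "hvec a x i \<bullet> hvec a x i \<le> s" for i
    by (auto simp: s_def intro: sum_nonneg member_le_sum)
  have "hvec a x i \<bullet> hvec a x i / (1 + s) \<le> 1" for i
    using s(1) s(2)[of i] by (simp add: pos_divide_le_eq)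
  then have "lifted_feasible a x ((1 / (1 + s)) *\<^sub>R mat 1)"
    using s(1) by (auto simp: lifted_feasible_def scaleR_matrix_mult_vec intro!: posdef_scaleR posdef_mat_1)
  then show ?thesis ..
qed

text \<open>Compactness is found by relaxing to semidefinite matrices, with the trace bounding the
  norm. A maximizer there has positive determinant, because some feasible matrix has, and so it is
  positive definite.\<close>

lemma lifted_maximizer_exists:
  fixes a :: "'m::finite \<Rightarrow> real^'n"
  assumes P: "bounded (polyP a)" "x \<in> interior (polyP a)"
  shows "\<exists>Q. lifted_feasible a x Q \<and> (\<forall>Q'. lifted_feasible a x Q' \<longrightarrow> det Q' \<le> det Q)"
proof -
  let ?h = "hvec a x"
  define K where "K = {Q. transpose Q = Q \<and> (\<forall>v. 0 \<le> v \<bullet> (Q *v v)) \<and> (\<forall>i. ?h i \<bullet> (Q *v ?h i) \<le> 1)}"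
  have feasK: "Q \<in> K" if "lifted_feasible a x Q" for Q
    using that posdefD by (auto simp: K_def lifted_feasible_def)
  obtain \<alpha> where \<alpha>: "0 < \<alpha>" "\<And>v. \<alpha> * (v \<bullet> v) \<le> v \<bullet> ((\<Sum>i\<in>UNIV. 1 *\<^sub>R outer_prod (?h i)) *v v)"
    using posdef_lower_bound[OF posdef_sum_hvec[OF P, of "\<lambda>_. 1"]] by auto
  have "norm Q \<le> real CARD('m) / \<alpha>" if "Q \<in> K" for Q
  proof -
    have "\<alpha> * trace Q \<le> (\<Sum>i\<in>UNIV. 1 * (?h i \<bullet> (Q *v ?h i)))"
      using that by (intro psd_trace_bound \<alpha>) (auto simp: K_def)
    also have "\<dots> \<le> (\<Sum>i\<in>(UNIV :: 'm set). 1)"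
      using that by (intro sum_mono) (auto simp: K_def)
    finally have "trace Q \<le> real CARD('m) / \<alpha>" using \<alpha>(1) by (simp add: field_simps)
    then show ?thesis
      using psd_norm_le_trace[of Q] that by (auto simp: K_def)
  qed
  then have "bounded K" by (auto simp: bounded_iff)
  moreover have "closed K"
  proof -
    have "K = {Q. transpose Q = Q} \<inter> (\<Inter>v. {Q. 0 \<le> v \<bullet> (Q *v v)}) \<inter> (\<Inter>i. {Q. ?h i \<bullet> (Q *v ?h i) \<le> 1})"
      by (auto simp: K_def)
    moreover have "continuous_on UNIV (\<lambda>Q :: real^('n option)^('n option). transpose Q)"
      unfolding transpose_def by (intro continuous_intros)
    ultimately show ?thesis
      by (auto intro!: closed_Int closed_INT closed_Collect_le closed_Collect_eq continuous_intros)
  qed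
  ultimately have "compact K" by (simp add: compact_eq_bounded_closed)
  obtain Q0 where Q0: "lifted_feasible a x Q0" using lifted_feasible_exists by blast
  have "\<exists>Q\<in>K. \<forall>Q'\<in>K. det Q' \<le> det Q"
    using \<open>compact K\<close> feasK[OF Q0] by (intro continuous_attains_sup) (auto intro!: continuous_intros)
  then obtain Q where Q: "Q \<in> K" "\<And>Q'. Q' \<in> K \<Longrightarrow> det Q' \<le> det Q" by blast
  have "0 < det Q0" using Q0 by (auto simp: lifted_feasible_def intro: posdef_det_pos)
  also have "\<dots> \<le> det Q" by (intro Q feasK Q0)
  finally have "posdef Q"
    using Q(1) by (intro posdef_if_psd_det_nonzero) (auto simp: K_def)
  then show ?thesis
    using Q feasK by (auto simp: lifted_feasible_def K_def)
qed

text \<open>\<open>arg_min\<close> is a choice; its defining property holds once some minimizer is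
  exhibited.\<close>

lemma arg_min_is_arg_min:
  fixes f :: "'a \<Rightarrow> 'b::linorder"
  assumes "P x" "\<And>y. P y \<Longrightarrow> f x \<le> f y"
  shows "P (arg_min f P)" "\<And>y. P y \<Longrightarrow> f (arg_min f P) \<le> f y"
proof -
  have "is_arg_min f P x" using assms by (auto simp: is_arg_min_def not_less)
  then have "is_arg_min f P (arg_min f P)" unfolding arg_min_def by (rule someI)
  then show "P (arg_min f P)" "\<And>y. P y \<Longrightarrow> f (arg_min f P) \<le> f y"
    by (auto simp: is_arg_min_def not_less)
qed

lemma arg_max_is_arg_max:
  fixes f :: "'a \<Rightarrow> 'b::linorder"
  assumes "P x" "\<And>y. P y \<Longrightarrow> f y \<le> f x"
  shows "P (arg_max f P)" "\<And>y. P y \<Longrightarrow> f y \<le> f (arg_max f P)"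
proof -
  have "is_arg_max f P x" using assms by (auto simp: is_arg_max_def not_less)
  then have "is_arg_max f P (arg_max f P)" unfolding arg_max_def by (rule someI)
  then show "P (arg_max f P)" "\<And>y. P y \<Longrightarrow> f y \<le> f (arg_max f P)"
    by (auto simp: is_arg_max_def not_less)
qed

lemma Qopt_optimal:
  assumes P: "bounded (polyP a)" "x \<in> interior (polyP a)"
  shows "lifted_feasible a x (Qopt a x)" "\<And>Q. lifted_feasible a x Q \<Longrightarrow> det Q \<le> det (Qopt a x)"
proof -
  obtain Q where Q: "lifted_feasible a x Q" "\<And>Q'. lifted_feasible a x Q' \<Longrightarrow> det Q' \<le> det Q"
    using lifted_maximizer_exists[OF P] by blast
  have pos: "0 < det Q'" if "lifted_feasible a x Q'" for Q'
    using that by (auto simp: lifted_feasible_def intro: posdef_det_pos)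
  have le: "- ln (det Q) \<le> - ln (det Q')" if "lifted_feasible a x Q'" for Q'
    using Q(2)[OF that] pos[OF that] by simp
  show feas: "lifted_feasible a x (Qopt a x)"
    unfolding Qopt_def using Q(1) le by (rule arg_min_is_arg_min)
  show "det Q' \<le> det (Qopt a x)" if "lifted_feasible a x Q'" for Q'
  proof -
    have "- ln (det (Qopt a x)) \<le> - ln (det Q')"
      unfolding Qopt_def using Q(1) le that by (rule arg_min_is_arg_min)
    then show ?thesis using pos[OF that] pos[OF feas] by simp
  qed
qed

lemma posdef_convex:
  assumes "posdef A" "posdef B" "0 \<le> t" "t \<le> 1"
  shows "posdef (A + t *\<^sub>R (B - A))"
  unfolding posdef_def
proof (intro conjI allI impI)
  show "transpose (A + t *\<^sub>R (B - A)) = A + t *\<^sub>R (B - A)"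
    using assms(1,2) by (simp add: transpose_add transpose_scalar transpose_diff posdefD)
  fix v :: "real^'a" assume "v \<noteq> 0"
  then have "0 < v \<bullet> (A *v v)" "0 < v \<bullet> (B *v v)"
    using assms by (auto simp: posdefD)
  then have "0 < (1 - t) * (v \<bullet> (A *v v)) + t * (v \<bullet> (B *v v))"
    using assms(3,4) by (cases "t = 1") (auto intro!: add_pos_nonneg)
  then show "0 < v \<bullet> ((A + t *\<^sub>R (B - A)) *v v)"
    by (simp add: matrix_vector_mult_add_rdistrib scaleR_matrix_mult_vec matrix_vector_mult_diff_rdistrib
        inner_add_right inner_diff_right algebra_simps)
qed

lemma lifted_feasible_convex:
  assumes A: "lifted_feasible a x A" and B: "lifted_feasible a x B" and t: "0 \<le> t" "t \<le> 1"
  shows "lifted_feasible a x (A + t *\<^sub>R (B - A))"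
  unfolding lifted_feasible_def
proof (intro conjI allI)
  show "posdef (A + t *\<^sub>R (B - A))"
    using A B t by (intro posdef_convex) (auto simp: lifted_feasible_def)
  fix i
  have "hvec a x i \<bullet> ((A + t *\<^sub>R (B - A)) *v hvec a x i) =
      (1 - t) * (hvec a x i \<bullet> (A *v hvec a x i)) + t * (hvec a x i \<bullet> (B *v hvec a x i))"
    by (simp add: matrix_vector_mult_add_rdistrib scaleR_matrix_mult_vec matrix_vector_mult_diff_rdistrib
        inner_add_right inner_diff_right algebra_simps)
  also have "\<dots> \<le> (1 - t) * 1 + t * 1"
    using A B t by (intro add_mono mult_left_mono) (auto simp: lifted_feasible_def)
  finally show "hvec a x i \<bullet> ((A + t *\<^sub>R (B - A)) *v hvec a x i) \<le> 1" by simp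
qed

text \<open>Summing the constraints bounds the trace of every feasible matrix by
  \<open>m / \<alpha>\<close>, the radius \<open>R\<close> of the strong convexity estimate. The
  segment to \<open>Qopt\<close> consists of feasible matrices, so \<open>Qopt\<close> is maximal on
  it.\<close>

lemma near_optimal_is_close:
  assumes P: "bounded (polyP a)" "x \<in> interior (polyP (a :: 'm::finite \<Rightarrow> _))"
    and S: "0 < \<alpha>" "\<alpha> \<le> lambda_min (\<Sum>i\<in>UNIV. outer_prod (hvec a x i))"
    and Q: "lifted_feasible a x Q" "ln (det (Qopt a x)) \<le> ln (det Q) + \<epsilon>"
  shows "(norm (Q - Qopt a x))\<^sup>2 \<le> 2 * (real CARD('m) / \<alpha>)\<^sup>2 * \<epsilon>"
proof (rule near_maximizer_of_det_is_close)
  let ?S = "\<Sum>i\<in>UNIV. 1 *\<^sub>R outer_prod (hvec a x i)"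
  have S_form: "\<alpha> * (v \<bullet> v) \<le> v \<bullet> (?S *v v)" for v
  proof -
    have "\<alpha> * (v \<bullet> v) \<le> lambda_min ?S * (v \<bullet> v)"
      using S(2) by (intro mult_right_mono) auto
    also have "\<dots> \<le> v \<bullet> (?S *v v)"
      by (intro lambda_min_le_form) (simp add: transpose_sum)
    finally show ?thesis .
  qed
  have tr: "trace Q' \<le> real CARD('m) / \<alpha>" if "lifted_feasible a x Q'" for Q'
  proof -
    have "\<alpha> * trace Q' \<le> (\<Sum>i\<in>UNIV. 1 * (hvec a x i \<bullet> (Q' *v hvec a x i)))"
      using that posdefD by (intro psd_trace_bound S_form) (auto simp: lifted_feasible_def)
    also have "\<dots> \<le> (\<Sum>i\<in>(UNIV :: 'm set). 1)"
      using that by (intro sum_mono) (auto simp: lifted_feasible_def)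
    finally show ?thesis using S(1) by (simp add: field_simps)
  qed
  note opt = Qopt_optimal[OF P]
  show "posdef Q" "posdef (Qopt a x)" using Q opt by (auto simp: lifted_feasible_def)
  show "trace Q \<le> real CARD('m) / \<alpha>" "trace (Qopt a x) \<le> real CARD('m) / \<alpha>"
    using tr Q opt by auto
  show "det (Qopt a x + t *\<^sub>R (Q - Qopt a x)) \<le> det (Qopt a x)" if "0 \<le> t" "t \<le> 1" for t
    using that by (intro opt lifted_feasible_convex Q)
qed (fact Q)

text \<open>Simplex weights average the constraints to at most 1, which is the hypothesis of the
  determinant bound in dimension \<open>n + 1\<close>.\<close>

lemma weak_duality:
  fixes a :: "'m::finite \<Rightarrow> real^'n"
  assumes Q: "lifted_feasible a x Q" and l: "l \<in> simplexD" "posdef (Mmat a x l)"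
  shows "ln (det Q) \<le> - ln (det (Mmat a x l)) - (real CARD('n) + 1) * ln (real CARD('n) + 1)"
proof -
  have "(\<Sum>i\<in>UNIV. l $ i * (hvec a x i \<bullet> (Q *v hvec a x i))) \<le> (\<Sum>i\<in>UNIV. l $ i * 1)"
    using Q l by (intro sum_mono mult_left_mono) (auto simp: lifted_feasible_def simplexD_def)
  also have "\<dots> = 1" using l by (simp add: simplexD_def)
  finally have "det Q * det (Mmat a x l) * real CARD('n option) ^ CARD('n option) \<le> 1"
    using Q l unfolding Mmat_def by (intro det_mult_le_if_weighted_form_le_1) (auto simp: lifted_feasible_def)
  moreover have "0 < det Q" "0 < det (Mmat a x l)"
    using Q l by (auto simp: lifted_feasible_def intro: posdef_det_pos)
  ultimately have "ln (det Q * det (Mmat a x l) * real CARD('n option) ^ CARD('n option)) \<le> ln 1"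
    by (subst ln_le_cancel_iff) auto
  also have "ln (det Q * det (Mmat a x l) * real CARD('n option) ^ CARD('n option)) =
      ln (det Q) + ln (det (Mmat a x l)) + ln (real CARD('n option) ^ CARD('n option))"
    using \<open>0 < det Q\<close> \<open>0 < det (Mmat a x l)\<close>
    by (subst ln_mult_pos; (subst ln_mult_pos)?) auto
  also have "ln (real CARD('n option) ^ CARD('n option)) = (real CARD('n) + 1) * ln (real CARD('n) + 1)"
    by (subst ln_realpow) (auto simp: add.commute)
  finally show ?thesis by simp
qed

lemma ln_det_recovered:
  fixes a :: "'m::finite \<Rightarrow> real^'n"
  assumes M: "posdef (Mmat a x l)" and \<zeta>: "0 < \<zeta>"
  shows "ln (det (recovered a x \<zeta> l)) =
    - (real CARD('n) + 1) * (ln (real CARD('n) + 1) + ln (1 + \<zeta>)) - ln (det (Mmat a x l))"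
proof -
  define d where "d = real CARD('n) + 1"
  have d: "0 < d" by (simp add: d_def)
  have M0: "0 < det (Mmat a x l)" using M by (rule posdef_det_pos)
  have "ln (det (recovered a x \<zeta> l)) = ln ((1 / (d * (1 + \<zeta>))) ^ CARD('n option)) + ln (1 / det (Mmat a x l))"
    unfolding recovered_def d_def[symmetric] det_scaleR using d \<zeta> M0
    by (subst ln_mult_pos[symmetric]) (auto simp: det_matrix_inv)
  also have "ln ((1 / (d * (1 + \<zeta>))) ^ CARD('n option)) = - d * (ln d + ln (1 + \<zeta>))"
  proof -
    have "ln ((1 / (d * (1 + \<zeta>))) ^ CARD('n option)) = d * ln (1 / (d * (1 + \<zeta>)))"
      by (subst ln_realpow) (simp_all add: d_def add.commute)
    moreover have "ln (1 / (d * (1 + \<zeta>))) = - (ln d + ln (1 + \<zeta>))"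
      using d \<zeta> by (simp add: ln_div ln_mult_pos)
    ultimately show ?thesis
      by (simp only: mult_minus_left mult_minus_right)
  qed
  also have "ln (1 / det (Mmat a x l)) = - ln (det (Mmat a x l))"
    using M0 by (simp add: ln_div)
  finally show ?thesis by (simp add: d_def)
qed

text \<open>Dividing \<open>matrix_inv M\<close> by \<open>d * (1 + \<zeta>)\<close> turns the upper
  leverage bounds into the feasibility constraints. Relative to the dual value at \<open>l\<close>
  this costs \<open>d * ln (1 + \<zeta>) \<le> d * \<zeta>\<close>.\<close>

lemma recovered_near_optimal:
  fixes a :: "'m::finite \<Rightarrow> real^'n"
  assumes l: "strong_approx a x \<zeta> l" and \<zeta>: "0 < \<zeta>"
  shows "lifted_feasible a x (recovered a x \<zeta> l)"
    and "lifted_feasible a x Q \<Longrightarrow> ln (det Q) \<le> ln (det (recovered a x \<zeta> l)) + (real CARD('n) + 1) * \<zeta>"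
proof -
  define d where "d = real CARD('n) + 1"
  define M where "M = Mmat a x l"
  have d: "0 < d" by (simp add: d_def)
  have M: "posdef M" "l \<in> simplexD" "\<And>i. lev a x l i \<le> (1 + \<zeta>) * d"
    using l by (auto simp: strong_approx_def M_def d_def)
  have rec: "recovered a x \<zeta> l = (1 / (d * (1 + \<zeta>))) *\<^sub>R matrix_inv M"
    by (simp add: recovered_def d_def M_def)
  show "lifted_feasible a x (recovered a x \<zeta> l)"
    unfolding lifted_feasible_def rec
  proof (intro conjI allI)
    show "posdef ((1 / (d * (1 + \<zeta>))) *\<^sub>R matrix_inv M)"
      using d \<zeta> by (intro posdef_scaleR posdef_matrix_inv M) auto
    fix i
    have "hvec a x i \<bullet> ((1 / (d * (1 + \<zeta>))) *\<^sub>R matrix_inv M *v hvec a x i) = lev a x l i / (d * (1 + \<zeta>))"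
      by (simp add: scaleR_matrix_mult_vec lev_def M_def)
    also have "\<dots> \<le> 1"
      using M(3)[of i] d \<zeta> by (simp add: mult.commute)
    finally show "hvec a x i \<bullet> ((1 / (d * (1 + \<zeta>))) *\<^sub>R matrix_inv M *v hvec a x i) \<le> 1" .
  qed
  assume Q: "lifted_feasible a x Q"
  have "d * ln (1 + \<zeta>) \<le> d * \<zeta>"
    using d \<zeta> by (intro mult_left_mono ln_add_one_self_le_self) auto
  then show "ln (det Q) \<le> ln (det (recovered a x \<zeta> l)) + (real CARD('n) + 1) * \<zeta>"
    using weak_duality[OF Q M(2)] ln_det_recovered[OF M(1)[unfolded M_def] \<zeta>] M(1)
    by (simp add: M_def d_def algebra_simps)
qed

section \<open>Ellipsoids\<close>

lemma posdef_Cauchy_Schwarz: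
  assumes "posdef A"
  shows "(u \<bullet> (A *v v))\<^sup>2 \<le> (u \<bullet> (A *v u)) * (v \<bullet> (A *v v))"
proof (cases "v = 0")
  case False
  define b c where "b = u \<bullet> (A *v v)" and "c = v \<bullet> (A *v v)"
  have c: "0 < c" using assms False by (simp add: c_def posdefD)
  have "0 \<le> (u - (b / c) *\<^sub>R v) \<bullet> (A *v (u - (b / c) *\<^sub>R v))"
    by (rule posdefD(3)[OF assms])
  also have "\<dots> = u \<bullet> (A *v u) - 2 * (b / c) * b + (b / c)\<^sup>2 * c"
    using symmetric_inner_commute[OF posdefD(1)[OF assms], of v u]
    by (simp add: matrix_vector_mult_diff_distrib matrix_vector_mult_scaleR inner_diff_left
        inner_diff_right b_def[symmetric] c_def[symmetric] power2_eq_square algebra_simps)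
  also have "\<dots> = u \<bullet> (A *v u) - b\<^sup>2 / c"
    using c by (simp add: power2_eq_square)
  finally have "b\<^sup>2 \<le> (u \<bullet> (A *v u)) * c"
    using c by (simp add: pos_divide_le_eq)
  then show ?thesis by (simp add: b_def c_def)
qed simp

lemma closed_ellipsoid: "closed (ellipsoid c Q)"
  unfolding ellipsoid_def by (intro closed_Collect_le continuous_intros)

lemma convex_ellipsoid:
  assumes "posdef Q"
  shows "convex (ellipsoid c Q)"
proof (rule convexI)
  fix x y and s t :: real
  assume xy: "x \<in> ellipsoid c Q" "y \<in> ellipsoid c Q" and st: "0 \<le> s" "0 \<le> t" "s + t = 1"
  define u v where "u = x - c" and "v = y - c"
  have uv: "u \<bullet> (Q *v u) \<le> 1" "v \<bullet> (Q *v v) \<le> 1"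
    using xy by (auto simp: ellipsoid_def u_def v_def)
  have "(u \<bullet> (Q *v v))\<^sup>2 \<le> (u \<bullet> (Q *v u)) * (v \<bullet> (Q *v v))"
    by (rule posdef_Cauchy_Schwarz[OF assms])
  also have "\<dots> \<le> 1"
    using uv by (intro mult_le_one posdefD(3)[OF assms])
  finally have cross: "u \<bullet> (Q *v v) \<le> 1"
    using power2_le_imp_le[of "u \<bullet> (Q *v v)" 1] by simp
  have "s *\<^sub>R x + t *\<^sub>R y - c = s *\<^sub>R u + t *\<^sub>R v"
    using st(3) by (simp add: u_def v_def algebra_simps flip: scaleR_add_left)
  then have "(s *\<^sub>R x + t *\<^sub>R y - c) \<bullet> (Q *v (s *\<^sub>R x + t *\<^sub>R y - c)) =
      (s * s) * (u \<bullet> (Q *v u)) + (2 * s * t) * (u \<bullet> (Q *v v)) + (t * t) * (v \<bullet> (Q *v v))"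
    using symmetric_inner_commute[OF posdefD(1)[OF assms], of v u]
    by (simp add: matrix_vector_right_distrib matrix_vector_mult_scaleR inner_add_left inner_add_right algebra_simps)
  also have "\<dots> \<le> (s * s) * 1 + (2 * s * t) * 1 + (t * t) * 1"
    using st uv cross by (intro add_mono mult_left_mono) auto
  also have "\<dots> = (s + t)\<^sup>2" by (simp add: power2_eq_square algebra_simps)
  finally show "s *\<^sub>R x + t *\<^sub>R y \<in> ellipsoid c Q"
    using st(3) by (simp add: ellipsoid_def)
qed

text \<open>The composition of the point reflections in the two centers is a translation preserving
  the ellipsoid; iterating it would leave the ellipsoid unless the centers agree. For equal centers
  the boundary point on each ray determines the quadratic form. This is what makes
  \<open>ellipsoid_center\<close> and \<open>ellipsoid_vol\<close> well defined.\<close>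

lemma ellipsoid_inj:
  assumes Q: "posdef Q" "posdef Q'" and eq: "ellipsoid c Q = ellipsoid c' Q'"
  shows "c = c' \<and> Q = Q'"
proof -
  define w where "w = 2 *\<^sub>R (c' - c)"
  have refl: "2 *\<^sub>R c - y \<in> ellipsoid c Q" if "y \<in> ellipsoid c Q" for c Q and y :: "real^'a"
  proof -
    have "2 *\<^sub>R c - y - c = - (y - c)" by (simp add: scaleR_2)
    moreover have "Q *v (- (y - c)) = - (Q *v (y - c))"
      using matrix_vector_mult_scaleR[of Q "-1" "y - c"] by simp
    ultimately show ?thesis
      using that by (simp only: ellipsoid_def mem_Collect_eq inner_minus_left inner_minus_right minus_minus)
  qed
  have trans: "y + w \<in> ellipsoid c Q" if "y \<in> ellipsoid c Q" for y
  proof -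
    have "2 *\<^sub>R c' - (2 *\<^sub>R c - y) \<in> ellipsoid c Q"
      using refl[of "2 *\<^sub>R c - y" c' Q'] refl[OF that] eq by simp
    then show ?thesis by (simp add: w_def algebra_simps)
  qed
  have "c + real k *\<^sub>R w \<in> ellipsoid c Q" for k
  proof (induction k)
    case (Suc k)
    show ?case using trans[OF Suc] by (simp add: algebra_simps)
  qed (simp add: ellipsoid_def)
  then have k: "(real k)\<^sup>2 * (w \<bullet> (Q *v w)) \<le> 1" for k
    by (simp add: ellipsoid_def matrix_vector_mult_scaleR power2_eq_square mult.assoc)
  have "w = 0"
  proof (rule ccontr)
    assume "w \<noteq> 0"
    then have pos: "0 < w \<bullet> (Q *v w)" using Q by (simp add: posdefD)
    obtain k where "1 / (w \<bullet> (Q *v w)) < real k" using reals_Archimedean2 by blast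
    then have "1 < real k * (w \<bullet> (Q *v w))" "1 \<le> real k"
      using pos by (auto simp: field_simps) (metis One_nat_def Suc_leI of_nat_0_less_iff of_nat_1 of_nat_le_iff pos
          zero_less_mult_pos2 less_trans zero_less_one)
    then have "1 < real k * (real k * (w \<bullet> (Q *v w)))"
      by (smt (verit) mult_le_cancel_right1)
    then show False using k[of k] by (simp add: power2_eq_square mult.assoc)
  qed
  then have c: "c = c'" by (simp add: w_def)
  have le: "u \<bullet> (B *v u) \<le> u \<bullet> (A *v u)"
    if A: "posdef A" and AB: "ellipsoid c A = ellipsoid c B" for u and A B :: "real^'a^'a"
  proof (cases "u = 0")
    case False
    then have pos: "0 < u \<bullet> (A *v u)" using A by (simp add: posdefD)
    define r where "r = sqrt (u \<bullet> (A *v u))"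
    have r: "0 < r" "r * r = u \<bullet> (A *v u)" using pos by (auto simp: r_def)
    have "c + (1 / r) *\<^sub>R u \<in> ellipsoid c A"
      using r by (simp add: ellipsoid_def matrix_vector_mult_scaleR)
    then have "c + (1 / r) *\<^sub>R u \<in> ellipsoid c B" using AB by simp
    then have "(u \<bullet> (B *v u)) / (r * r) \<le> 1"
      by (simp add: ellipsoid_def matrix_vector_mult_scaleR)
    then show ?thesis using r pos by (simp add: pos_divide_le_eq)
  qed simp
  have form: "u \<bullet> (Q *v u) = u \<bullet> (Q' *v u)" for u
    using le[OF Q(1), of Q'] le[OF Q(2), of Q] eq c by (auto intro: antisym)
  have "transpose (Q - Q') = Q - Q'"
    using Q by (simp add: transpose_diff posdefD)
  moreover have "u \<bullet> ((Q - Q') *v u) = 0" for u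
    using form by (simp add: matrix_vector_mult_diff_rdistrib inner_diff_right)
  ultimately have "u \<bullet> ((Q - Q') *v v) = 0" for u v
    using psd_form_zero[of "Q - Q'" UNIV u v] subspace_UNIV by auto
  then have "(Q - Q') *v v = 0" for v
    using inner_eq_zero_iff by blast
  then have "Q = Q'"
    by (simp add: matrix_eq matrix_vector_mult_diff_rdistrib)
  with c show ?thesis by simp
qed

lemma ellipsoid_center_eq: "posdef Q \<Longrightarrow> ellipsoid_center (ellipsoid c Q) = c"
  unfolding ellipsoid_center_def using ellipsoid_inj by (intro the_equality) blast+

lemma ellipsoid_vol_eq: "posdef Q \<Longrightarrow> ellipsoid_vol (ellipsoid c Q) = det Q powr (- 1 / 2)"
  unfolding ellipsoid_vol_def
proof (rule the_equality)
  fix r assume "posdef Q" "\<exists>c' Q'. posdef Q' \<and> ellipsoid c Q = ellipsoid c' Q' \<and> r = det Q' powr (- 1 / 2)"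
  then show "r = det Q powr (- 1 / 2)" using ellipsoid_inj by blast
qed blast

lemma ellipsoid_vol_pos: "posdef Q \<Longrightarrow> 0 < ellipsoid_vol (ellipsoid c Q)"
  using posdef_det_pos[of Q] by (simp add: ellipsoid_vol_eq)

lemma ln_ellipsoid_vol: "posdef Q \<Longrightarrow> ln (ellipsoid_vol (ellipsoid c Q)) = - ln (det Q) / 2"
  by (simp add: ellipsoid_vol_eq ln_powr)

lemma ellipsoid_vol_le_iff:
  assumes "posdef Q" "posdef Q'"
  shows "ellipsoid_vol (ellipsoid c Q) \<le> ellipsoid_vol (ellipsoid c' Q') \<longleftrightarrow> det Q' \<le> det Q"
proof -
  have "ellipsoid_vol (ellipsoid c Q) \<le> ellipsoid_vol (ellipsoid c' Q') \<longleftrightarrow>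
      ln (ellipsoid_vol (ellipsoid c Q)) \<le> ln (ellipsoid_vol (ellipsoid c' Q'))"
    using assms by (simp add: ellipsoid_vol_pos)
  then show ?thesis
    using assms by (simp add: ln_ellipsoid_vol posdef_det_pos)
qed

text \<open>\<open>b \<bullet> c + sqrt (b \<bullet> (matrix_inv Q *v b))\<close> is the support
  function of the ellipsoid: an upper bound by Cauchy-Schwarz for \<open>Q\<close>, attained in the
  direction \<open>matrix_inv Q *v b\<close> from the center.\<close>

lemma ellipsoid_subset_halfspace:
  assumes Q: "posdef Q"
  shows "ellipsoid c Q \<subseteq> {y. b \<bullet> y \<le> r} \<longleftrightarrow> b \<bullet> c + sqrt (b \<bullet> (matrix_inv Q *v b)) \<le> r"
proof
  have d: "det Q \<noteq> 0" using posdef_det_pos[OF Q] by simp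
  define w where "w = matrix_inv Q *v b"
  have Qw: "Q *v w = b" by (simp add: w_def matrix_inv_mult_vec[OF d])
  have bw: "b \<bullet> w = w \<bullet> (Q *v w)" by (simp add: Qw inner_commute)
  define \<rho> where "\<rho> = sqrt (b \<bullet> w)"
  have \<rho>: "0 \<le> \<rho>" "\<rho> * \<rho> = b \<bullet> w"
    using posdefD(3)[OF Q, of w] by (auto simp: \<rho>_def bw)
  {
    assume sub: "ellipsoid c Q \<subseteq> {y. b \<bullet> y \<le> r}"
    have "b \<bullet> c + \<rho> \<le> r"
    proof (cases "\<rho> = 0")
      case True
      have "c \<in> ellipsoid c Q" by (simp add: ellipsoid_def)
      then show ?thesis using sub True by auto
    next
      case False
      have "c + (1 / \<rho>) *\<^sub>R w \<in> ellipsoid c Q"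
        using False \<rho> by (simp add: ellipsoid_def matrix_vector_mult_scaleR bw[symmetric])
      then have "b \<bullet> (c + (1 / \<rho>) *\<^sub>R w) \<le> r" using sub by auto
      moreover have "b \<bullet> (c + (1 / \<rho>) *\<^sub>R w) = b \<bullet> c + \<rho>"
        using False \<rho>(2)[symmetric] by (simp add: inner_add_right)
      ultimately show ?thesis by simp
    qed
    then show "b \<bullet> c + sqrt (b \<bullet> (matrix_inv Q *v b)) \<le> r"
      by (simp add: \<rho>_def w_def)
  }
  {
    assume "b \<bullet> c + sqrt (b \<bullet> (matrix_inv Q *v b)) \<le> r"
    then have le: "b \<bullet> c + \<rho> \<le> r" by (simp add: \<rho>_def w_def)
    show "ellipsoid c Q \<subseteq> {y. b \<bullet> y \<le> r}"
    proof clarify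
      fix y assume y: "y \<in> ellipsoid c Q"
      have "(b \<bullet> (y - c))\<^sup>2 = (w \<bullet> (Q *v (y - c)))\<^sup>2"
        using symmetric_inner_commute[OF posdefD(1)[OF Q], of w "y - c"] by (simp add: Qw inner_commute)
      also have "\<dots> \<le> (w \<bullet> (Q *v w)) * ((y - c) \<bullet> (Q *v (y - c)))"
        by (rule posdef_Cauchy_Schwarz[OF Q])
      also have "\<dots> \<le> (w \<bullet> (Q *v w)) * 1"
        using y posdefD(3)[OF Q] by (intro mult_left_mono) (auto simp: ellipsoid_def)
      also have "\<dots> = \<rho>\<^sup>2" using \<rho>(2) by (simp add: bw power2_eq_square)
      finally have "b \<bullet> (y - c) \<le> \<rho>" by (rule power2_le_imp_le) (rule \<rho>)
      then show "b \<bullet> y \<le> r" using le by (simp add: inner_diff_right)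
    qed
  }
qed

text \<open>The polar body is generated by the vectors \<open>tilde a x i\<close>, so containment in
  a closed convex set is tested on them. A functional separating a polar point from \<open>S\<close>
  either rescales to a point of \<open>P - x\<close> that contradicts polarity, or is a recession
  direction of \<open>P\<close>.\<close>

lemma polar_set_subset_iff:
  assumes P: "bounded (polyP a)" "x \<in> interior (polyP a)" and S: "closed S" "convex S"
  shows "polar_set ((\<lambda>p. p - x) ` polyP a) \<subseteq> S \<longleftrightarrow> (\<forall>i. tilde a x i \<in> S)"
proof
  have pos: "0 < 1 - a i \<bullet> x" for i using P(2) by (simp add: interior_polyP)
  have mem: "p \<in> polyP a \<longleftrightarrow> (\<forall>i. tilde a x i \<bullet> (p - x) \<le> 1)" for p
  proof -
    have "tilde a x i \<bullet> (p - x) \<le> 1 \<longleftrightarrow> a i \<bullet> p \<le> 1" for i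
    proof -
      have "tilde a x i \<bullet> (p - x) = (a i \<bullet> p - a i \<bullet> x) / (1 - a i \<bullet> x)"
        by (simp add: tilde_def inner_diff_right diff_divide_distrib)
      then show ?thesis using pos[of i] by (simp add: pos_divide_le_eq)
    qed
    then show ?thesis by (simp add: polyP_def)
  qed
  {
    assume "polar_set ((\<lambda>p. p - x) ` polyP a) \<subseteq> S"
    moreover have "tilde a x i \<in> polar_set ((\<lambda>p. p - x) ` polyP a)" for i
      using mem by (auto simp: polar_set_def)
    ultimately show "\<forall>i. tilde a x i \<in> S" by blast
  }
  {
    assume S': "\<forall>i. tilde a x i \<in> S"
    show "polar_set ((\<lambda>p. p - x) ` polyP a) \<subseteq> S"
    proof
      fix w assume w: "w \<in> polar_set ((\<lambda>p. p - x) ` polyP a)"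
      have wle: "w \<bullet> u \<le> 1" if "\<And>i. tilde a x i \<bullet> u \<le> 1" for u
      proof -
        have "x + u \<in> polyP a" using that by (simp add: mem)
        then have "u \<in> (\<lambda>p. p - x) ` polyP a" by (auto intro!: image_eqI[of _ _ "x + u"])
        then show ?thesis using w by (auto simp: polar_set_def)
      qed
      show "w \<in> S"
      proof (rule ccontr)
        assume "w \<notin> S"
        then obtain u b where ub: "u \<bullet> w < b" "\<And>s. s \<in> S \<Longrightarrow> b < u \<bullet> s"
          using separating_hyperplane_closed_point[OF S(2,1)] by metis
        have t: "tilde a x i \<bullet> (- u) < - b" for i
          using ub(2)[of "tilde a x i"] S' by (simp add: inner_commute)
        have wu: "- b < w \<bullet> (- u)" using ub(1) by (simp add: inner_commute)
        show False
        proof (cases "0 < - b")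
          case True
          have "tilde a x i \<bullet> ((1 / - b) *\<^sub>R (- u)) \<le> 1" for i
            using t[of i] True by (simp add: divide_simps)
          from wle[OF this] show False
            using wu True by (simp add: divide_simps split: if_splits)
        next
          case False
          have "tilde a x i \<bullet> (- u) \<le> 0" for i
            using t[of i] False by simp
          then have "- u = 0" by (rule tilde_recession[OF P])
          then show False using t[of undefined] wu by simp
        qed
      qed
    qed
  }
qed

section \<open>Lifted matrices and inscribed ellipsoids\<close>

lemma blk_block_mat [simp]: "blkG (block_mat G z w c) = G" "blkz (block_mat G z w c) = z" "blks (block_mat G z w c) = c"
  by (simp_all add: blkG_def blkz_def blks_def vec_eq_iff)

lemma symmetric_block_mat:
  assumes "transpose Q = Q"
  shows "Q = block_mat (blkG Q) (blkz Q) (blkz Q) (blks Q)"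
  by (metis assms block_mat_blk)

lemma block_form:
  assumes "transpose Q = Q"
  shows "block_vec y t \<bullet> (Q *v block_vec y t) = y \<bullet> (blkG Q *v y) + 2 * t * (blkz Q \<bullet> y) + t * t * blks Q"
  by (subst symmetric_block_mat[OF assms])
    (simp add: inner_add_right inner_commute algebra_simps)

lemma posdef_blkG:
  assumes "posdef Q" shows "posdef (blkG Q)"
  unfolding posdef_def
proof (intro conjI allI impI)
  show "transpose (blkG Q) = blkG Q"
    using posdefD(1)[OF assms] by (simp add: blkG_def transpose_def vec_eq_iff)
  fix v :: "real^'a" assume "v \<noteq> 0"
  then have "0 < block_vec v 0 \<bullet> (Q *v block_vec v 0)"
    by (intro posdefD(2)[OF assms]) simp
  then show "0 < v \<bullet> (blkG Q *v v)"
    by (simp add: block_form[OF posdefD(1)[OF assms]])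
qed

lemma det_blkG_betaQ:
  assumes "posdef Q"
  shows "det Q = det (blkG Q) * (1 - betaQ Q)" "betaQ Q < 1"
proof -
  have G: "posdef (blkG Q)" by (rule posdef_blkG[OF assms])
  show eq: "det Q = det (blkG Q) * (1 - betaQ Q)"
    using posdef_det_pos[OF G]
    by (subst symmetric_block_mat[OF posdefD(1)[OF assms]], subst det_block_schur_complement)
      (simp_all add: posdefD[OF G] betaQ_def)
  show "betaQ Q < 1"
    using posdef_det_pos[OF assms] posdef_det_pos[OF G] unfolding eq by (simp add: zero_less_mult_iff)
qed

lemma tilde_form:
  assumes "lifted_feasible a x Q"
  shows "tilde a x i \<bullet> (blkG Q *v tilde a x i) + 2 * (blkz Q \<bullet> tilde a x i) + blks Q \<le> 1"
proof -
  have "hvec a x i \<bullet> (Q *v hvec a x i) \<le> 1" and Q: "posdef Q"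
    using assms by (auto simp: lifted_feasible_def)
  then show ?thesis
    unfolding hvec_block block_form[OF posdefD(1)[OF Q]] by simp
qed

text \<open>If \<open>blks Q\<close> were at least 1, the constraints would force
  \<open>tilde a x i \<bullet> blkz Q \<le> 0\<close>, hence \<open>blkz Q = 0\<close>, and then
  every \<open>tilde a x i = 0\<close>, which boundedness excludes. These signs give the
  denominators of center and shape their meaning.\<close>

lemma lifted_feasible_blks_betaQ:
  fixes a :: "'m::finite \<Rightarrow> real^'n"
  assumes P: "bounded (polyP a)" "x \<in> interior (polyP a)" and Q: "lifted_feasible a x Q"
  shows "blks Q < 1" "0 < betaQ Q" "1 - blks Q \<le> betaQ Q"
proof -
  have pQ: "posdef Q" using Q by (simp add: lifted_feasible_def)
  note G = posdef_blkG[OF pQ]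
  show "blks Q < 1"
  proof (rule ccontr)
    assume s: "\<not> blks Q < 1"
    have "tilde a x i \<bullet> blkz Q \<le> 0" for i
      using tilde_form[OF Q, of i] s posdefD(3)[OF G, of "tilde a x i"] by (simp add: inner_commute)
    then have z: "blkz Q = 0" by (rule tilde_recession[OF P])
    have "tilde a x i = 0" for i
      using tilde_form[OF Q, of i] s posdefD(2)[OF G, of "tilde a x i"] by (force simp: z)
    then have "axis undefined 1 = (0 :: real^'n)"
      by (intro tilde_recession[OF P]) simp
    then show False by simp
  qed
  show "1 - blks Q \<le> betaQ Q"
    using posdefD(3)[OF posdef_matrix_inv[OF G]] by (simp add: betaQ_def)
  with \<open>blks Q < 1\<close> show "0 < betaQ Q" by simp
qed

text \<open>The logarithm of \<open>\<kappa> = (1 - \<beta>) \<beta>\<^sup>n\<close> at its maximizer \<open>\<beta> = n / (n + 1)\<close>.\<close>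

definition ln_kappa :: "real \<Rightarrow> real" where
  "ln_kappa n = n * ln n - (n + 1) * ln (n + 1)"

text \<open>Uses \<open>ln u \<le> u - 1\<close> at \<open>u = (n + 1) * (1 - \<beta>)\<close> and,
  with weight \<open>n\<close>, at \<open>u = (n + 1) * \<beta> / n\<close>; the right-hand sides
  cancel.\<close>

lemma ln_kappa_ge:
  fixes n \<beta> :: real
  assumes "1 \<le> n" "0 < \<beta>" "\<beta> < 1"
  shows "ln (1 - \<beta>) + n * ln \<beta> \<le> ln_kappa n"
proof -
  have "ln ((n + 1) * (1 - \<beta>)) \<le> (n + 1) * (1 - \<beta>) - 1"
    using assms by (intro ln_le_minus_one) auto
  moreover have "n * ln ((n + 1) * \<beta> / n) \<le> (n + 1) * \<beta> - n"
  proof -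
    have "n * ln ((n + 1) * \<beta> / n) \<le> n * ((n + 1) * \<beta> / n - 1)"
      using assms by (intro mult_left_mono ln_le_minus_one) auto
    also have "\<dots> = (n + 1) * \<beta> - n"
      using assms by (simp add: right_diff_distrib)
    finally show ?thesis .
  qed
  moreover have "ln ((n + 1) * (1 - \<beta>)) = ln (n + 1) + ln (1 - \<beta>)"
    using assms by (simp add: ln_mult_pos)
  moreover have "ln ((n + 1) * \<beta> / n) = ln (n + 1) + ln \<beta> - ln n"
    using assms by (simp add: ln_mult_pos ln_div)
  ultimately have "ln (n + 1) + ln (1 - \<beta>) \<le> (n + 1) * (1 - \<beta>) - 1"
    "n * (ln (n + 1) + ln \<beta> - ln n) \<le> (n + 1) * \<beta> - n"
    by simp_all
  then have "ln (n + 1) + ln (1 - \<beta>) + n * (ln (n + 1) + ln \<beta> - ln n) \<le> 0"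
    by (simp add: right_diff_distrib)
  then show ?thesis
    by (simp add: ln_kappa_def algebra_simps)
qed

lemma lift_ellipsoid:
  fixes a :: "'m::finite \<Rightarrow> real^'n"
  assumes A: "posdef A" and sub: "\<And>i. tilde a x i \<in> ellipsoid c A"
  obtains Q where "lifted_feasible a x Q" "ln (det Q) = ln (det A) + ln_kappa (real CARD('n))"
proof -
  define n where "n = real CARD('n)"
  have n: "1 \<le> n" by (simp add: n_def Suc_leI)
  \<comment> \<open>The lifted matrix has \<open>betaQ Q = t\<close> and determinant
    \<open>t ^ n * (1 - t) * det A\<close>, so \<open>t\<close> is taken as the maximizer behind
    \<open>ln_kappa\<close>.\<close>
  define t where "t = n / (n + 1)"
  have t: "0 < t" "t < 1" using n by (auto simp: t_def)
  define Q where "Q = block_mat (t *\<^sub>R A) (- t *\<^sub>R (A *v c)) (- t *\<^sub>R (A *v c)) (t * (c \<bullet> (A *v c)) + (1 - t))"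
  have tQ: "transpose Q = Q"
    by (simp add: Q_def transpose_scalar posdefD(1)[OF A])
  have form: "block_vec y r \<bullet> (Q *v block_vec y r) = t * ((y - r *\<^sub>R c) \<bullet> (A *v (y - r *\<^sub>R c))) + (1 - t) * (r * r)" for y r
    unfolding block_form[OF tQ]
    using symmetric_inner_commute[OF posdefD(1)[OF A], of c y]
    by (simp add: Q_def scaleR_matrix_mult_vec matrix_vector_mult_diff_distrib matrix_vector_mult_scaleR
        inner_diff_left inner_diff_right inner_commute algebra_simps)
  have pQ: "posdef Q"
    unfolding posdef_def
  proof (intro conjI allI impI tQ)
    fix v :: "real^('n option)" assume "v \<noteq> 0"
    obtain y r where v: "v = block_vec y r" by (rule block_vec_cases)
    show "0 < v \<bullet> (Q *v v)"
    proof (cases "r = 0")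
      case True
      then have "y \<noteq> 0" using \<open>v \<noteq> 0\<close> v by simp
      then show ?thesis unfolding v form using True t posdefD(2)[OF A, of y] by simp
    next
      case False
      then have "0 < (1 - t) * (r * r)" using t False by (auto simp: zero_less_mult_iff)
      moreover have "0 \<le> t * ((y - r *\<^sub>R c) \<bullet> (A *v (y - r *\<^sub>R c)))"
        using t posdefD(3)[OF A] by (intro mult_nonneg_nonneg) auto
      ultimately show ?thesis unfolding v form by linarith
    qed
  qed
  have "hvec a x i \<bullet> (Q *v hvec a x i) \<le> 1" for i
  proof -
    have "t * ((tilde a x i - c) \<bullet> (A *v (tilde a x i - c))) \<le> t * 1"
      using sub[of i] t by (intro mult_left_mono) (auto simp: ellipsoid_def)
    then show ?thesis
      using form[of "tilde a x i" 1] by (simp add: hvec_block)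
  qed
  then have "lifted_feasible a x Q" using pQ by (simp add: lifted_feasible_def)
  moreover have "ln (det Q) = ln (det A) + ln_kappa n"
  proof -
    have inv: "matrix_inv (t *\<^sub>R A) *v (t *\<^sub>R (A *v c)) = c"
    proof -
      have "det (t *\<^sub>R A) \<noteq> 0"
        using t posdef_det_pos[OF A] by (simp add: det_scaleR)
      from matrix_inv_mult_vec(2)[OF this, of c] show ?thesis
        by (simp add: scaleR_matrix_mult_vec)
    qed
    have "matrix_inv (t *\<^sub>R A) *v (- t *\<^sub>R (A *v c)) = - c"
      using matrix_vector_mult_scaleR[of "matrix_inv (t *\<^sub>R A)" "-1" "t *\<^sub>R (A *v c)"] inv by simp
    then have "betaQ Q = t"
      by (simp add: betaQ_def Q_def inner_commute)
    moreover have "blkG Q = t *\<^sub>R A" by (simp add: Q_def)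
    ultimately have "det Q = t ^ CARD('n) * det A * (1 - t)"
      using det_blkG_betaQ(1)[OF pQ] by (simp add: det_scaleR)
    then have "ln (det Q) = n * ln t + ln (det A) + ln (1 - t)"
      using t posdef_det_pos[OF A] by (simp add: ln_mult_pos ln_realpow n_def)
    moreover have "1 - t = 1 / (n + 1)" using n by (simp add: t_def field_simps)
    ultimately show ?thesis
      using n unfolding \<open>1 - t = 1 / (n + 1)\<close> by (simp add: t_def ln_div ln_kappa_def algebra_simps)
  qed
  ultimately show thesis using that by (simp add: n_def)
qed

text \<open>Completing the square in the lifted constraint yields the center
  \<open>- (matrix_inv G *v z)\<close> and the shape \<open>G / \<beta>\<close>. Since
  \<open>det Q = det G * (1 - \<beta>)\<close>, the bound on
  \<open>(1 - \<beta>) * \<beta> ^ n\<close> compares the determinants.\<close>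

lemma ellipsoid_of_lifted:
  fixes a :: "'m::finite \<Rightarrow> real^'n"
  assumes P: "bounded (polyP a)" "x \<in> interior (polyP a)" and Q: "lifted_feasible a x Q"
  obtains c A where "posdef A" "\<And>i. tilde a x i \<in> ellipsoid c A"
    "ln (det Q) - ln_kappa (real CARD('n)) \<le> ln (det A)"
proof -
  define n where "n = real CARD('n)"
  have n: "1 \<le> n" by (simp add: n_def Suc_leI)
  define G z \<beta> where "G = blkG Q" and "z = blkz Q" and "\<beta> = betaQ Q"
  have pQ: "posdef Q" using Q by (simp add: lifted_feasible_def)
  have G: "posdef G" using posdef_blkG[OF pQ] by (simp add: G_def)
  have dG: "0 < det G" using posdef_det_pos[OF G] .
  have \<beta>: "0 < \<beta>" "\<beta> < 1" using lifted_feasible_blks_betaQ[OF P Q] det_blkG_betaQ[OF pQ] by (auto simp: \<beta>_def)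
  define c where "c = - (matrix_inv G *v z)"
  have Gc: "G *v c = - z"
    using matrix_vector_mult_scaleR[of G "-1" "matrix_inv G *v z"] matrix_inv_mult_vec(1)[of G z] dG by (simp add: c_def)
  have pA: "posdef ((1 / \<beta>) *\<^sub>R G)" using \<beta> G by (intro posdef_scaleR) auto
  have "tilde a x i \<in> ellipsoid c ((1 / \<beta>) *\<^sub>R G)" for i
  proof -
    let ?y = "tilde a x i"
    have "(?y - c) \<bullet> (G *v (?y - c)) = ?y \<bullet> (G *v ?y) + 2 * (z \<bullet> ?y) - c \<bullet> z"
      using symmetric_inner_commute[OF posdefD(1)[OF G], of c ?y]
      by (simp add: matrix_vector_mult_diff_distrib Gc inner_diff_left inner_diff_right inner_add_right inner_commute)
    moreover have "- (c \<bullet> z) = \<beta> - 1 + blks Q"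
      by (simp add: c_def \<beta>_def betaQ_def G_def z_def inner_commute)
    ultimately have "(?y - c) \<bullet> (G *v (?y - c)) \<le> \<beta>"
      using tilde_form[OF Q, of i] by (simp add: G_def z_def)
    then show ?thesis
      using \<beta> by (simp add: ellipsoid_def scaleR_matrix_mult_vec pos_divide_le_eq)
  qed
  moreover have "ln (det Q) - ln_kappa n \<le> ln (det ((1 / \<beta>) *\<^sub>R G))"
  proof -
    have "ln (det Q) = ln (det G) + ln (1 - \<beta>)"
      using det_blkG_betaQ(1)[OF pQ] dG \<beta> by (simp add: G_def \<beta>_def ln_mult_pos)
    moreover have "ln (det ((1 / \<beta>) *\<^sub>R G)) = - n * ln \<beta> + ln (det G)"
    proof -
      have "ln (det ((1 / \<beta>) *\<^sub>R G)) = ln ((1 / \<beta>) ^ CARD('n)) + ln (det G)"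
        unfolding det_scaleR using dG \<beta> by (intro ln_mult_pos) auto
      also have "ln ((1 / \<beta>) ^ CARD('n)) = n * ln (1 / \<beta>)"
        unfolding n_def by (rule ln_realpow)
      finally show ?thesis using \<beta> by (simp add: ln_div)
    qed
    ultimately show ?thesis
      using ln_kappa_ge[OF n \<beta>] by simp
  qed
  ultimately show thesis by (intro that[OF pA]) (simp_all add: n_def)
qed

text \<open>The passages between ellipsoids and lifted matrices shift \<open>ln det\<close> by the
  same \<open>ln_kappa\<close> in opposite directions, so the optimal values correspond. The
  ellipsoid read off from \<open>Qopt\<close> is therefore minimal, and the chosen
  \<open>MinCE\<close> shares its volume.\<close>

lemma vfun_eq:
  fixes a :: "'m::finite \<Rightarrow> real^'n"
  assumes P: "bounded (polyP a)" "x \<in> interior (polyP a)"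
  shows "vfun a x = (ln_kappa (real CARD('n)) - ln (det (Qopt a x))) / 2"
    and "posdef A \<Longrightarrow> (\<And>i. tilde a x i \<in> ellipsoid c A) \<Longrightarrow> vfun a x \<le> - ln (det A) / 2"
proof -
  let ?k = "ln_kappa (real CARD('n))"
  let ?K = "polar_set ((\<lambda>p. p - x) ` polyP a)"
  note opt = Qopt_optimal[OF P]
  have upper: "ln (det A) + ?k \<le> ln (det (Qopt a x))" if A: "posdef A" "\<And>i. tilde a x i \<in> ellipsoid c A" for A c
  proof -
    obtain Q where Q: "lifted_feasible a x Q" "ln (det Q) = ln (det A) + ?k"
      using lift_ellipsoid[OF A] by blast
    then have "0 < det Q" by (auto simp: lifted_feasible_def intro: posdef_det_pos)
    then have "ln (det Q) \<le> ln (det (Qopt a x))" using opt(2)[OF Q(1)] by simp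
    then show ?thesis using Q by simp
  qed
  obtain c A where A: "posdef A" "\<And>i. tilde a x i \<in> ellipsoid c A" "ln (det (Qopt a x)) - ?k \<le> ln (det A)"
    by (rule ellipsoid_of_lifted[OF P opt(1)]) (rule that)
  have A': "ln (det A) = ln (det (Qopt a x)) - ?k"
    using A(3) upper[OF A(1,2)] by simp
  have contains: "?K \<subseteq> ellipsoid c B \<longleftrightarrow> (\<forall>i. tilde a x i \<in> ellipsoid c B)" if "posdef B" for c B
    by (intro polar_set_subset_iff[OF P] closed_ellipsoid convex_ellipsoid that)
  have E1: "is_ellipsoid (ellipsoid c A) \<and> ?K \<subseteq> ellipsoid c A"
    using A contains[OF A(1)] by (auto simp: is_ellipsoid_def)
  have E2: "ellipsoid_vol (ellipsoid c A) \<le> ellipsoid_vol S" if S: "is_ellipsoid S \<and> ?K \<subseteq> S" for S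
  proof -
    obtain c' B where B: "posdef B" "S = ellipsoid c' B" using S by (auto simp: is_ellipsoid_def)
    then have "\<And>i. tilde a x i \<in> ellipsoid c' B" using S contains[OF B(1)] by auto
    from upper[OF B(1) this] have "ln (det B) \<le> ln (det A)" using A' by simp
    then show ?thesis
      using A(1) B by (simp add: ellipsoid_vol_le_iff posdef_det_pos)
  qed
  have M: "is_ellipsoid (MinCE ?K) \<and> ?K \<subseteq> MinCE ?K"
    unfolding MinCE_def using E1 E2 by (rule arg_min_is_arg_min)
  have "ellipsoid_vol (MinCE ?K) \<le> ellipsoid_vol (ellipsoid c A)"
    unfolding MinCE_def using E1 E2 E1 by (rule arg_min_is_arg_min(2))
  then have "ellipsoid_vol (MinCE ?K) = ellipsoid_vol (ellipsoid c A)"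
    using E2[OF M] by simp
  then show v: "vfun a x = (?k - ln (det (Qopt a x))) / 2"
    using A(1) A' by (simp add: vfun_def ln_ellipsoid_vol)
  show "vfun a x \<le> - ln (det A) / 2" if "posdef A" "\<And>i. tilde a x i \<in> ellipsoid c A" for A c
    using upper[OF that] by (simp add: v)
qed

text \<open>The inverse of \<open>shapeE Q\<close> by the Sherman-Morrison formula; it enters the
  support function of the inner ellipsoid.\<close>

definition shape_dual :: "real^('n::finite option)^('n option) \<Rightarrow> real^'n^'n" where
  "shape_dual Q = (1 / (1 - blks Q)) *\<^sub>R (blkG Q + (1 / (1 - blks Q)) *\<^sub>R outer_prod (blkz Q))"

lemma shape_dual_form:
  "u \<bullet> (shape_dual Q *v w) = (u \<bullet> (blkG Q *v w) + (blkz Q \<bullet> u) * (blkz Q \<bullet> w) / (1 - blks Q)) / (1 - blks Q)"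
  by (simp add: shape_dual_def scaleR_matrix_mult_vec matrix_vector_mult_add_rdistrib outer_prod_mult_vec
      inner_add_right inner_commute mult.commute)

lemma posdef_shape_dual:
  assumes Q: "posdef Q" and s: "blks Q < 1"
  shows "posdef (shape_dual Q)"
  unfolding posdef_def
proof (intro conjI allI impI)
  note G = posdef_blkG[OF Q]
  show "transpose (shape_dual Q) = shape_dual Q"
    by (simp add: shape_dual_def transpose_scalar transpose_add posdefD(1)[OF G])
  fix v :: "real^'a" assume "v \<noteq> 0"
  then have "0 < v \<bullet> (blkG Q *v v)" by (simp add: posdefD[OF G])
  moreover have "0 \<le> (blkz Q \<bullet> v) * (blkz Q \<bullet> v) / (1 - blks Q)" using s by simp
  ultimately have "0 < v \<bullet> (blkG Q *v v) + (blkz Q \<bullet> v) * (blkz Q \<bullet> v) / (1 - blks Q)"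
    by linarith
  then show "0 < v \<bullet> (shape_dual Q *v v)"
    using s by (simp add: shape_dual_form)
qed

lemma shape_dual_shapeE:
  assumes Q: "posdef Q" and s: "blks Q < 1" and \<beta>: "0 < betaQ Q"
  shows "shape_dual Q ** shapeE Q = mat 1"
proof -
  define G z s \<beta> where "G = blkG Q" and "z = blkz Q" and "s = blks Q" and "\<beta> = betaQ Q"
  have s: "0 < 1 - s" and \<beta>: "0 < \<beta>" using assms by (auto simp: s_def \<beta>_def)
  have G: "posdef G" using posdef_blkG[OF Q] by (simp add: G_def)
  then have dG: "det G \<noteq> 0" using posdef_det_pos by force
  have Gi: "transpose (matrix_inv G) = matrix_inv G"
    by (intro transpose_matrix_inv dG posdefD G)
  define h where "h = matrix_inv G *v z"
  have \<beta>_eq: "z \<bullet> h = \<beta> - (1 - s)" by (simp add: \<beta>_def betaQ_def h_def z_def G_def s_def)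
  have "shape_dual Q *v (shapeE Q *v x) = x" for x
  proof -
    define g where "g = matrix_inv G *v x"
    have zg: "z \<bullet> g = h \<bullet> x"
      using symmetric_inner_commute[OF Gi, of z x] by (simp add: g_def h_def inner_commute)
    have E: "shapeE Q *v x = (1 - s) *\<^sub>R (g - ((z \<bullet> g) / \<beta>) *\<^sub>R h)"
      by (simp add: shapeE_def G_def[symmetric] z_def[symmetric] s_def[symmetric] \<beta>_def[symmetric]
          scaleR_matrix_mult_vec matrix_vector_mult_diff_rdistrib matrix_vector_mul_assoc[symmetric]
          outer_prod_mult_vec matrix_vector_mult_scaleR g_def h_def)
    have "G *v (shapeE Q *v x) = (1 - s) *\<^sub>R (x - ((z \<bullet> g) / \<beta>) *\<^sub>R z)"
      unfolding E matrix_vector_mult_scaleR matrix_vector_mult_diff_distrib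
      by (simp add: g_def h_def matrix_inv_mult_vec[OF dG])
    moreover have "z \<bullet> (shapeE Q *v x) = (1 - s) * ((1 - s) * ((z \<bullet> g) / \<beta>))"
    proof -
      have "z \<bullet> (shapeE Q *v x) = (1 - s) * ((z \<bullet> g) - (z \<bullet> g) / \<beta> * (\<beta> - (1 - s)))"
        unfolding E by (simp add: inner_diff_right \<beta>_eq[symmetric])
      also have "\<dots> = (1 - s) * ((1 - s) * ((z \<bullet> g) / \<beta>))"
        using \<beta> by (simp add: field_simps)
      finally show ?thesis .
    qed
    ultimately have "shape_dual Q *v (shapeE Q *v x) =
       (1 / (1 - s)) *\<^sub>R ((1 - s) *\<^sub>R (x - ((z \<bullet> g) / \<beta>) *\<^sub>R z) + (1 / (1 - s)) *\<^sub>R (((1 - s) * ((1 - s) * ((z \<bullet> g) / \<beta>))) *\<^sub>R z))"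
      by (simp add: shape_dual_def G_def[symmetric] z_def[symmetric] s_def[symmetric] scaleR_matrix_mult_vec
          matrix_vector_mult_add_rdistrib outer_prod_mult_vec)
    also have "\<dots> = x" using s by (simp add: scaleR_add_right scaleR_diff_right)
    finally show ?thesis .
  qed
  then show ?thesis by (simp add: matrix_eq flip: matrix_vector_mul_assoc)
qed

lemma shapeE_inverse:
  assumes "posdef Q" "blks Q < 1" "0 < betaQ Q"
  shows "posdef (shapeE Q)" "matrix_inv (shapeE Q) = shape_dual Q"
proof -
  have *: "shape_dual Q ** shapeE Q = mat 1" by (rule shape_dual_shapeE[OF assms])
  then have "matrix_inv (shape_dual Q) = shapeE Q" by (rule matrix_inv_unique)
  then show "posdef (shapeE Q)" using posdef_matrix_inv[OF posdef_shape_dual[OF assms(1,2)]] by simp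
  show "matrix_inv (shapeE Q) = shape_dual Q"
    using * by (intro matrix_inv_unique) (simp add: matrix_left_right_inverse)
qed

text \<open>The determinant of \<open>shape_dual Q\<close> is
  \<open>det G * \<beta> / (1 - s) ^ (n + 1)\<close>. Replacing \<open>1 - s\<close> by the larger
  \<open>\<beta>\<close> leaves \<open>det G / \<beta> ^ n\<close>, and the bound on
  \<open>(1 - \<beta>) * \<beta> ^ n\<close> compares this with
  \<open>det Q = det G * (1 - \<beta>)\<close>.\<close>

lemma shape_ellipsoid_vol:
  fixes Q :: "real^('n::finite option)^('n option)"
  assumes Q: "posdef Q" and s: "blks Q < 1" and \<beta>: "1 - blks Q \<le> betaQ Q"
  shows "(ln (det Q) - ln_kappa (real CARD('n))) / 2 \<le> ln (ellipsoid_vol (ellipsoid c (shapeE Q)))"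
proof -
  define n where "n = real CARD('n)"
  have n: "1 \<le> n" by (simp add: n_def Suc_leI)
  define G s \<beta> where "G = blkG Q" and "s = blks Q" and "\<beta> = betaQ Q"
  have s: "0 < 1 - s" and \<beta>: "0 < \<beta>" "1 - s \<le> \<beta>" "\<beta> < 1"
    using assms det_blkG_betaQ(2)[OF Q] by (auto simp: s_def \<beta>_def)
  have G: "posdef G" using posdef_blkG[OF Q] by (simp add: G_def)
  then have dG: "0 < det G" by (rule posdef_det_pos)
  have "det (shape_dual Q) = (1 / (1 - s)) ^ CARD('n) * (det G * (\<beta> / (1 - s)))"
  proof -
    have "det (G + (1 / (1 - s)) *\<^sub>R outer_prod (blkz Q)) = det G * (1 + (blkz Q \<bullet> (matrix_inv G *v blkz Q)) / (1 - s))"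
      using dG s posdefD(1)[OF G] by (intro det_rank_one_update) auto
    also have "1 + (blkz Q \<bullet> (matrix_inv G *v blkz Q)) / (1 - s) = \<beta> / (1 - s)"
      using s by (simp add: \<beta>_def betaQ_def G_def s_def field_simps)
    finally show ?thesis by (simp add: shape_dual_def det_scaleR G_def s_def)
  qed
  then have "ln (det (shape_dual Q)) = ln ((1 / (1 - s)) ^ CARD('n)) + (ln (det G) + ln (\<beta> / (1 - s)))"
    using s \<beta> dG by (simp add: ln_mult_pos del: times_divide_eq_right)
  also have "ln ((1 / (1 - s)) ^ CARD('n)) = - n * ln (1 - s)"
  proof -
    have "ln ((1 / (1 - s)) ^ CARD('n)) = n * ln (1 / (1 - s))"
      unfolding n_def by (rule ln_realpow)
    then show ?thesis using s by (simp add: ln_div)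
  qed
  also have "ln (\<beta> / (1 - s)) = ln \<beta> - ln (1 - s)" using s \<beta> by (simp add: ln_div)
  finally have ln_dual: "ln (det (shape_dual Q)) = ln (det G) + ln \<beta> - (n + 1) * ln (1 - s)"
    by (simp add: algebra_simps)
  have "det (shape_dual Q) * det (shapeE Q) = 1"
    using shape_dual_shapeE[OF Q] s \<beta> by (metis \<beta>_def s_def det_I det_mul diff_gt_0_iff_gt)
  moreover have "0 < det (shape_dual Q)" "0 < det (shapeE Q)"
    using posdef_det_pos[OF posdef_shape_dual[OF Q]] posdef_det_pos[OF shapeE_inverse(1)[OF Q]] s \<beta>
    by (auto simp: s_def \<beta>_def)
  ultimately have "ln (det (shape_dual Q)) = - ln (det (shapeE Q))"
    by (metis add.inverse_unique add.commute ln_mult_pos ln_one)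
  then have "ln (ellipsoid_vol (ellipsoid c (shapeE Q))) = (ln (det G) + ln \<beta> - (n + 1) * ln (1 - s)) / 2"
    using shapeE_inverse(1)[OF Q] s \<beta> ln_dual by (simp add: ln_ellipsoid_vol s_def \<beta>_def)
  moreover have "(n + 1) * ln (1 - s) \<le> (n + 1) * ln \<beta>"
    using s \<beta> n by (intro mult_left_mono) auto
  moreover have "ln (det Q) = ln (det G) + ln (1 - \<beta>)"
    using det_blkG_betaQ(1)[OF Q] dG \<beta> by (simp add: G_def \<beta>_def ln_mult_pos)
  moreover have "ln (1 - \<beta>) + n * ln \<beta> \<le> ln_kappa n"
    using n \<beta> by (intro ln_kappa_ge) auto
  ultimately show ?thesis
    by (simp add: n_def[symmetric] algebra_simps)
qed

text \<open>Each constraint is checked with the support function: feasibility bounds the form of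
  \<open>shape_dual Q\<close> at \<open>tilde a x i\<close> by \<open>r\<^sup>2\<close>, and
  \<open>\<tau> * r\<close> is the slack of the constraint at the center.\<close>

lemma shape_ellipsoid_subset:
  fixes a :: "'m::finite \<Rightarrow> real^'n"
  assumes P: "bounded (polyP a)" "x \<in> interior (polyP a)" and Q: "lifted_feasible a x Q"
  shows "posdef (shapeE Q)" "ellipsoid (centerK x Q) (shapeE Q) \<subseteq> polyP a"
proof -
  define G z s where "G = blkG Q" and "z = blkz Q" and "s = blks Q"
  have pQ: "posdef Q" using Q by (simp add: lifted_feasible_def)
  have s: "0 < 1 - s" using lifted_feasible_blks_betaQ[OF P Q] by (simp add: s_def)
  have inv: "matrix_inv (shapeE Q) = shape_dual Q" and pE: "posdef (shapeE Q)"
    using lifted_feasible_blks_betaQ[OF P Q] by (auto intro!: shapeE_inverse pQ)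
  show "posdef (shapeE Q)" by (rule pE)
  have "ellipsoid (centerK x Q) (shapeE Q) \<subseteq> {y. a i \<bullet> y \<le> 1}" for i
  proof -
    let ?y = "tilde a x i"
    define \<tau> where "\<tau> = 1 - a i \<bullet> x"
    have \<tau>: "0 < \<tau>" using P(2) by (simp add: interior_polyP \<tau>_def)
    then have ai: "a i = \<tau> *\<^sub>R ?y" by (simp add: tilde_def \<tau>_def)
    define r where "r = 1 - (z \<bullet> ?y) / (1 - s)"
    have tf: "?y \<bullet> (G *v ?y) + 2 * (z \<bullet> ?y) + s \<le> 1"
      using tilde_form[OF Q, of i] by (simp add: G_def z_def s_def)
    \<comment> \<open>Cauchy-Schwarz for \<open>Q\<close> between \<open>hvec a x i\<close> and the
      last unit vector: both have form value at most 1, so the mixed value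
      \<open>z \<bullet> ?y + s\<close> is at most 1.\<close>
    have "0 \<le> r"
    proof -
      have s0: "0 \<le> s" using posdefD(3)[OF pQ, of "block_vec 0 1"] by (simp add: block_form[OF posdefD(1)[OF pQ]] s_def)
      have hQe: "hvec a x i \<bullet> (Q *v block_vec 0 1) = z \<bullet> ?y + s"
        by (subst symmetric_block_mat[OF posdefD(1)[OF pQ]]) (simp add: hvec_block z_def s_def inner_commute)
      have "(hvec a x i \<bullet> (Q *v block_vec 0 1))\<^sup>2 \<le> (hvec a x i \<bullet> (Q *v hvec a x i)) * (block_vec 0 1 \<bullet> (Q *v block_vec 0 1))"
        by (rule posdef_Cauchy_Schwarz[OF pQ])
      also have "\<dots> \<le> 1"
        using Q s s0 by (intro mult_le_one) (auto simp: lifted_feasible_def block_form[OF posdefD(1)[OF pQ]] s_def)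
      finally have "z \<bullet> ?y + s \<le> 1"
        unfolding hQe using power2_le_imp_le[of "z \<bullet> ?y + s" 1] by simp
      then show ?thesis using s by (simp add: r_def pos_divide_le_eq)
    qed
    have "?y \<bullet> (shape_dual Q *v ?y) = (?y \<bullet> (G *v ?y) + (z \<bullet> ?y)\<^sup>2 / (1 - s)) / (1 - s)"
      by (simp add: shape_dual_form G_def z_def s_def power2_eq_square)
    also have "\<dots> \<le> ((1 - s) - 2 * (z \<bullet> ?y) + (z \<bullet> ?y)\<^sup>2 / (1 - s)) / (1 - s)"
      using tf s by (intro divide_right_mono add_right_mono) auto
    also have "\<dots> = r\<^sup>2"
      using s by (simp add: r_def power2_eq_square field_simps)
    finally have "sqrt (?y \<bullet> (shape_dual Q *v ?y)) \<le> r"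
      using \<open>0 \<le> r\<close> by (simp add: real_le_lsqrt)
    then have "\<tau> * sqrt (?y \<bullet> (shape_dual Q *v ?y)) \<le> \<tau> * r" using \<tau> by simp
    moreover have "sqrt (a i \<bullet> (shape_dual Q *v a i)) = \<tau> * sqrt (?y \<bullet> (shape_dual Q *v ?y))"
      using \<tau> by (subst (1 2) ai) (simp add: matrix_vector_mult_scaleR real_sqrt_mult mult.assoc[symmetric])
    moreover have "a i \<bullet> centerK x Q = 1 - \<tau> + \<tau> * ((z \<bullet> ?y) / (1 - s))"
    proof -
      have "a i \<bullet> z = \<tau> * (z \<bullet> ?y)" by (subst ai) (simp add: inner_commute)
      then show ?thesis by (simp add: centerK_def inner_add_right \<tau>_def z_def s_def)
    qed
    ultimately have "a i \<bullet> centerK x Q + sqrt (a i \<bullet> (matrix_inv (shapeE Q) *v a i)) \<le> 1"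
      by (simp add: inv r_def algebra_simps)
    then show ?thesis using ellipsoid_subset_halfspace[OF pE] by blast
  qed
  then show "ellipsoid (centerK x Q) (shapeE Q) \<subseteq> polyP a" by (auto simp: polyP_def)
qed

text \<open>The support function leaves positive slack at the center for every nonzero normal.
  Dividing by it turns inscription into polarity: the ellipsoid about 0 with the inverse shape
  contains every \<open>tilde a c i\<close>.\<close>

lemma ellipsoid_center_interior:
  assumes Q: "posdef Q" and sub: "ellipsoid c Q \<subseteq> polyP a"
  shows "c \<in> interior (polyP a)" "tilde a c i \<bullet> (matrix_inv Q *v tilde a c i) \<le> 1"
proof -
  have le: "a i \<bullet> c + sqrt (a i \<bullet> (matrix_inv Q *v a i)) \<le> 1" for i
    using sub ellipsoid_subset_halfspace[OF Q, of c "a i" 1] by (auto simp: polyP_def)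
  have lt: "a i \<bullet> c < 1" for i
  proof (cases "a i = 0")
    case False
    then have "0 < sqrt (a i \<bullet> (matrix_inv Q *v a i))"
      using posdefD(2)[OF posdef_matrix_inv[OF Q]] by simp
    then show ?thesis using le[of i] by linarith
  qed simp
  then show "c \<in> interior (polyP a)" by (simp add: interior_polyP)
  define \<tau> where "\<tau> = 1 - a i \<bullet> c"
  have \<tau>: "0 < \<tau>" using lt[of i] by (simp add: \<tau>_def)
  have "sqrt (a i \<bullet> (matrix_inv Q *v a i)) \<le> \<tau>" using le[of i] by (simp add: \<tau>_def)
  then have "a i \<bullet> (matrix_inv Q *v a i) \<le> \<tau>\<^sup>2"
    using \<tau> sqrt_le_D by blast
  then have "(a i \<bullet> (matrix_inv Q *v a i)) / (\<tau> * \<tau>) \<le> 1"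
    using \<tau> by (simp add: power2_eq_square pos_divide_le_eq)
  then show "tilde a c i \<bullet> (matrix_inv Q *v tilde a c i) \<le> 1"
    by (simp add: tilde_def \<tau>_def matrix_vector_mult_scaleR)
qed

section \<open>Maximal inscribed ellipsoids\<close>

text \<open>The maximization runs over pairs of a center and an inverse shape matrix, where
  inscription is a closed condition that also admits degenerate ellipsoids. The constraints bound
  the trace, and a small ball about 0 shows that the maximizer is nondegenerate.\<close>

lemma MaxIE_ellipsoid:
  fixes a :: "'m::finite \<Rightarrow> real^'n"
  assumes P: "bounded (polyP a)"
  obtains c Q where "posdef Q" "MaxIE (polyP a) = ellipsoid c Q" "ellipsoid c Q \<subseteq> polyP a"
    "\<And>c' Q'. posdef Q' \<Longrightarrow> ellipsoid c' Q' \<subseteq> polyP a \<Longrightarrow> ellipsoid_vol (ellipsoid c' Q') \<le> ellipsoid_vol (ellipsoid c Q)"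
proof -
  \<comment> \<open>The two inequalities for \<open>i\<close> encode the support function condition
    \<open>sqrt (a i \<bullet> (B *v a i)) \<le> 1 - a i \<bullet> c\<close>.\<close>
  define K where "K = {p :: (real^'n) \<times> (real^'n^'n). transpose (snd p) = snd p \<and> (\<forall>v. 0 \<le> v \<bullet> (snd p *v v)) \<and>
    (\<forall>i. a i \<bullet> fst p \<le> 1 \<and> a i \<bullet> (snd p *v a i) \<le> (1 - a i \<bullet> fst p)\<^sup>2)}"
  have inK: "(c, matrix_inv Q) \<in> K" if "posdef Q" "ellipsoid c Q \<subseteq> polyP a" for c Q
  proof -
    note pB = posdef_matrix_inv[OF that(1)]
    have "a i \<bullet> c + sqrt (a i \<bullet> (matrix_inv Q *v a i)) \<le> 1" for i
      using that(2) ellipsoid_subset_halfspace[OF that(1), of c "a i" 1] by (auto simp: polyP_def)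
    then have *: "sqrt (a i \<bullet> (matrix_inv Q *v a i)) \<le> 1 - a i \<bullet> c" for i
      by (simp add: algebra_simps)
    have "0 \<le> sqrt (a i \<bullet> (matrix_inv Q *v a i))" for i
      using posdefD(3)[OF pB] by simp
    then have "a i \<bullet> c \<le> 1" for i using *[of i] by (smt (verit))
    then show ?thesis
      using posdefD[OF pB] sqrt_le_D[OF *] by (auto simp: K_def)
  qed
  have ofK: "ellipsoid c (matrix_inv B) \<subseteq> polyP a" if "(c, B) \<in> K" "posdef B" for c B
  proof -
    have inv: "matrix_inv (matrix_inv B) = B"
      using that(2) posdef_det_pos[of B] by (intro matrix_inv_unique matrix_inv_inverse) auto
    have "a i \<bullet> c + sqrt (a i \<bullet> (B *v a i)) \<le> 1" for i
    proof -
      have "a i \<bullet> c \<le> 1" "a i \<bullet> (B *v a i) \<le> (1 - a i \<bullet> c)\<^sup>2"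
        using that(1) by (auto simp: K_def)
      then show ?thesis using real_le_lsqrt[of "1 - a i \<bullet> c" "a i \<bullet> (B *v a i)"] by simp
    qed
    then have "ellipsoid c (matrix_inv B) \<subseteq> {y. a i \<bullet> y \<le> 1}" for i
      using ellipsoid_subset_halfspace[OF posdef_matrix_inv[OF that(2)]] inv by simp
    then show ?thesis by (auto simp: polyP_def)
  qed
  have "posdef (\<Sum>i\<in>UNIV. 1 *\<^sub>R outer_prod (a i))"
    unfolding posdef_def
  proof (intro conjI allI impI)
    show "transpose (\<Sum>i\<in>UNIV. 1 *\<^sub>R outer_prod (a i)) = (\<Sum>i\<in>UNIV. 1 *\<^sub>R outer_prod (a i))"
      by (simp add: transpose_sum)
    fix v :: "real^'n" assume "v \<noteq> 0"
    then obtain i where i: "a i \<bullet> v \<noteq> 0"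
      using bounded_polyP_recession[OF P, of v] by force
    have "0 < (\<Sum>i\<in>UNIV. 1 * (a i \<bullet> v) * (a i \<bullet> v))"
      by (rule sum_pos2[of _ i]) (use i in \<open>auto simp: zero_less_mult_iff\<close>)
    then show "0 < v \<bullet> ((\<Sum>i\<in>UNIV. 1 *\<^sub>R outer_prod (a i)) *v v)"
      unfolding sum_outer_prod_form .
  qed
  from posdef_lower_bound[OF this] obtain \<alpha> where \<alpha>: "0 < \<alpha>"
    "\<And>v. \<alpha> * (v \<bullet> v) \<le> v \<bullet> ((\<Sum>i\<in>UNIV. 1 *\<^sub>R outer_prod (a i)) *v v)" by blast
  obtain R where R: "\<And>x. x \<in> polyP a \<Longrightarrow> norm x \<le> R"
    using P by (auto simp: bounded_iff)
  have "0 \<in> polyP a" by (simp add: polyP_def)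
  then have R0: "0 \<le> R" using R[of 0] by simp
  have "norm p \<le> R + (\<Sum>i\<in>UNIV. (1 + norm (a i) * R)\<^sup>2) / \<alpha>" if "p \<in> K" for p
  proof -
    obtain c B where p: "p = (c, B)" by force
    have "c \<in> polyP a" using that by (auto simp: K_def p polyP_def)
    then have c: "norm c \<le> R" by (rule R)
    have B: "transpose B = B" "\<And>v. 0 \<le> v \<bullet> (B *v v)" using that by (auto simp: K_def p)
    have "\<alpha> * trace B \<le> (\<Sum>i\<in>UNIV. 1 * (a i \<bullet> (B *v a i)))"
      by (intro psd_trace_bound \<alpha> B)
    also have "\<dots> \<le> (\<Sum>i\<in>UNIV. (1 + norm (a i) * R)\<^sup>2)"
    proof (intro sum_mono)
      fix i
      have "\<bar>a i \<bullet> c\<bar> \<le> norm (a i) * R"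
        using Cauchy_Schwarz_ineq2[of "a i" c] c by (meson mult_left_mono norm_ge_zero order_trans)
      then have "(1 - a i \<bullet> c)\<^sup>2 \<le> (1 + norm (a i) * R)\<^sup>2"
        using R0 by (intro abs_le_square_iff[THEN iffD1]) (simp add: abs_le_iff)
      then show "1 * (a i \<bullet> (B *v a i)) \<le> (1 + norm (a i) * R)\<^sup>2"
        using that by (auto simp: K_def p intro: order_trans)
    qed
    finally have "trace B \<le> (\<Sum>i\<in>UNIV. (1 + norm (a i) * R)\<^sup>2) / \<alpha>"
      using \<alpha>(1) by (simp add: pos_le_divide_eq mult.commute)
    then have "norm B \<le> (\<Sum>i\<in>UNIV. (1 + norm (a i) * R)\<^sup>2) / \<alpha>"
      using psd_norm_le_trace[OF B] by simp
    then show ?thesis using c norm_Pair_le[of c B] by (simp add: p)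
  qed
  then have "bounded K" unfolding bounded_iff by blast
  moreover have "closed K"
  proof -
    have "K = {p. transpose (snd p) = snd p} \<inter> (\<Inter>v. {p. 0 \<le> v \<bullet> (snd p *v v)}) \<inter>
      (\<Inter>i. {p. a i \<bullet> fst p \<le> 1} \<inter> {p. a i \<bullet> (snd p *v a i) \<le> (1 - a i \<bullet> fst p)\<^sup>2})"
      by (auto simp: K_def)
    moreover have "continuous_on UNIV (\<lambda>p :: (real^'n) \<times> (real^'n^'n). transpose (snd p))"
      unfolding transpose_def by (intro continuous_intros)
    ultimately show ?thesis
      by (auto intro!: closed_Int closed_INT closed_Collect_le closed_Collect_eq continuous_intros)
  qed
  ultimately have "compact K" by (simp add: compact_eq_bounded_closed)
  obtain \<epsilon> where \<epsilon>: "0 < \<epsilon>" "(0, \<epsilon> *\<^sub>R mat 1) \<in> K"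
  proof -
    define s where "s = (\<Sum>i\<in>UNIV. a i \<bullet> a i)"
    have s: "0 \<le> s" "a i \<bullet> a i \<le> s" for i
      by (auto simp: s_def intro: sum_nonneg member_le_sum)
    have "a i \<bullet> a i / (1 + s) \<le> 1" for i using s(1) s(2)[of i] by (simp add: pos_divide_le_eq)
    then have "(0, (1 / (1 + s)) *\<^sub>R mat 1) \<in> K"
      using s(1) by (simp add: K_def scaleR_matrix_mult_vec transpose_scalar)
    then show thesis using that[of "1 / (1 + s)"] s(1) by simp
  qed
  have "\<exists>p\<in>K. \<forall>p'\<in>K. det (snd p') \<le> det (snd p)"
    using \<open>compact K\<close> \<epsilon> by (intro continuous_attains_sup) (auto intro!: continuous_intros)
  then obtain c B where B: "(c, B) \<in> K" "\<And>c' B'. (c', B') \<in> K \<Longrightarrow> det B' \<le> det B"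
    by (metis prod.collapse snd_conv)
  have "0 < det (\<epsilon> *\<^sub>R mat 1 :: real^'n^'n)"
    using \<epsilon> by (intro posdef_det_pos posdef_scaleR posdef_mat_1)
  also have "\<dots> \<le> det B" by (rule B(2)[OF \<epsilon>(2)])
  finally have pB: "posdef B"
    using B(1) by (intro posdef_if_psd_det_nonzero) (auto simp: K_def)
  define E where "E = ellipsoid c (matrix_inv B)"
  have E1: "is_ellipsoid E \<and> E \<subseteq> polyP a"
    using ofK[OF B(1) pB] posdef_matrix_inv[OF pB] by (auto simp: is_ellipsoid_def E_def)
  have E2: "ellipsoid_vol S \<le> ellipsoid_vol E" if S: "is_ellipsoid S \<and> S \<subseteq> polyP a" for S
  proof -
    obtain c' Q' where Q': "posdef Q'" "S = ellipsoid c' Q'" using S by (auto simp: is_ellipsoid_def)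
    have "det (matrix_inv Q') \<le> det B"
      using inK[OF Q'(1)] S Q'(2) by (intro B) auto
    then have "1 / det Q' \<le> 1 / det (matrix_inv B)"
      using posdef_det_pos[OF Q'(1)] posdef_det_pos[OF pB] by (simp add: det_matrix_inv)
    then have "det (matrix_inv B) \<le> det Q'"
      using posdef_det_pos[OF Q'(1)] posdef_det_pos[OF posdef_matrix_inv[OF pB]]
      by (simp add: frac_le_eq divide_simps)
    then show ?thesis
      using Q' posdef_matrix_inv[OF pB] by (simp add: E_def ellipsoid_vol_le_iff)
  qed
  have M: "is_ellipsoid (MaxIE (polyP a)) \<and> MaxIE (polyP a) \<subseteq> polyP a"
    unfolding MaxIE_def using E1 E2 by (rule arg_max_is_arg_max)
  then obtain c' Q' where Q': "posdef Q'" "MaxIE (polyP a) = ellipsoid c' Q'" by (auto simp: is_ellipsoid_def)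
  have max: "ellipsoid_vol S \<le> ellipsoid_vol (MaxIE (polyP a))" if "is_ellipsoid S \<and> S \<subseteq> polyP a" for S
    unfolding MaxIE_def using E1 E2 that by (rule arg_max_is_arg_max(2))
  show thesis
  proof (rule that[OF Q'])
    show "ellipsoid c' Q' \<subseteq> polyP a" using M Q' by simp
    show "ellipsoid_vol (ellipsoid c'' Q'') \<le> ellipsoid_vol (ellipsoid c' Q')"
      if "posdef Q''" "ellipsoid c'' Q'' \<subseteq> polyP a" for c'' Q''
      using max[of "ellipsoid c'' Q''"] that Q' by (auto simp: is_ellipsoid_def)
  qed
qed

text \<open>Duality between \<open>v\<close> and inscribed ellipsoids: polarity turns the minimizer defining \<open>v x\<close>
  into an inscribed ellipsoid of volume at least \<open>exp (- v x)\<close>, and the maximal inscribed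
  ellipsoid into a competitor for \<open>v\<close> at its center.\<close>

lemma delta_v_bounds:
  fixes a :: "'m::finite \<Rightarrow> real^'n"
  assumes P: "bounded (polyP a)" "x \<in> interior (polyP a)"
  shows "0 \<le> delta_v a x"
    and "ln (ellipsoid_vol (MaxIE (polyP a))) - delta_v a x
      \<le> ln (ellipsoid_vol (ellipsoid (Kmap a x) (shapeE (Qopt a x))))"
    and "0 < ellipsoid_vol (MaxIE (polyP a))"
proof -
  obtain c Q where M: "posdef Q" "MaxIE (polyP a) = ellipsoid c Q" "ellipsoid c Q \<subseteq> polyP a"
    "\<And>c' Q'. posdef Q' \<Longrightarrow> ellipsoid c' Q' \<subseteq> polyP a \<Longrightarrow> ellipsoid_vol (ellipsoid c' Q') \<le> ellipsoid_vol (ellipsoid c Q)"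
    by (rule MaxIE_ellipsoid[OF P(1)]) (rule that)
  define V where "V = ln (ellipsoid_vol (MaxIE (polyP a)))"
  show "0 < ellipsoid_vol (MaxIE (polyP a))" using M by (simp add: ellipsoid_vol_pos)
  have V: "V = - ln (det Q) / 2" using M by (simp add: V_def ln_ellipsoid_vol)
  have center: "ellipsoid_center (MaxIE (polyP a)) = c" using M by (simp add: ellipsoid_center_eq)
  note c = ellipsoid_center_interior[OF M(1,3)]
  \<comment> \<open>The inverse shape of the maximal inscribed ellipsoid, centered at 0, competes in
    the problem defining \<open>vfun\<close> at \<open>c\<close>.\<close>
  have vc: "vfun a c \<le> - V"
  proof -
    have "vfun a c \<le> - ln (det (matrix_inv Q)) / 2"
      using c(2) by (intro vfun_eq(2)[OF P(1) c(1) posdef_matrix_inv[OF M(1)], of 0]) (simp add: ellipsoid_def)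
    then show ?thesis
      using posdef_det_pos[OF M(1)] by (simp add: V det_matrix_inv ln_div)
  qed
  note opt = Qopt_optimal(1)[OF P] and s = lifted_feasible_blks_betaQ[OF P Qopt_optimal(1)[OF P]]
  have pQ: "posdef (Qopt a x)" using opt by (simp add: lifted_feasible_def)
  let ?E = "ellipsoid (Kmap a x) (shapeE (Qopt a x))"
  have vx: "- vfun a x \<le> ln (ellipsoid_vol ?E)"
    using shape_ellipsoid_vol[OF pQ s(1,3), of "Kmap a x"] by (simp add: vfun_eq(1)[OF P] diff_divide_distrib)
  note E = shape_ellipsoid_subset[OF P opt, folded Kmap_def]
  \<comment> \<open>This closes the chain \<open>- vfun a x \<le> ln (ellipsoid_vol ?E) \<le> V
    \<le> - vfun a c\<close>, from which both claims on \<open>delta_v\<close> follow.\<close>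
  have "ln (ellipsoid_vol ?E) \<le> V"
    unfolding V_def using M(4)[OF E] M(1,2) E(1) by (simp add: ellipsoid_vol_pos)
  then show "0 \<le> delta_v a x"
    using vx vc by (simp add: delta_v_def center)
  show "V - delta_v a x \<le> ln (ellipsoid_vol ?E)"
    using vx vc by (simp add: delta_v_def center)
qed

lemma Kmap_interior:
  fixes a :: "'m::finite \<Rightarrow> real^'n"
  assumes P: "bounded (polyP a)" "x \<in> interior (polyP a)"
  shows "Kmap a x \<in> interior (polyP a)"
  using ellipsoid_center_interior(1)[OF shape_ellipsoid_subset[OF P Qopt_optimal(1)[OF P]]]
  by (simp add: Kmap_def)

section \<open>Differentiability of the polar volume function\<close>

text \<open>\<open>h - g\<close> has a local minimum at \<open>x\<close>, so the two derivatives
  agree; the remainder of \<open>f\<close> then lies between two remainders of lower order than the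
  distance.\<close>

lemma differentiable_squeeze:
  fixes f g h :: "'a::real_normed_vector \<Rightarrow> real"
  assumes g: "g differentiable (at x)" and h: "h differentiable (at x)"
    and bounds: "\<forall>\<^sub>F y in at x. g y \<le> f y" "\<forall>\<^sub>F y in at x. f y \<le> h y"
    and eq: "g x = f x" "h x = f x"
  shows "f differentiable (at x)"
proof -
  obtain g' h' where g': "(g has_derivative g') (at x)" and h': "(h has_derivative h') (at x)"
    using g h by (auto simp: differentiable_def)
  have "(\<lambda>v. h' v - g' v) = (\<lambda>v. 0)"
  proof (rule has_derivative_local_min)
    show "((\<lambda>y. h y - g y) has_derivative (\<lambda>v. h' v - g' v)) (at x)"
      by (intro has_derivative_diff g' h')
    show "\<forall>\<^sub>F y in at x. h x - g x \<le> h y - g y"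
      using bounds by eventually_elim (simp add: eq)
  qed
  then have "h' = g'" by (simp add: fun_eq_iff)
  then have "(f has_derivative g') (at x)"
    unfolding has_derivative_at_within
  proof (intro conjI)
    show "bounded_linear g'" using g' by (rule has_derivative_bounded_linear)
    have G: "((\<lambda>y. (1 / norm (y - x)) *\<^sub>R (g y - (g x + g' (y - x)))) \<longlongrightarrow> 0) (at x)"
      and H: "((\<lambda>y. (1 / norm (y - x)) *\<^sub>R (h y - (h x + g' (y - x)))) \<longlongrightarrow> 0) (at x)"
      using g' h' \<open>h' = g'\<close> by (simp_all add: has_derivative_within)
    show "((\<lambda>y. (f y - f x - g' (y - x)) /\<^sub>R norm (y - x)) \<longlongrightarrow> 0) (at x)"
    proof (rule tendsto_sandwich[OF _ _ G H])
      show "\<forall>\<^sub>F y in at x. (1 / norm (y - x)) *\<^sub>R (g y - (g x + g' (y - x))) \<le> (f y - f x - g' (y - x)) /\<^sub>R norm (y - x)"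
        using bounds(1) by eventually_elim (auto simp: eq divide_inverse intro!: mult_left_mono)
      show "\<forall>\<^sub>F y in at x. (f y - f x - g' (y - x)) /\<^sub>R norm (y - x) \<le> (1 / norm (y - x)) *\<^sub>R (h y - (h x + g' (y - x)))"
        using bounds(2) by eventually_elim (auto simp: eq divide_inverse intro!: mult_left_mono)
    qed
  qed
  then show ?thesis by (auto simp: differentiable_def)
qed

lemma differentiable_prod:
  fixes f :: "'i \<Rightarrow> 'a::real_normed_vector \<Rightarrow> real"
  assumes "\<And>i. i \<in> I \<Longrightarrow> f i differentiable (at x)"
  shows "(\<lambda>y. \<Prod>i\<in>I. f i y) differentiable (at x)"
  using assms by (induction I rule: infinite_finite_induct) auto

lemma differentiable_det:
  fixes A :: "'a::real_normed_vector \<Rightarrow> real^'k^'k"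
  assumes "\<And>i j. (\<lambda>y. A y $ i $ j) differentiable (at x)"
  shows "(\<lambda>y. det (A y)) differentiable (at x)"
  unfolding det_def by (intro differentiable_sum ballI differentiable_mult differentiable_const differentiable_prod assms) simp

lemma differentiable_ln:
  fixes f :: "'a::real_normed_vector \<Rightarrow> real"
  assumes "f differentiable (at x)" "0 < f x"
  shows "(\<lambda>y. ln (f y)) differentiable (at x)"
  using assms unfolding differentiable_def by (blast intro: has_derivative_ln)

text \<open>The Riesz vector of the derivative is a gradient, so the choice in
  \<open>gradient\<close> returns a genuine one.\<close>

lemma differentiable_imp_GDERIV_gradient:
  fixes f :: "'a::euclidean_space \<Rightarrow> real"
  assumes "f differentiable (at x)"
  shows "GDERIV f x :> gradient f x"
proof -
  obtain f' where f': "(f has_derivative f') (at x)" using assms by (auto simp: differentiable_def)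
  then have lin: "linear f'" by (rule has_derivative_linear)
  have "f' = (\<lambda>v. v \<bullet> (\<Sum>b\<in>Basis. f' b *\<^sub>R b))"
  proof
    fix v
    have "f' v = (\<Sum>b\<in>Basis. (v \<bullet> b) * f' b)"
      using linear_sum[OF lin, of "\<lambda>b. (v \<bullet> b) *\<^sub>R b" Basis] linear_scale[OF lin]
      by (simp add: euclidean_representation)
    then show "f' v = v \<bullet> (\<Sum>b\<in>Basis. f' b *\<^sub>R b)"
      by (simp add: inner_sum_right mult.commute)
  qed
  with f' have "\<exists>g. GDERIV f x :> g" unfolding gderiv_def by metis
  then show ?thesis unfolding gradient_def by (rule someI_ex)
qed

text \<open>Moving the polarity center is a projective map on the vectors \<open>tilde\<close>,
  hence linear on the lifted vectors up to positive factors.\<close>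

lemma hvec_change_point:
  fixes a :: "'m::finite \<Rightarrow> real^'n"
  assumes "x \<in> interior (polyP a)" "y \<in> interior (polyP a)"
  shows "block_mat (mat 1) 0 (y - x) 1 *v hvec a y i = ((1 - a i \<bullet> x) / (1 - a i \<bullet> y)) *\<^sub>R hvec a x i"
proof -
  have "0 < 1 - a i \<bullet> x" "0 < 1 - a i \<bullet> y" using assms by (auto simp: interior_polyP)
  then show ?thesis
    by (simp add: hvec_block block_vec_scaleR tilde_def)
      (simp add: inner_commute[of _ "a i"] inner_diff_right field_simps)
qed

text \<open>An optimal lifted matrix at \<open>x\<close> gives feasible points at all nearby \<open>y\<close>, since a fixed
  inscribed ellipsoid stays inscribed when the polarity center moves.\<close>

definition moved_form :: "real^('n::finite option)^('n option) \<Rightarrow> real^'n \<Rightarrow> real^('n option)^('n option)" where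
  "moved_form Q u = Q - outer_prod (block_vec 0 1) + outer_prod (block_vec (- u) 1)"

lemma moved_form_form:
  "v \<bullet> (moved_form Q u *v v) = v \<bullet> (Q *v v) - (block_vec 0 1 \<bullet> v)\<^sup>2 + (block_vec (- u) 1 \<bullet> v)\<^sup>2"
  by (simp add: moved_form_def matrix_vector_mult_add_rdistrib matrix_vector_mult_diff_rdistrib
      outer_prod_mult_vec inner_add_right inner_diff_right inner_commute power2_eq_square)

text \<open>The pullback along the change of point keeps the determinant. At the new lifted vector
  its form is \<open>c\<^sup>2\<close> times the value of \<open>moved_form\<close> at the old one,
  and the two rank-one corrections replace the bound 1 there by \<open>(1 / c)\<^sup>2\<close>,
  which cancels the factor.\<close>

lemma moved_form_feasible:
  fixes a :: "'m::finite \<Rightarrow> real^'n"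
  assumes x: "x \<in> interior (polyP a)" and y: "y \<in> interior (polyP a)" and Q: "lifted_feasible a x Q"
    and R: "posdef (moved_form Q (y - x))"
  obtains Q' where "lifted_feasible a y Q'" "det Q' = det (moved_form Q (y - x))"
proof -
  define R where "R = moved_form Q (y - x)"
  define S :: "real^('n option)^('n option)" where "S = block_mat (mat 1) 0 (y - x) 1"
  define Q' where "Q' = transpose S ** R ** S"
  have detS: "det S = 1" by (simp add: S_def det_block_lower)
  have pR: "posdef R" using assms(4) by (simp add: R_def)
  have form: "v \<bullet> (Q' *v v) = (S *v v) \<bullet> (R *v (S *v v))" for v
    by (simp add: Q'_def matrix_vector_mul_assoc[symmetric] inner_matrix_transpose[of v "transpose S"]
        del: transpose_matrix_vector)
  have detQ': "det Q' = det R" by (simp add: Q'_def det_mul detS)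
  have "posdef Q'"
  proof (rule posdef_if_psd_det_nonzero)
    show "transpose Q' = Q'"
      by (simp add: Q'_def matrix_transpose_mul matrix_mul_assoc posdefD(1)[OF pR])
    show "0 \<le> v \<bullet> (Q' *v v)" for v unfolding form by (rule posdefD(3)[OF pR])
    show "det Q' \<noteq> 0" using posdef_det_pos[OF pR] by (simp add: detQ')
  qed
  moreover have "hvec a y i \<bullet> (Q' *v hvec a y i) \<le> 1" for i
  proof -
    define c where "c = (1 - a i \<bullet> x) / (1 - a i \<bullet> y)"
    have pos: "0 < 1 - a i \<bullet> x" "0 < 1 - a i \<bullet> y" using x y by (auto simp: interior_polyP)
    have Sh: "S *v hvec a y i = c *\<^sub>R hvec a x i"
      using hvec_change_point[OF x y] by (simp add: S_def c_def)
    have "block_vec (- (y - x)) 1 \<bullet> hvec a x i = 1 / c"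
      using pos by (simp add: hvec_block tilde_def c_def inner_commute[of _ "a i"] inner_diff_right field_simps)
    moreover have "block_vec 0 1 \<bullet> hvec a x i = 1" by (simp add: hvec_block)
    ultimately have "hvec a x i \<bullet> (R *v hvec a x i) = hvec a x i \<bullet> (Q *v hvec a x i) - 1 + (1 / c)\<^sup>2"
      unfolding R_def moved_form_form by simp
    also have "\<dots> \<le> (1 / c)\<^sup>2" using Q by (simp add: lifted_feasible_def)
    finally have "c\<^sup>2 * (hvec a x i \<bullet> (R *v hvec a x i)) \<le> c\<^sup>2 * (1 / c)\<^sup>2"
      by (intro mult_left_mono) auto
    moreover have "c \<noteq> 0" using pos by (simp add: c_def)
    ultimately show ?thesis
      unfolding form Sh by (simp add: matrix_vector_mult_scaleR power2_eq_square mult.assoc)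
  qed
  ultimately show thesis
    using that[of Q'] detQ' by (simp add: lifted_feasible_def R_def)
qed

lemma eventually_posdef_moved_form:
  fixes Q :: "real^('n::finite option)^('n option)"
  assumes "posdef Q"
  shows "\<forall>\<^sub>F y in at x. posdef (moved_form Q (y - x))"
proof -
  obtain \<alpha> where \<alpha>: "0 < \<alpha>" "\<And>v. \<alpha> * (v \<bullet> v) \<le> v \<bullet> (Q *v v)" by (rule posdef_lower_bound[OF assms]) (rule that)
  have "\<forall>\<^sub>F y in at x. dist y x < min 1 (\<alpha> / 3)"
    unfolding eventually_at using \<alpha>(1) by (intro exI[of _ "min 1 (\<alpha> / 3)"]) auto
  then show ?thesis
  proof eventually_elim
    case (elim y)
    define u where "u = y - x"
    have u: "norm u < 1" "norm u < \<alpha> / 3" using elim by (auto simp: u_def dist_norm)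
    show ?case
      unfolding posdef_def u_def[symmetric]
    proof (intro conjI allI impI)
      show "transpose (moved_form Q u) = moved_form Q u"
        by (simp add: moved_form_def transpose_add transpose_diff posdefD(1)[OF assms])
      fix v :: "real^('n option)" assume v: "v \<noteq> 0"
      \<comment> \<open>A difference of squares: the first factor is small with \<open>u\<close>,
        the second has norm at most 3 as \<open>norm u < 1\<close>. Hence the radius
        \<open>\<alpha> / 3\<close>.\<close>
      have "(block_vec 0 1 \<bullet> v)\<^sup>2 - (block_vec (- u) 1 \<bullet> v)\<^sup>2 = (block_vec u 0 \<bullet> v) * (block_vec (- u) 2 \<bullet> v)"
        by (rule block_vec_cases[of v]) (simp add: power2_eq_square algebra_simps)
      also have "\<dots> \<le> (norm (block_vec u 0) * norm v) * (norm (block_vec (- u) 2) * norm v)"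
        by (rule order_trans[OF abs_ge_self], subst abs_mult, intro mult_mono Cauchy_Schwarz_ineq2) auto
      also have "norm (block_vec u 0) = norm u"
        by (simp add: norm_eq_sqrt_inner)
      also have "norm (block_vec (- u) 2) \<le> 3"
      proof -
        have "block_vec (- u) 2 \<bullet> block_vec (- u) 2 = (norm u)\<^sup>2 + 4"
          by (simp add: power2_norm_eq_inner)
        moreover have "(norm u)\<^sup>2 \<le> 1" using u(1) by (simp add: power_le_one)
        ultimately have "block_vec (- u) 2 \<bullet> block_vec (- u) 2 \<le> 3\<^sup>2" by simp
        then show ?thesis by (simp add: norm_eq_sqrt_inner real_le_lsqrt)
      qed
      finally have "(block_vec 0 1 \<bullet> v)\<^sup>2 - (block_vec (- u) 1 \<bullet> v)\<^sup>2 \<le> (norm u * norm v) * (3 * norm v)"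
        by (simp add: mult_left_mono mult_right_mono)
      also have "\<dots> = (3 * norm u) * (v \<bullet> v)"
        by (simp add: dot_square_norm power2_eq_square)
      also have "\<dots> < \<alpha> * (v \<bullet> v)"
        using u(2) v by (intro mult_strict_right_mono) auto
      also have "\<dots> \<le> v \<bullet> (Q *v v)" by (rule \<alpha>)
      finally show "0 < v \<bullet> (moved_form Q u *v v)" by (simp add: moved_form_form)
    qed
  qed
qed

section \<open>The dual problem over the simplex and differentiability of the polar volume\<close>

lemma compact_simplexD: "compact (simplexD :: (real^'m) set)"
proof -
  have "norm l \<le> 1" if "l \<in> simplexD" for l :: "real^'m"
    using norm_le_l1_cart[of l] that by (simp add: simplexD_def)
  then have "bounded (simplexD :: (real^'m) set)" unfolding bounded_iff by blast
  moreover have "closed (simplexD :: (real^'m) set)"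
  proof -
    have eq: "(simplexD :: (real^'m) set) = (\<Inter>i. {l. 0 \<le> l $ i}) \<inter> {l. (\<Sum>i\<in>UNIV. l $ i) = 1}"
      by (auto simp: simplexD_def)
    show ?thesis
      unfolding eq by (intro closed_Int closed_INT ballI closed_Collect_le closed_Collect_eq continuous_intros)
  qed
  ultimately show ?thesis by (simp add: compact_eq_bounded_closed)
qed

text \<open>Compactness gives an exact dual maximizer \<open>l\<close>. Equality of values comes
  from approximate maximizers: their recovered matrices are feasible, and their value falls short of
  the dual value at \<open>l\<close> by at most \<open>d * z\<close> with \<open>z\<close>
  arbitrarily small.\<close>

lemma strong_duality:
  fixes a :: "'m::finite \<Rightarrow> real^'n"
  assumes P: "bounded (polyP a)" "x \<in> interior (polyP a)"
    and approx: "\<And>z. 0 < z \<Longrightarrow> z < 1 \<Longrightarrow> \<exists>l. strong_approx a x z l"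
  obtains l where "l \<in> simplexD" "posdef (Mmat a x l)"
    "ln (det (Qopt a x)) = - ln (det (Mmat a x l)) - (real CARD('n) + 1) * ln (real CARD('n) + 1)"
proof -
  define d where "d = real CARD('n) + 1"
  have d: "0 < d" by (simp add: d_def)
  note opt = Qopt_optimal[OF P]
  obtain l0 where l0: "strong_approx a x (1/2) l0" using approx[of "1/2"] by auto
  have "\<exists>l\<in>simplexD. \<forall>l'\<in>simplexD. det (Mmat a x l') \<le> det (Mmat a x l)"
    using l0 unfolding Mmat_def
    by (intro continuous_attains_sup compact_simplexD) (auto simp: strong_approx_def intro!: continuous_intros)
  then obtain l where l: "l \<in> simplexD" "\<And>l'. l' \<in> simplexD \<Longrightarrow> det (Mmat a x l') \<le> det (Mmat a x l)" by blast
  have "0 < det (Mmat a x l0)" using l0 by (auto simp: strong_approx_def intro: posdef_det_pos)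
  also have "\<dots> \<le> det (Mmat a x l)" using l0 by (intro l) (auto simp: strong_approx_def)
  finally have det_pos: "0 < det (Mmat a x l)" .
  then have pM: "posdef (Mmat a x l)"
    using Mmat_psd[OF l(1)] by (intro posdef_if_psd_det_nonzero transpose_Mmat) auto
  have "- ln (det (Mmat a x l)) - d * ln d \<le> ln (det (Qopt a x))"
  proof (rule field_le_epsilon)
    fix e :: real assume e: "0 < e"
    define z where "z = min (1/2) (e / d)"
    have z: "0 < z" "z < 1" "d * z \<le> e"
      using e d by (auto simp: z_def min_def field_simps)
    obtain lz where lz: "strong_approx a x z lz" using approx z by blast
    then have pz: "posdef (Mmat a x lz)" "lz \<in> simplexD" by (auto simp: strong_approx_def)
    have feas: "lifted_feasible a x (recovered a x z lz)" using recovered_near_optimal(1)[OF lz z(1)] .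
    then have "0 < det (recovered a x z lz)" by (auto simp: lifted_feasible_def intro: posdef_det_pos)
    then have "ln (det (recovered a x z lz)) \<le> ln (det (Qopt a x))"
      using opt(2)[OF feas] by simp
    moreover have "ln (det (recovered a x z lz)) = - d * (ln d + ln (1 + z)) - ln (det (Mmat a x lz))"
      using ln_det_recovered[OF pz(1) z(1)] by (simp add: d_def)
    moreover have "d * ln (1 + z) \<le> d * z"
      using d z by (intro mult_left_mono ln_add_one_self_le_self) auto
    moreover have "ln (det (Mmat a x lz)) \<le> ln (det (Mmat a x l))"
      using l(2)[OF pz(2)] posdef_det_pos[OF pz(1)] det_pos by simp
    ultimately show "- ln (det (Mmat a x l)) - d * ln d \<le> ln (det (Qopt a x)) + e"
      using z(3) by (simp add: algebra_simps)
  qed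
  moreover have "ln (det (Qopt a x)) \<le> - ln (det (Mmat a x l)) - d * ln d"
    unfolding d_def using opt(1) l(1) pM by (rule weak_duality)
  ultimately show thesis using that[OF l(1) pM] by (simp add: d_def)
qed

lemma differentiable_vfun:
  fixes a :: "'m::finite \<Rightarrow> real^'n"
  assumes P: "bounded (polyP a)" "x \<in> interior (polyP a)"
    and approx: "\<And>z. 0 < z \<Longrightarrow> z < 1 \<Longrightarrow> \<exists>l. strong_approx a x z l"
  shows "vfun a differentiable (at x)"
proof -
  define d where "d = real CARD('n) + 1"
  define k where "k = ln_kappa (real CARD('n))"
  obtain l where l: "l \<in> simplexD" "posdef (Mmat a x l)"
    "ln (det (Qopt a x)) = - ln (det (Mmat a x l)) - d * ln d"
    using strong_duality[OF P approx] unfolding d_def by blast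
  define Q where "Q = Qopt a x"
  have Q: "lifted_feasible a x Q" using Qopt_optimal(1)[OF P] by (simp add: Q_def)
  then have pQ: "posdef Q" by (simp add: lifted_feasible_def)
  define g where "g y = (k + ln (det (Mmat a y l)) + d * ln d) / 2" for y
  define h where "h y = (k - ln (det (moved_form Q (y - x)))) / 2" for y
  have int: "\<forall>\<^sub>F y in at x. y \<in> interior (polyP a)"
    using P(2) by (intro eventually_at_topological[THEN iffD2]) (auto intro!: exI[of _ "interior (polyP a)"])
  have dM: "(\<lambda>y. det (Mmat a y l)) differentiable (at x)"
  proof (rule differentiable_det)
    fix i j :: "'n option"
    have h: "(\<lambda>y. hvec a y i' $ j') differentiable (at x)" for i' j'
      using P(2) by (cases j')
        (auto simp: hvec_def interior_polyP less_imp_neq intro!: differentiable_divide differentiable_diff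
          differentiable_const differentiable_inner)
    have "(\<lambda>y. \<Sum>i'\<in>UNIV. l $ i' * (hvec a y i' $ i * hvec a y i' $ j)) differentiable (at x)"
      by (intro differentiable_sum ballI differentiable_mult differentiable_const h) simp
    then show "(\<lambda>y. Mmat a y l $ i $ j) differentiable (at x)"
      by (simp add: Mmat_def outer_prod_def)
  qed
  have det0: "0 < det (Mmat a x l)" using l(2) by (rule posdef_det_pos)
  have dR: "(\<lambda>y. det (moved_form Q (y - x))) differentiable (at x)"
  proof (rule differentiable_det)
    fix i j :: "'n option"
    have p: "(\<lambda>y. block_vec (- (y - x)) 1 $ j') differentiable (at x)" for j'
    proof (cases j')
      case None
      then show ?thesis by simp
    next
      case (Some j'')
      have "(\<lambda>y. (x - y) $ j'') = (\<lambda>y. (x - y) \<bullet> axis j'' 1)"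
        by (simp add: cart_eq_inner_axis)
      moreover have "(\<lambda>y. (x - y) \<bullet> axis j'' 1) differentiable (at x)"
        by (intro differentiable_inner differentiable_diff differentiable_const differentiable_ident)
      ultimately show ?thesis using Some by simp
    qed
    have "(\<lambda>y. Q $ i $ j - block_vec 0 1 $ i * block_vec 0 1 $ j + block_vec (- (y - x)) 1 $ i * block_vec (- (y - x)) 1 $ j)
        differentiable (at x)"
      by (intro differentiable_add differentiable_mult differentiable_const p)
    then show "(\<lambda>y. moved_form Q (y - x) $ i $ j) differentiable (at x)"
      by (simp add: moved_form_def outer_prod_def)
  qed
  have R0: "moved_form Q (x - x) = Q" by (simp add: moved_form_def)
  show ?thesis
  proof (rule differentiable_squeeze[of g x h])
    show "g differentiable (at x)"
      unfolding g_def using det0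
      by (intro differentiable_divide differentiable_add differentiable_const differentiable_ln dM) auto
    show "h differentiable (at x)"
      unfolding h_def using posdef_det_pos[OF pQ]
      by (intro differentiable_divide differentiable_diff differentiable_const differentiable_ln dR) (use R0 in simp_all)
    have "\<forall>\<^sub>F y in at x. 0 < det (Mmat a y l)"
      using differentiable_imp_continuous_within[OF dM] det0
      by (intro order_tendstoD(1)[of "\<lambda>y. det (Mmat a y l)"]) (auto simp: continuous_within)
    with int show "\<forall>\<^sub>F y in at x. g y \<le> vfun a y"
    proof eventually_elim
      case (elim y)
      \<comment> \<open>With \<open>l\<close> fixed, \<open>Mmat a y l\<close> is always
        semidefinite, so positivity of its determinant near \<open>x\<close> is enough.\<close>
      have "posdef (Mmat a y l)"
        using Mmat_psd[OF l(1)] elim by (intro posdef_if_psd_det_nonzero transpose_Mmat) auto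
      then have "ln (det (Qopt a y)) \<le> - ln (det (Mmat a y l)) - d * ln d"
        unfolding d_def by (intro weak_duality l Qopt_optimal(1) P elim)
      then show ?case by (simp add: g_def vfun_eq(1)[OF P(1) elim(1)] k_def)
    qed
    show "\<forall>\<^sub>F y in at x. vfun a y \<le> h y"
      using int eventually_posdef_moved_form[OF pQ, of x]
    proof eventually_elim
      case (elim y)
      obtain Q' where Q': "lifted_feasible a y Q'" "det Q' = det (moved_form Q (y - x))"
        by (rule moved_form_feasible[OF P(2) elim(1) Q elim(2)])
      have "0 < det Q'" using posdef_det_pos[OF elim(2)] Q'(2) by simp
      then have "ln (det Q') \<le> ln (det (Qopt a y))"
        using Qopt_optimal(2)[OF P(1) elim(1) Q'(1)] by simp
      then show ?case using Q'(2) by (simp add: h_def vfun_eq(1)[OF P(1) elim(1)] k_def)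
    qed
    show "g x = vfun a x" using l(3) by (simp add: g_def vfun_eq(1)[OF P] k_def)
    show "h x = vfun a x" unfolding h_def R0 by (simp add: Q_def vfun_eq(1)[OF P] k_def)
  qed
qed

section \<open>The inexact polarity process\<close>

lemma strong_approx_stop_time:
  assumes "strong_approx a x \<zeta> (L t)"
  shows "strong_approx a x \<zeta> (L (stop_time a x \<zeta> L))" "stop_time a x \<zeta> L \<le> t"
  unfolding stop_time_def using assms by (fact LeastI, fact Least_le)

text \<open>A ball about a point of \<open>K\<close> whose radius is the distance to the frontier is
  connected and meets \<open>S\<close>; leaving \<open>S\<close>, it would contain a frontier point
  that is too close.\<close>

lemma near_setdist_frontier_interior:
  fixes S :: "'a::euclidean_space set"
  assumes K: "K \<subseteq> interior S" "K \<noteq> {}" and r: "infdist y K < setdist K (frontier S)"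
  shows "y \<in> interior S"
proof -
  \<comment> \<open>The infimum need not be attained; strictness of the inequality supplies an
    actual point of \<open>K\<close>.\<close>
  obtain k where k: "k \<in> K" "dist y k < setdist K (frontier S)"
    using r K(2) by (auto simp: infdist_notempty cInf_less_iff)
  have "ball k (setdist K (frontier S)) \<subseteq> S"
  proof (rule ccontr)
    assume "\<not> ball k (setdist K (frontier S)) \<subseteq> S"
    moreover have "k \<in> ball k (setdist K (frontier S)) \<inter> S"
      using k K(1) interior_subset[of S] by (auto intro: order.strict_trans1[OF zero_le_dist])
    ultimately have "ball k (setdist K (frontier S)) \<inter> frontier S \<noteq> {}"
      by (intro connected_Int_frontier connected_ball) blast+
    then obtain w where "w \<in> frontier S" "dist k w < setdist K (frontier S)" by auto
    then show False using setdist_le_dist[OF k(1), of w "frontier S"] by simp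
  qed
  then have "ball k (setdist K (frontier S)) \<subseteq> interior S" by (intro interior_maximal) auto
  then show ?thesis using k(2) by (auto simp: dist_commute)
qed

lemma gradient_bound_on_segment:
  fixes f :: "'a::euclidean_space \<Rightarrow> real"
  assumes diff: "\<And>w. w \<in> closed_segment x y \<Longrightarrow> f differentiable (at w)"
    and bound: "\<And>w. w \<in> closed_segment x y \<Longrightarrow> norm (gradient f w) \<le> B"
  shows "\<bar>f x - f y\<bar> \<le> B * norm (x - y)"
proof -
  have "norm (f x - f y) \<le> B * norm (x - y)"
  proof (rule differentiable_bound[of "closed_segment x y" f "\<lambda>w h. h \<bullet> gradient f w"])
    show "(f has_derivative (\<lambda>h. h \<bullet> gradient f w)) (at w within closed_segment x y)" if "w \<in> closed_segment x y" for w
      using differentiable_imp_GDERIV_gradient[OF diff[OF that]]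
      by (auto simp: gderiv_def intro: has_derivative_at_withinI)
    show "onorm (\<lambda>h. h \<bullet> gradient f w) \<le> B" if "w \<in> closed_segment x y" for w
    proof (rule onorm_le)
      fix h
      have "\<bar>h \<bullet> gradient f w\<bar> \<le> norm h * norm (gradient f w)"
        by (rule Cauchy_Schwarz_ineq2)
      also have "\<dots> \<le> norm h * B"
        using bound[OF that] by (rule mult_left_mono) simp
      finally show "norm (h \<bullet> gradient f w) \<le> B * norm h"
        by (simp add: mult.commute)
    qed
  qed auto
  then show ?thesis by simp
qed

text \<open>The common shape of the five terms of the tolerance: \<open>\<alpha>\<close> stands for
  \<open>lambda0\<close>, \<open>k\<close> for a Lipschitz factor of the controlled quantity,
  \<open>c\<close> for its allowed error.\<close>

lemma tolerance_bound:
  fixes \<eta> \<alpha> m \<epsilon> k c :: real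
  assumes "\<eta>\<^sup>2 \<le> 2 * (m / \<alpha>)\<^sup>2 * \<epsilon>" "\<epsilon> \<le> \<alpha>\<^sup>2 * c\<^sup>2 / (2 * m\<^sup>2 * k\<^sup>2)"
    and "0 < \<alpha>" "0 < m" "0 < k" "0 \<le> c"
  shows "k * \<eta> \<le> c"
proof (rule power2_le_imp_le)
  have "\<eta>\<^sup>2 \<le> 2 * (m / \<alpha>)\<^sup>2 * (\<alpha>\<^sup>2 * c\<^sup>2 / (2 * m\<^sup>2 * k\<^sup>2))"
    using assms by (intro order_trans[OF assms(1)] mult_left_mono) auto
  also have "\<dots> = c\<^sup>2 / k\<^sup>2"
    using assms(3-5) by (simp add: power_divide)
  finally show "(k * \<eta>)\<^sup>2 \<le> c\<^sup>2"
    using assms(5) by (simp add: power_mult_distrib pos_le_divide_eq mult.commute)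
qed (fact assms)

text \<open>The exponent counts the contractions that bring \<open>\<delta>\<close> down to
  \<open>l / 2\<close>; if \<open>\<delta>\<close> starts there, any exponent works.\<close>

lemma power_log_plus_bound:
  fixes q \<delta> l :: real
  assumes q: "0 < q" "q < 1" and "0 \<le> \<delta>" "0 < l"
  shows "q ^ nat \<lceil>log_plus (2 * \<delta> / l) / ln (1 / q)\<rceil> * \<delta> \<le> l / 2"
proof (cases "2 * \<delta> \<le> l")
  case True
  have "q ^ nat \<lceil>log_plus (2 * \<delta> / l) / ln (1 / q)\<rceil> * \<delta> \<le> 1 * \<delta>"
    using assms by (intro mult_right_mono power_le_one) auto
  then show ?thesis using True by simp
next
  case False
  define N where "N = nat \<lceil>log_plus (2 * \<delta> / l) / ln (1 / q)\<rceil>"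
  have t: "1 < 2 * \<delta> / l" using False assms by simp
  then have "log_plus (2 * \<delta> / l) = ln (2 * \<delta> / l)" by (simp add: log_plus_def del: zero_less_divide_iff)
  then have "ln (2 * \<delta> / l) / ln (1 / q) \<le> real N"
    unfolding N_def using real_nat_ceiling_ge by metis
  moreover have "0 < ln (1 / q)" using q by simp
  ultimately have "ln (2 * \<delta> / l) \<le> real N * ln (1 / q)"
    by (simp add: pos_divide_le_eq)
  also have "\<dots> = - ln (q ^ N)" using q by (simp add: ln_realpow ln_div)
  finally have "ln (q ^ N * (2 * \<delta> / l)) \<le> 0"
    using q t by (subst ln_mult_pos) auto
  moreover have "0 < q ^ N * (2 * \<delta> / l)" using q t by (intro mult_pos_pos) auto
  ultimately have "q ^ N * (2 * \<delta> / l) \<le> 1" by simp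
  then show ?thesis using assms(4) by (simp add: N_def field_simps)
qed

theorem theorem6:
  fixes a :: "'m::finite \<Rightarrow> real^'n"
    and x0 :: "real^'n"
    and \<gamma> \<epsilon> \<zeta> q0 lambda0 \<theta>0 \<mu>0 \<sigma>0 \<beta>0 \<rho>0 Lctr Lvol r0 L0 c :: real
    and V0 :: "(real^'n) set"
    and N :: nat
    and C_WA J :: "real^'n \<Rightarrow> real"
    and waty :: "real^'n \<Rightarrow> nat \<Rightarrow> real^'m"
    and X :: "nat \<Rightarrow> real^'n"
    and E :: "nat \<Rightarrow> real^'n^'n"
    and init_ops :: "nat \<Rightarrow> nat"
    and iter_ops :: "nat \<Rightarrow> nat \<Rightarrow> nat"
  assumes P_bounded: "bounded (polyP a)"
    and P_full: "interior (polyP a) \<noteq> {}"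
    and x0: "x0 \<in> interior (polyP a)"
    and \<gamma>: "0 < \<gamma>" "\<gamma> < 1"
    (* constants depending on P and x0 *)
    and q0: "0 < q0" "q0 < 1"
      "\<forall>x\<in>levelL a x0. delta_v a (Kmap a x) \<le> q0 * delta_v a x"
    and lambda0: "0 < lambda0"
      "is_min_value (\<lambda>x. lambda_min (\<Sum>i\<in>UNIV. outer_prod (hvec a x i))) (levelL a x0) lambda0"
    and \<theta>0: "0 < \<theta>0" "is_min_value (\<lambda>x. lambda_min (Qopt a x)) (levelL a x0) \<theta>0"
    and \<mu>0: "0 < \<mu>0" "is_min_value (\<lambda>x. lambda_min (blkG (Qopt a x))) (levelL a x0) \<mu>0"
    and \<sigma>0: "0 < \<sigma>0" "is_min_value (\<lambda>x. 1 - blks (Qopt a x)) (levelL a x0) \<sigma>0"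
    and \<beta>0: "0 < \<beta>0" "is_min_value (\<lambda>x. betaQ (Qopt a x)) (levelL a x0) \<beta>0"
    and \<rho>0: "0 < \<rho>0"
      "\<forall>x\<in>levelL a x0. \<forall>Q. lifted_feasible a x Q \<and> norm (Q - Qopt a x) \<le> \<rho>0 \<longrightarrow>
         lambda_min Q \<ge> \<theta>0 / 2 \<and> lambda_min (blkG Q) \<ge> \<mu>0 / 2 \<and>
         1 - blks Q \<ge> \<sigma>0 / 2 \<and> betaQ Q \<ge> \<beta>0 / 2"
    and Lctr: "0 < Lctr"
      "\<forall>x\<in>levelL a x0. \<forall>Q. lifted_feasible a x Q \<and> norm (Q - Qopt a x) \<le> \<rho>0 \<longrightarrow>
         norm (centerK x Q - Kmap a x) \<le> Lctr * norm (Q - Qopt a x)"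
    and Lvol: "0 < Lvol"
      "\<forall>x\<in>levelL a x0. \<forall>Q. lifted_feasible a x Q \<and> norm (Q - Qopt a x) \<le> \<rho>0 \<longrightarrow>
         \<bar>ln (ellipsoid_vol (ellipsoid (centerK x Q) (shapeE Q)))
           - ln (ellipsoid_vol (ellipsoid (Kmap a x) (shapeE (Qopt a x))))\<bar>
         \<le> Lvol * norm (Q - Qopt a x)"
    and r0: "0 < r0" "r0 = setdist (Kmap a ` levelL a x0) (frontier (polyP a))"
    and V0: "V0 = {y. infdist y (Kmap a ` levelL a x0) \<le> r0 / 2}"
    and L0: "0 < L0" "is_max_value (\<lambda>y. norm (gradient (delta_v a) y)) V0 L0"
    (* the WA-TY method and its iteration bound at a fixed x *)
    and waty: "\<forall>x\<in>interior (polyP a). waty_run a x (waty x)"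
    and C_J_pos: "\<forall>x\<in>interior (polyP a). 0 < C_WA x \<and> 0 < J x"
    and waty_bound: "\<forall>x\<in>interior (polyP a). \<forall>z. 0 < z \<and> z < 1 \<longrightarrow>
         (\<exists>t. real t \<le> J x + 56 * C_WA x * ln (1 / z) \<and> strong_approx a x z (waty x t))"
    (* parameters of the run *)
    and \<epsilon>: "\<epsilon> = Min {lambda0\<^sup>2 * \<rho>0\<^sup>2 / (2 * (real CARD('m))\<^sup>2),
                    lambda0\<^sup>2 * r0\<^sup>2 / (8 * (real CARD('m))\<^sup>2 * Lctr\<^sup>2),
                    lambda0\<^sup>2 * (1 - q0)\<^sup>2 / (2 * (real CARD('m))\<^sup>2 * L0\<^sup>2 * Lctr\<^sup>2),
                    lambda0\<^sup>2 * (1 - q0)\<^sup>2 * (ln (1 / \<gamma>))\<^sup>2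
                      / (32 * (real CARD('m))\<^sup>2 * L0\<^sup>2 * Lctr\<^sup>2),
                    lambda0\<^sup>2 * (ln (1 / \<gamma>))\<^sup>2 / (32 * (real CARD('m))\<^sup>2 * Lvol\<^sup>2)}"
    and N: "N = nat \<lceil>log_plus (2 * delta_v a x0 / ln (1 / \<gamma>)) / ln (1 / q0)\<rceil>"
    and \<zeta>: "\<zeta> = min (1 / 2) (\<epsilon> / (real CARD('n) + 1))"
    (* the process: N + 1 updates *)
    and X_0: "X 0 = x0"
    and X_Suc: "\<forall>k\<le>N. X (Suc k) = centerK (X k) (waty_oracle a \<zeta> waty (X k))"
    and E_Suc: "\<forall>k\<le>N. E (Suc k) = shapeE (waty_oracle a \<zeta> waty (X k))"
    (* dense implementation model: operation counts in outer iteration k (and inner iteration t) *)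
    and init_ops: "\<forall>k\<le>N. real (init_ops k) \<le> c * real CARD('m) * (real CARD('n) + 1)\<^sup>2"
    and iter_ops: "\<forall>k\<le>N. \<forall>t. real (iter_ops k t) \<le> c * real CARD('m) * (real CARD('n) + 1)\<^sup>2"
  shows "gamma_maximal (polyP a) \<gamma> (ellipsoid (X (N + 1)) (E (N + 1))) \<and>
    real (\<Sum>k\<le>N. init_ops k + (\<Sum>t<stop_time a (X k) \<zeta> (waty (X k)). iter_ops k t))
      \<le> c * (1 + 1 / J x0) *
        ((real N + 1) * real CARD('m) * (real CARD('n) + 1)\<^sup>2 *
          (Max ((\<lambda>k. J (X k)) ` {0..N}) + 56 * Max ((\<lambda>k. C_WA (X k)) ` {0..N}) * ln (1 / \<zeta>)))"
proof -
  define n where "n = real CARD('n)"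
  define m where "m = real CARD('m)"
  define \<l> where "\<l> = ln (1 / \<gamma>)"
  define L where "L = levelL a x0"
  define Qh where "Qh = waty_oracle a \<zeta> waty"
  define \<eta> where "\<eta> x = norm (Qh x - Qopt a x)" for x
  note bnd = P_bounded
  have m: "0 < m" by (simp add: m_def)
  have \<l>: "0 < \<l>" using \<gamma> by (simp add: \<l>_def)
  have Lint: "x \<in> interior (polyP a)" if "x \<in> L" for x
    using that by (simp add: L_def levelL_def)
  have x0L: "x0 \<in> L" using x0 by (simp add: L_def levelL_def)
  \<comment> \<open>The five terms of the minimum in the shape that \<open>tolerance_bound\<close>
    expects; \<open>1\<^sup>2\<close> and \<open>r0 / 2\<close> serve only this purpose.\<close>
  have \<epsilon>_le: "\<epsilon> \<le> lambda0\<^sup>2 * \<rho>0\<^sup>2 / (2 * m\<^sup>2 * 1\<^sup>2)"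
    "\<epsilon> \<le> lambda0\<^sup>2 * (r0 / 2)\<^sup>2 / (2 * m\<^sup>2 * Lctr\<^sup>2)"
    "\<epsilon> \<le> lambda0\<^sup>2 * (1 - q0)\<^sup>2 / (2 * m\<^sup>2 * (L0 * Lctr)\<^sup>2)"
    "\<epsilon> \<le> lambda0\<^sup>2 * ((1 - q0) * \<l> / 4)\<^sup>2 / (2 * m\<^sup>2 * (L0 * Lctr)\<^sup>2)"
    "\<epsilon> \<le> lambda0\<^sup>2 * (\<l> / 4)\<^sup>2 / (2 * m\<^sup>2 * Lvol\<^sup>2)"
    unfolding \<epsilon> by (intro Min_le_iff[THEN iffD2]; simp add: m_def \<l>_def power_mult_distrib power_divide mult.assoc)+
  have \<epsilon>_pos: "0 < \<epsilon>"
    unfolding \<epsilon> using lambda0(1) \<rho>0(1) r0(1) Lctr(1) Lvol(1) L0(1) q0 m \<l>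
    by (subst Min_gr_iff) (auto simp: m_def \<l>_def)
  have \<zeta>_bounds: "0 < \<zeta>" "\<zeta> < 1" "(n + 1) * \<zeta> \<le> \<epsilon>"
  proof -
    have "\<zeta> \<le> \<epsilon> / (n + 1)" "0 < n + 1" by (auto simp: \<zeta> n_def)
    then show "(n + 1) * \<zeta> \<le> \<epsilon>" by (simp add: pos_le_divide_eq mult.commute)
    show "0 < \<zeta>" "\<zeta> < 1" using \<epsilon>_pos by (auto simp: \<zeta> min_def)
  qed
  have approx: "\<exists>l. strong_approx a x z l" if "x \<in> interior (polyP a)" "0 < z" "z < 1" for x z
    using waty_bound that by blast
  have stop: "strong_approx a x \<zeta> (waty x (stop_time a x \<zeta> (waty x)))"
    "real (stop_time a x \<zeta> (waty x)) \<le> J x + 56 * C_WA x * ln (1 / \<zeta>)"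
    if x: "x \<in> interior (polyP a)" for x
  proof -
    obtain t where t: "real t \<le> J x + 56 * C_WA x * ln (1 / \<zeta>)" "strong_approx a x \<zeta> (waty x t)"
      using waty_bound x \<zeta>_bounds by blast
    show "strong_approx a x \<zeta> (waty x (stop_time a x \<zeta> (waty x)))"
      using t(2) by (rule strong_approx_stop_time)
    have "stop_time a x \<zeta> (waty x) \<le> t"
      using t(2) by (rule strong_approx_stop_time)
    then show "real (stop_time a x \<zeta> (waty x)) \<le> J x + 56 * C_WA x * ln (1 / \<zeta>)"
      using t(1) by linarith
  qed
  \<comment> \<open>On the level set the oracle gap bounds \<open>(\<eta> x)\<^sup>2\<close>, and
    each term of \<open>\<epsilon>\<close> converts this into one error estimate.\<close>
  have Qh: "lifted_feasible a x (Qh x)" "\<eta> x \<le> \<rho>0" "Lctr * \<eta> x \<le> r0 / 2" "L0 * Lctr * \<eta> x \<le> 1 - q0"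
    "L0 * Lctr * \<eta> x \<le> (1 - q0) * \<l> / 4" "Lvol * \<eta> x \<le> \<l> / 4" if x: "x \<in> L" for x
  proof -
    have xi: "x \<in> interior (polyP a)" by (rule Lint[OF x])
    note rec = recovered_near_optimal[OF stop(1)[OF xi] \<zeta>_bounds(1), folded waty_oracle_def Qh_def]
    show "lifted_feasible a x (Qh x)" by (rule rec(1))
    have "lambda0 \<le> lambda_min (\<Sum>i\<in>UNIV. outer_prod (hvec a x i))"
      using lambda0(2) x by (simp add: is_min_value_def L_def)
    moreover have "ln (det (Qopt a x)) \<le> ln (det (Qh x)) + \<epsilon>"
      using rec(2)[OF Qopt_optimal(1)[OF bnd xi]] \<zeta>_bounds(3) by (simp add: n_def)
    ultimately have \<eta>: "(\<eta> x)\<^sup>2 \<le> 2 * (m / lambda0)\<^sup>2 * \<epsilon>"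
      unfolding \<eta>_def m_def by (intro near_optimal_is_close[OF bnd xi lambda0(1)] rec(1))
    note tol = tolerance_bound[OF \<eta> _ lambda0(1) m]
    show "\<eta> x \<le> \<rho>0" using tol[OF \<epsilon>_le(1)] \<rho>0(1) by simp
    show "Lctr * \<eta> x \<le> r0 / 2" using tol[OF \<epsilon>_le(2)] r0(1) Lctr(1) by simp
    show "L0 * Lctr * \<eta> x \<le> 1 - q0" using tol[OF \<epsilon>_le(3)] q0 L0(1) Lctr(1) by simp
    show "L0 * Lctr * \<eta> x \<le> (1 - q0) * \<l> / 4" using tol[OF \<epsilon>_le(4)] q0 \<l> L0(1) Lctr(1) by simp
    show "Lvol * \<eta> x \<le> \<l> / 4" using tol[OF \<epsilon>_le(5)] \<l> Lvol(1) by simp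
  qed
  \<comment> \<open>\<open>V0\<close> reaches only \<open>r0 / 2\<close> from the image of the
    center map, strictly less than the distance \<open>r0\<close> to the boundary.\<close>
  have V0_int: "y \<in> interior (polyP a)" if "y \<in> V0" for y
  proof (rule near_setdist_frontier_interior)
    show "Kmap a ` L \<subseteq> interior (polyP a)" using Kmap_interior[OF bnd Lint] by auto
    show "Kmap a ` L \<noteq> {}" using x0L by blast
    show "infdist y (Kmap a ` L) < setdist (Kmap a ` L) (frontier (polyP a))"
      using that r0 by (simp add: V0 L_def)
  qed
  have diff: "delta_v a differentiable (at y)" if "y \<in> interior (polyP a)" for y
    unfolding delta_v_def[abs_def]
    using differentiable_vfun[OF bnd that approx[OF that]]
    by (intro differentiable_diff differentiable_const)
  have update: "centerK x (Qh x) \<in> interior (polyP a)"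
    "delta_v a (centerK x (Qh x)) \<le> q0 * delta_v a x + L0 * Lctr * \<eta> x" if x: "x \<in> L" for x
  proof -
    let ?y = "centerK x (Qh x)" and ?K = "Kmap a x"
    have dist: "norm (?y - ?K) \<le> Lctr * \<eta> x"
      using Lctr(2) x Qh[OF x] by (simp add: L_def \<eta>_def)
    \<comment> \<open>The mean value estimate uses the gradient on the whole segment, which stays
      within \<open>r0 / 2\<close> of \<open>?K\<close> because its end point \<open>?y\<close>
      does.\<close>
    have seg: "closed_segment ?y ?K \<subseteq> V0"
    proof
      fix w assume "w \<in> closed_segment ?y ?K"
      then have "dist w ?K \<le> dist ?y ?K"
        using dist_in_closed_segment[of w ?y ?K] by (simp add: dist_commute)
      then have "dist w ?K \<le> r0 / 2"
        using dist Qh(3)[OF x] by (simp add: dist_norm)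
      moreover have "infdist w (Kmap a ` L) \<le> dist w ?K"
        using x by (intro infdist_le) auto
      ultimately show "w \<in> V0" by (simp add: V0 L_def)
    qed
    then show "?y \<in> interior (polyP a)" by (auto intro!: V0_int)
    have "\<bar>delta_v a ?y - delta_v a ?K\<bar> \<le> L0 * norm (?y - ?K)"
      using seg L0(2) by (intro gradient_bound_on_segment diff V0_int) (auto simp: is_max_value_def)
    also have "\<dots> \<le> L0 * (Lctr * \<eta> x)"
      using dist L0(1) by (intro mult_left_mono) auto
    finally have "delta_v a ?y \<le> delta_v a ?K + L0 * Lctr * \<eta> x" by (simp add: mult.assoc)
    moreover have "delta_v a ?K \<le> q0 * delta_v a x" using q0(3) x by (simp add: L_def)
    ultimately show "delta_v a ?y \<le> q0 * delta_v a x + L0 * Lctr * \<eta> x" by linarith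
  qed
  have \<delta>0: "0 \<le> delta_v a x0" by (rule delta_v_bounds(1)[OF bnd x0])
  have L_iff: "x \<in> L \<longleftrightarrow> x \<in> interior (polyP a) \<and> delta_v a x \<le> delta_v a x0 + 1" for x
    by (auto simp: L_def levelL_def delta_v_def)
  \<comment> \<open>Membership in the level set belongs to the induction, as the constants are valid
    only there. The second summand is the partial geometric series of the errors
    \<open>(1 - q0) * \<l> / 4\<close>.\<close>
  have iter: "X k \<in> L \<and> delta_v a (X k) \<le> q0 ^ k * delta_v a x0 + (1 - q0 ^ k) * (\<l> / 4)" if "k \<le> N" for k
    using that
  proof (induction k)
    case 0
    then show ?case using x0L by (simp add: X_0)
  next
    case (Suc k)
    then have XL: "X k \<in> L" and IH: "delta_v a (X k) \<le> q0 ^ k * delta_v a x0 + (1 - q0 ^ k) * (\<l> / 4)" by auto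
    have X: "X (Suc k) = centerK (X k) (Qh (X k))" using X_Suc Suc by (simp add: Qh_def)
    note up = update[OF XL, folded X]
    \<comment> \<open>The cruder error bound \<open>1 - q0\<close> enters here: with the slack 1 of
      the level set, \<open>q0 * (\<delta> + 1) + (1 - q0) = q0 * \<delta> + 1\<close> for the
      initial deficit \<open>\<delta>\<close>.\<close>
    have "delta_v a (X (Suc k)) \<le> q0 * (delta_v a x0 + 1) + (1 - q0)"
      using up(2) Qh(4)[OF XL] XL q0(1) by (smt (verit) L_iff mult_left_mono)
    also have "\<dots> \<le> delta_v a x0 + 1"
      using mult_left_le_one_le[of "delta_v a x0" q0] \<delta>0 q0(1,2) by (simp add: algebra_simps)
    finally have "X (Suc k) \<in> L" using up(1) by (simp add: L_iff)
    moreover have "delta_v a (X (Suc k)) \<le> q0 * (q0 ^ k * delta_v a x0 + (1 - q0 ^ k) * (\<l> / 4)) + (1 - q0) * \<l> / 4"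
      using up(2) Qh(5)[OF XL] mult_left_mono[OF IH, of q0] q0(1) by linarith
    then have "delta_v a (X (Suc k)) \<le> q0 ^ Suc k * delta_v a x0 + (1 - q0 ^ Suc k) * (\<l> / 4)"
      by (simp add: field_simps)
    ultimately show ?case ..
  qed
  have gm: "gamma_maximal (polyP a) \<gamma> (ellipsoid (X (N + 1)) (E (N + 1)))"
  proof -
    have XL: "X N \<in> L" and "delta_v a (X N) \<le> q0 ^ N * delta_v a x0 + (1 - q0 ^ N) * (\<l> / 4)"
      using iter[of N] by auto
    moreover have "q0 ^ N * delta_v a x0 \<le> \<l> / 2"
      unfolding N \<l>_def[symmetric] by (rule power_log_plus_bound[OF q0(1,2) \<delta>0 \<l>])
    moreover have "(1 - q0 ^ N) * (\<l> / 4) \<le> 1 * (\<l> / 4)"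
      using q0 \<l> by (intro mult_right_mono) auto
    \<comment> \<open>One half is left by the contraction and one quarter by the center errors; the
      remaining quarter is kept for the volume error of the last update.\<close>
    ultimately have \<delta>N: "delta_v a (X N) \<le> 3 * \<l> / 4" by linarith
    have XE: "X (N + 1) = centerK (X N) (Qh (X N))" "E (N + 1) = shapeE (Qh (X N))"
      using X_Suc E_Suc by (auto simp: Qh_def)
    note sub = shape_ellipsoid_subset[OF bnd Lint[OF XL] Qh(1)[OF XL], folded XE]
    note db = delta_v_bounds[OF bnd Lint[OF XL]]
    have "\<bar>ln (ellipsoid_vol (ellipsoid (X (N + 1)) (E (N + 1))))
        - ln (ellipsoid_vol (ellipsoid (Kmap a (X N)) (shapeE (Qopt a (X N)))))\<bar> \<le> Lvol * \<eta> (X N)"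
      unfolding XE using Lvol(2) XL Qh[OF XL] by (simp add: L_def \<eta>_def)
    then have "ln (ellipsoid_vol (MaxIE (polyP a))) - \<l> \<le> ln (ellipsoid_vol (ellipsoid (X (N + 1)) (E (N + 1))))"
      using db(2) \<delta>N Qh(6)[OF XL] by linarith
    moreover have "ln (\<gamma> * ellipsoid_vol (MaxIE (polyP a))) = ln (ellipsoid_vol (MaxIE (polyP a))) - \<l>"
      using \<gamma> db(3) by (simp add: \<l>_def ln_mult_pos ln_div)
    ultimately have "ln (\<gamma> * ellipsoid_vol (MaxIE (polyP a))) \<le> ln (ellipsoid_vol (ellipsoid (X (N + 1)) (E (N + 1))))"
      by simp
    then have "\<gamma> * ellipsoid_vol (MaxIE (polyP a)) \<le> ellipsoid_vol (ellipsoid (X (N + 1)) (E (N + 1)))"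
      using \<gamma> db(3) ellipsoid_vol_pos[OF sub(1)] by (subst (asm) ln_le_cancel_iff) auto
    then show ?thesis
      using sub by (auto simp: gamma_maximal_def is_ellipsoid_def)
  qed
  define lz where "lz = ln (1 / \<zeta>)"
  define Jm where "Jm = Max ((\<lambda>k. J (X k)) ` {0..N})"
  define Cm where "Cm = Max ((\<lambda>k. C_WA (X k)) ` {0..N})"
  define B where "B = Jm + 56 * Cm * lz"
  define W where "W = c * m * (n + 1)\<^sup>2"
  have lz: "0 \<le> lz" using \<zeta>_bounds by (simp add: lz_def)
  have Xint: "X k \<in> interior (polyP a)" if "k \<le> N" for k
    using iter[OF that] Lint by blast
  have Jm: "J (X k) \<le> Jm" and Cm: "C_WA (X k) \<le> Cm" if "k \<le> N" for k
    using that by (auto simp: Jm_def Cm_def intro!: Max_ge)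
  \<comment> \<open>\<open>W\<close> inherits its sign from the operation counts, which are natural
    numbers.\<close>
  have W: "0 \<le> W"
    using init_ops by (force simp: W_def m_def n_def intro: order_trans[OF of_nat_0_le_iff])
  have stop_le: "real (stop_time a (X k) \<zeta> (waty (X k))) \<le> B" if "k \<le> N" for k
  proof -
    have "56 * C_WA (X k) * lz \<le> 56 * Cm * lz"
      using Cm[OF that] lz by (intro mult_right_mono) auto
    then show ?thesis
      using stop(2)[OF Xint[OF that]] Jm[OF that] by (simp add: B_def lz_def)
  qed
  have "real (\<Sum>k\<le>N. init_ops k + (\<Sum>t<stop_time a (X k) \<zeta> (waty (X k)). iter_ops k t))
      = (\<Sum>k\<le>N. real (init_ops k) + (\<Sum>t<stop_time a (X k) \<zeta> (waty (X k)). real (iter_ops k t)))"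
    by simp
  \<comment> \<open>Per outer iteration one initialization and at most \<open>B\<close> inner
    iterations, each of cost at most \<open>W\<close>.\<close>
  also have "\<dots> \<le> (\<Sum>k\<le>N. W + B * W)"
  proof (intro sum_mono add_mono)
    fix k assume k: "k \<in> {..N}"
    then show "real (init_ops k) \<le> W" using init_ops by (simp add: W_def m_def n_def)
    have "(\<Sum>t<stop_time a (X k) \<zeta> (waty (X k)). real (iter_ops k t)) \<le> (\<Sum>t<stop_time a (X k) \<zeta> (waty (X k)). W)"
      using iter_ops k by (intro sum_mono) (simp add: W_def m_def n_def)
    also have "\<dots> = real (stop_time a (X k) \<zeta> (waty (X k))) * W" by simp
    also have "\<dots> \<le> B * W" using stop_le[of k] k W by (intro mult_right_mono) auto
    finally show "(\<Sum>t<stop_time a (X k) \<zeta> (waty (X k)). real (iter_ops k t)) \<le> B * W" .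
  qed
  also have "\<dots> = (real N + 1) * W * (1 + B)" by (simp add: algebra_simps)
  \<comment> \<open>The index 0 occurs in the maximum, so \<open>J x0 \<le> B\<close>, and the
    initialization is absorbed as \<open>1 \<le> B / J x0\<close>. The resulting factor
    \<open>c * (1 + 1 / J x0)\<close> does not involve \<open>\<gamma>\<close>.\<close>
  also have "\<dots> \<le> (real N + 1) * W * ((1 + 1 / J x0) * B)"
  proof (intro mult_left_mono)
    have J0: "0 < J x0" using C_J_pos x0 by blast
    have "J x0 \<le> Jm" using Jm[of 0] by (simp add: X_0)
    moreover have "0 < Cm" using Cm[of 0] C_J_pos x0 by (force simp: X_0)
    ultimately have "J x0 \<le> B" using lz by (auto simp: B_def intro: add_increasing2)
    then have "1 \<le> B / J x0" using J0 by simp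
    then show "1 + B \<le> (1 + 1 / J x0) * B" by (simp add: algebra_simps)
    show "0 \<le> (real N + 1) * W" using W by simp
  qed
  finally have "real (\<Sum>k\<le>N. init_ops k + (\<Sum>t<stop_time a (X k) \<zeta> (waty (X k)). iter_ops k t))
      \<le> c * (1 + 1 / J x0) * ((real N + 1) * m * (n + 1)\<^sup>2 * B)"
    by (simp add: W_def mult_ac)
  then show ?thesis
    using gm unfolding B_def Jm_def Cm_def lz_def m_def n_def by blast
qed

end
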